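(* Let $E$ be a complex Banach space, let $p,q,p',q'\in\mathbb{N}_{>0}$ and let $k,l>0$ be real numbers. The following statements hold: (1) If $\max\{p/p',q/q'\}<l/k$ then $E\{x_1,x_2\}^{(p,q)}_{1/k}\cap E[[x_1,x_2]]^{(p',q')}_{1/l}=E\{x_1,x_2\}$. (2) $E\{x_1,x_2\}^{(p,q)}_{1/k}\cap E\{x_1,x_2\}^{(p',q')}_{1/l}=E\{x_1,x_2\}$, except in the case $p/p'=q/q'=l/k$, where $E\{x_1,x_2\}^{(p,q)}_{1/k}=E\{x_1,x_2\}^{(p',q')}_{1/l}$.
   Context: $\mathbb{N}$ contains $0$ and $\mathbb{N}_{>0}=\mathbb{N}\setminus\{0\}$. $(E,\|\cdot\|)$ is a complex Banach space, $D_r\subset\mathbb{C}$ is the open disk of radius $r$ centered at $0$, $\mathcal{O}_b(U,E)$ is the space of bounded holomorphic $E$-valued maps on $U$. $E[[x_1,x_2]]$ denotes formal power series with coefficients in $E$ and $E\{x_1,x_2\}$ the convergent ones. Formal decomposition. Fix $p,q\in\mathbb{N}_{>0}$. Any $\hat f=\sum a_{n,m}x_1^nx_2^m$ is written uniquely as $\hat f=\sum_{n\ge0} f_n(x_1,x_2)(x_1^px_2^q)^n$ with $f_n=\sum_{m<p\text{ or }j<q}a_{np+m,nq+j}x_1^mx_2^j$. Let $\mathcal{C}=\bigcup_{r>0}\mathcal{C}_r$, $\mathcal{C}_r=\mathcal{O}_b(D_r,E)[[x_1]]\cap\mathcal{O}_b(D_r,E)[[x_2]]$ (coefficients being functions of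 the other variable). Let $\mathcal{E}^{(p,q)}_r$ be the Banach space (sup norm) of $g\in\mathcal{O}_b(D_r^2,E)$ with $\frac{\partial^{n+m}g}{\partial x_1^n\partial x_2^m}(0,0)=0$ whenever both $n\ge p$ and $m\ge q$. For $\hat f\in\mathcal{C}$ put $\hat T_{p,q}(\hat f)=\sum f_nt^n$, which lies in $\mathcal{E}^{(p,q)}_r[[t]]$ for some $r>0$. Gevrey series. For $s\ge0$, a series $\sum b_nt^n$ with coefficients in a Banach space is $s$-Gevrey if $\|b_n\|\le CA^nn!^s$ for some $C,A>0$ and all $n$. $E[[x_1,x_2]]^{(p,q)}_s$ is the set of $\hat f\in\mathcal{C}$ such that for some $r>0$, $\hat T_{p,q}(\hat f)\in\mathcal{E}^{(p,q)}_r[[t]]$ and it is $s$-Gevrey in $t$. Monomial sectors. $\Pi_{p,q}(a,b,r)=\{(x_1,x_2): 0<|x_1|^p,|x_2|^q<r,\ a<\arg(x_1^px_2^q)<b\}$. As usual for sectors, $x_1,x_2$ are taken on the Riemann surface of the logarithm and $\arg(x_1^px_2^q)=p\arg x_1+q\arg x_2$. A proper subsector is $\Pi_{p,q}(a',b',\rho)$ with $a<a'<b'<b$, $0<\rho<r$. Asymptotics. For $f$ holomorphic on $\Pi_{p,q}(a,b,r)$ with values in $E$, $\hat f\in\mathcal{C}$ and $s\ge 0$, $f\sim^{(p,q)}_s\hat f$ means: there is $0<r'\le r$ with $\hat T_{p,q}(\hat f)=\sum f_nt^n\in\mathcal{E}^{(p,q)}_{r'}[[t]]$ and for every proper subsector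 $\Pi'=\Pi_{p,q}(a',b',\rho)$ with $\rho<r'$ contained in $\{|x_1|,|x_2|<r'\}$ there are $C,A>0$ such that for all $N\in\mathbb{N}$, $\|f-\sum_{n<N}f_n\,(x_1^px_2^q)^n\|\le CA^NN!^s|x_1^px_2^q|^N$ on $\Pi'$. Summability. For $k>0$, $\hat f\in\mathcal{C}$ is $k$-summable in $x_1^px_2^q$ in direction $d$ if there are $a<b$, $r>0$ with $(a+b)/2=d$, $b-a>\pi/k$ and $f$ holomorphic on $\Pi_{p,q}(a,b,r)$ with $f\sim^{(p,q)}_{1/k}\hat f$. It is $k$-summable in $x_1^px_2^q$ if this holds for every direction $d$ with finitely many exceptions mod $2\pi$. $E\{x_1,x_2\}^{(p,q)}_{1/k}$ is the set of series $k$-summable in $x_1^px_2^q$. *)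

theory Defs
  imports "HOL-Analysis.Analysis"
begin

section \<open>Complex normed spaces and holomorphic maps between them\<close>

class complex_normed_vector = real_normed_vector +
  fixes scaleC :: "complex \<Rightarrow> 'a \<Rightarrow> 'a"  (infixr "*\<^sub>C" 75)
  assumes scaleC_add_right: "c *\<^sub>C (x + y) = c *\<^sub>C x + c *\<^sub>C y"
    and scaleC_add_left: "(c + d) *\<^sub>C x = c *\<^sub>C x + d *\<^sub>C x"
    and scaleC_scaleC: "c *\<^sub>C d *\<^sub>C x = (c * d) *\<^sub>C x"
    and scaleC_of_real: "complex_of_real t *\<^sub>C x = t *\<^sub>R x"
    and norm_scaleC: "norm (c *\<^sub>C x) = cmod c * norm x"

class complex_banach = complex_normed_vector + banach

instantiation complex :: complex_normed_vector
begin

definition scaleC_complex :: "complex \<Rightarrow> complex \<Rightarrow> complex" where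
  "scaleC_complex c x = c * x"

instance
  by standard (simp_all add: scaleC_complex_def algebra_simps norm_mult scaleR_conv_of_real)

end

instance complex :: complex_banach ..

instantiation prod :: (complex_normed_vector, complex_normed_vector) complex_normed_vector
begin

definition scaleC_prod :: "complex \<Rightarrow> 'a \<times> 'b \<Rightarrow> 'a \<times> 'b" where
  "scaleC_prod c x = (c *\<^sub>C fst x, c *\<^sub>C snd x)"

instance
proof
  fix c d :: complex and t :: real and x y :: "'a \<times> 'b"
  show "c *\<^sub>C (x + y) = c *\<^sub>C x + c *\<^sub>C y"
    by (simp add: scaleC_prod_def scaleC_add_right)
  show "(c + d) *\<^sub>C x = c *\<^sub>C x + d *\<^sub>C x"
    by (simp add: scaleC_prod_def scaleC_add_left)
  show "c *\<^sub>C d *\<^sub>C x = (c * d) *\<^sub>C x"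
    by (simp add: scaleC_prod_def scaleC_scaleC)
  show "complex_of_real t *\<^sub>C x = t *\<^sub>R x"
    by (simp add: scaleC_prod_def scaleC_of_real scaleR_prod_def)
  have "norm (c *\<^sub>C x) = sqrt ((cmod c)\<^sup>2 * ((norm (fst x))\<^sup>2 + (norm (snd x))\<^sup>2))"
    by (simp add: scaleC_prod_def norm_prod_def norm_scaleC power_mult_distrib distrib_left)
  then show "norm (c *\<^sub>C x) = cmod c * norm x"
    by (simp add: norm_prod_def real_sqrt_mult)
qed

end

text \<open>Holomorphic means Frechet differentiable with complex-linear derivative; the sets below
  are all open. The library's \<open>holomorphic_on\<close> only covers maps from
  \<^typ>\<open>complex\<close> to \<^typ>\<open>complex\<close>.\<close>

definition holomorphic_map ::
    "'a::complex_normed_vector set \<Rightarrow> ('a \<Rightarrow> 'b::complex_normed_vector) \<Rightarrow> bool" where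
  "holomorphic_map U f \<longleftrightarrow>
     (\<forall>x\<in>U. \<exists>D. (f has_derivative D) (at x) \<and> (\<forall>c h. D (c *\<^sub>C h) = c *\<^sub>C D h))"

definition bounded_holomorphic ::
    "'a::complex_normed_vector set \<Rightarrow> ('a \<Rightarrow> 'b::complex_normed_vector) set" where
  "bounded_holomorphic U = {f. holomorphic_map U f \<and> bounded (f ` U)}"

definition complex_deriv :: "(complex \<Rightarrow> 'e::complex_normed_vector) \<Rightarrow> complex \<Rightarrow> 'e" where
  "complex_deriv f z = (THE v. (f has_derivative (\<lambda>h. h *\<^sub>C v)) (at z))"

definition partial_1 ::
    "(complex \<times> complex \<Rightarrow> 'e::complex_normed_vector) \<Rightarrow> complex \<times> complex \<Rightarrow> 'e" where
  "partial_1 g = (\<lambda>(x1, x2). complex_deriv (\<lambda>z. g (z, x2)) x1)"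

definition partial_2 ::
    "(complex \<times> complex \<Rightarrow> 'e::complex_normed_vector) \<Rightarrow> complex \<times> complex \<Rightarrow> 'e" where
  "partial_2 g = (\<lambda>(x1, x2). complex_deriv (\<lambda>z. g (x1, z)) x2)"


section \<open>Formal power series in two variables\<close>

text \<open>An element of \<open>E[[x1,x2]]\<close> is its array of coefficients: \<open>a n m\<close> is the coefficient of
  \<open>x1^n x2^m\<close>.\<close>

type_synonym 'e series2 = "nat \<Rightarrow> nat \<Rightarrow> 'e"

definition polydisc :: "real \<Rightarrow> (complex \<times> complex) set" where
  "polydisc r = ball 0 r \<times> ball 0 r"

definition convergent_series2 :: "'e::complex_banach series2 set" where
  "convergent_series2 =
     {a. \<exists>r>0. \<forall>(x1, x2)\<in>polydisc r. (\<lambda>(n, m). (x1 ^ n * x2 ^ m) *\<^sub>C a n m) summable_on UNIV}"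

text \<open>A formal series is identified with the holomorphic function on a (poly)disc of which it is
  the convergent power series expansion at the origin.\<close>

definition expands_1 :: "real \<Rightarrow> (nat \<Rightarrow> 'e::complex_banach) \<Rightarrow> (complex \<Rightarrow> 'e) \<Rightarrow> bool" where
  "expands_1 r c g \<longleftrightarrow> (\<forall>z\<in>ball 0 r. (\<lambda>m. z ^ m *\<^sub>C c m) sums g z)"

definition expands_2 ::
    "real \<Rightarrow> 'e::complex_banach series2 \<Rightarrow> (complex \<times> complex \<Rightarrow> 'e) \<Rightarrow> bool" where
  "expands_2 r c g \<longleftrightarrow>
     (\<forall>(x1, x2)\<in>polydisc r. ((\<lambda>(m, j). (x1 ^ m * x2 ^ j) *\<^sub>C c m j) has_sum g (x1, x2)) UNIV)"

text \<open>The first condition is membership in \<open>O_b(D_r,E)[[x1]]\<close>, the second one membership in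
  \<open>O_b(D_r,E)[[x2]]\<close>.\<close>

definition series_C_at :: "real \<Rightarrow> 'e::complex_banach series2 set" where
  "series_C_at r =
     {a. (\<forall>n. \<exists>g\<in>bounded_holomorphic (ball 0 r). expands_1 r (\<lambda>m. a n m) g) \<and>
         (\<forall>m. \<exists>g\<in>bounded_holomorphic (ball 0 r). expands_1 r (\<lambda>n. a n m) g)}"

definition series_C :: "'e::complex_banach series2 set" where
  "series_C = (\<Union>r\<in>{0<..}. series_C_at r)"


section \<open>Decomposition with respect to a monomial\<close>

text \<open>The coefficient array of \<open>f_n\<close> in \<open>\<Sum>n. f_n(x1,x2) (x1^p x2^q)^n\<close>.\<close>

definition monomial_part :: "nat \<Rightarrow> nat \<Rightarrow> 'e::complex_banach series2 \<Rightarrow> nat \<Rightarrow> 'e series2" where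
  "monomial_part p q a n = (\<lambda>m j. if m < p \<or> j < q then a (n * p + m) (n * q + j) else 0)"

definition space_E ::
    "nat \<Rightarrow> nat \<Rightarrow> real \<Rightarrow> (complex \<times> complex \<Rightarrow> 'e::complex_banach) set" where
  "space_E p q r =
     {g \<in> bounded_holomorphic (polydisc r).
        \<forall>n\<ge>p. \<forall>m\<ge>q. (partial_1 ^^ n) ((partial_2 ^^ m) g) (0, 0) = 0}"

definition sup_norm :: "real \<Rightarrow> (complex \<times> complex \<Rightarrow> 'e::complex_banach) \<Rightarrow> real" where
  "sup_norm r g = (SUP x\<in>polydisc r. norm (g x))"

text \<open>\<open>monomial_expansion p q r a F\<close>: the series \<open>\<Sum>n. f_n t^n\<close> attached to \<open>a\<close> lies in
  \<open>space_E p q r [[t]]\<close>, and \<open>F n\<close> is \<open>f_n\<close> as a function on the polydisc. The values of \<open>F n\<close>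
  on \<open>polydisc r\<close> are uniquely determined.\<close>

definition monomial_expansion ::
    "nat \<Rightarrow> nat \<Rightarrow> real \<Rightarrow> 'e::complex_banach series2 \<Rightarrow> (nat \<Rightarrow> complex \<times> complex \<Rightarrow> 'e) \<Rightarrow> bool"
  where
  "monomial_expansion p q r a F \<longleftrightarrow>
     (\<forall>n. F n \<in> space_E p q r \<and> expands_2 r (monomial_part p q a n) (F n))"

definition gevrey :: "('b \<Rightarrow> real) \<Rightarrow> real \<Rightarrow> (nat \<Rightarrow> 'b) \<Rightarrow> bool" where
  "gevrey nrm s b \<longleftrightarrow> (\<exists>C>0. \<exists>A>0. \<forall>n. nrm (b n) \<le> C * A ^ n * fact n powr s)"

definition gevrey_series2 :: "nat \<Rightarrow> nat \<Rightarrow> real \<Rightarrow> 'e::complex_banach series2 set" where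
  "gevrey_series2 p q s =
     {a \<in> series_C. \<exists>r>0. \<exists>F. monomial_expansion p q r a F \<and> gevrey (sup_norm r) s F}"


section \<open>Monomial sectors, asymptotic expansions and summability\<close>

text \<open>The Riemann surface of the logarithm is modelled by the complex plane with covering map
  \<^const>\<open>exp\<close>: the number \<open>w\<close> stands for the point over \<open>exp w\<close> with argument \<open>Im w\<close>.
  Hence monomial sectors consist of pairs of logarithms.\<close>

definition monomial_sector ::
    "nat \<Rightarrow> nat \<Rightarrow> real \<Rightarrow> real \<Rightarrow> real \<Rightarrow> (complex \<times> complex) set" where
  "monomial_sector p q \<alpha> \<beta> r =
     {(w1, w2). cmod (exp w1) ^ p < r \<and> cmod (exp w2) ^ q < r \<and>
                \<alpha> < real p * Im w1 + real q * Im w2 \<and> real p * Im w1 + real q * Im w2 < \<beta>}"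

definition gevrey_asymptotic ::
    "nat \<Rightarrow> nat \<Rightarrow> real \<Rightarrow> real \<Rightarrow> real \<Rightarrow> real \<Rightarrow> (complex \<times> complex \<Rightarrow> 'e::complex_banach)
      \<Rightarrow> 'e series2 \<Rightarrow> bool" where
  "gevrey_asymptotic p q s \<alpha> \<beta> r f a \<longleftrightarrow>
     (\<exists>r'. 0 < r' \<and> r' \<le> r \<and> (\<exists>F. monomial_expansion p q r' a F \<and>
       (\<forall>\<alpha>' \<beta>' \<rho>. \<alpha> < \<alpha>' \<and> \<alpha>' < \<beta>' \<and> \<beta>' < \<beta> \<and> 0 < \<rho> \<and> \<rho> < r' \<and>
          (\<forall>(w1, w2)\<in>monomial_sector p q \<alpha>' \<beta>' \<rho>. (exp w1, exp w2) \<in> polydisc r') \<longrightarrow>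
          (\<exists>C>0. \<exists>A>0. \<forall>N. \<forall>(w1, w2)\<in>monomial_sector p q \<alpha>' \<beta>' \<rho>.
             norm (f (w1, w2) - (\<Sum>n<N. (exp w1 ^ p * exp w2 ^ q) ^ n *\<^sub>C F n (exp w1, exp w2)))
               \<le> C * A ^ N * fact N powr s * cmod (exp w1 ^ p * exp w2 ^ q) ^ N))))"

definition summable_in_direction ::
    "nat \<Rightarrow> nat \<Rightarrow> real \<Rightarrow> real \<Rightarrow> 'e::complex_banach series2 \<Rightarrow> bool" where
  "summable_in_direction p q k d a \<longleftrightarrow>
     (\<exists>\<alpha> \<beta> r f. \<alpha> < \<beta> \<and> 0 < r \<and> (\<alpha> + \<beta>) / 2 = d \<and> \<beta> - \<alpha> > pi / k \<and>
        holomorphic_map (monomial_sector p q \<alpha> \<beta> r) f \<and>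
        gevrey_asymptotic p q (1 / k) \<alpha> \<beta> r f a)"

text \<open>The set \<open>D\<close> contains representatives modulo \<open>2 * pi\<close> of the exceptional directions.\<close>

definition summable_series2 :: "nat \<Rightarrow> nat \<Rightarrow> real \<Rightarrow> 'e::complex_banach series2 set" where
  "summable_series2 p q k =
     {a \<in> series_C. \<exists>D. finite D \<and>
        (\<forall>d. (\<forall>e\<in>D. \<forall>j::int. d \<noteq> e + 2 * pi * of_int j) \<longrightarrow> summable_in_direction p q k d a)}"

end

theory Submission
  imports Defs "HOL-Complex_Analysis.Complex_Analysis" "HOL-Real_Asymp.Real_Asymp"
begin

text \<open>Writing \<open>a n m\<close> for the coefficients, \<open>gevrey_coeffs \<sigma> a\<close> says that \<open>a n m\<close> grows at most like
  \<open>K^(n+m) (n!)^\<sigma>\<close>. A series is \<open>s\<close>-Gevrey in \<open>x1^p x2^q\<close> iff it satisfies this with exponent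
  \<open>s/p\<close> in the first and with exponent \<open>s/q\<close> in the second variable, and \<open>k\<close>-summability implies
  these bounds for \<open>s = 1/k\<close>. The core is Tauberian: if \<open>a\<close> is \<open>k\<close>-summable in \<open>x1^p x2^q\<close> and the
  exponent \<open>1/(k p)\<close> in the first variable can be replaced by some \<open>\<sigma> < 1/(k p)\<close>, then \<open>a\<close> converges.

  To see this, fix \<open>x2\<close> on a small circle and put \<open>x1 = exp (\<mu> w)\<close> with \<open>\<mu> = 1/(k p)\<close>. The sums in
  the directions of summability then become holomorphic functions on half-strips of height
  exceeding \<open>\<pi>\<close> which are \<open>\<mu>\<close>-Gevrey asymptotic to the resulting series in \<open>x1\<close>, so its Borel transform
  is of exponential size \<open>exp (K y^(1/\<mu>))\<close> on the rays in these directions. The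
  smaller exponent \<open>\<sigma>\<close> makes this Borel transform entire of order at most \<open>1/(\<mu>-\<sigma>)\<close>. Only finitely
  many directions modulo \<open>2\<pi>\<close> are exceptional, so finitely many good rays cut the plane into sectors
  narrow enough for the Phragmen-Lindelof principle, and the Borel transform has order \<open>1/\<mu>\<close>
  everywhere. Cauchy's estimates for it and for the dependence on \<open>x2\<close> give geometric
  bounds for \<open>a n m\<close>.

  Unless \<open>p/p' = q/q' = l/k\<close>, one of the two summability conditions provides the smaller exponent
  required by the other one, in one of the variables. If these ratios agree, then \<open>x1^p x2^q\<close> is formally the power
  of \<open>x1^p' x2^q'\<close> with exponent \<open>l/k\<close>, the same sums serve for both notions, and partial sums
  of the two decompositions differ by terms of the order of the remainder.\<close>

section \<open>Post-Widder inversion\<close>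

text \<open>The Borel transform is bounded on rays by Post-Widder inversion because this formula
  sees the sum only through derivatives at the single point n/x, so Cauchy's formula on one circle
  replaces an inversion contour. The disc around n/x reaching to a fixed distance from the origin
  approximates a half-plane; the surplus of the opening over pi is the room left for rotating x. A
  bound uniform in n requires integrating the decay |v|^-2 exactly over the circle: its maximum
  there would lose a factor of order n.

  The other constraint is uniformity. The one-variable result is applied to every functional of norm
  at most one and to every x2 on a circle, so its constant must be fixed before the series, and the
  size C of the data may enter only linearly; this explains the order of the quantifiers. All
  coefficient bounds tolerate geometric factors. Hence Stirling's formula is needed only up to c^n,
  and rounding indices to multiples of p is harmless.\<close>

lemma has_contour_integral_circlepathD:
  assumes "(f has_contour_integral I) (circlepath z r)"
  shows "((\<lambda>t. f (z + of_real r * exp (2 * of_real pi * \<i> * of_real t))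
            * (2 * of_real pi * \<i> * of_real r * exp (2 * of_real pi * \<i> * of_real t)))
          has_integral I) {0..1}"
  using assms unfolding has_contour_integral vector_derivative_circlepath
  by (simp add: circlepath mult_ac)

text \<open>The Poisson kernel is the real part of a holomorphic function, whose mean over the circle is
  its value at the centre.\<close>

lemma mean_inverse_square:
  fixes c :: complex
  assumes "0 < R" "R < cmod c"
  shows "((\<lambda>t. 1 / (cmod (c + of_real R * exp (2 * of_real pi * \<i> * of_real t)))\<^sup>2)
           has_integral 1 / ((cmod c)\<^sup>2 - R\<^sup>2)) {0..1}"
proof -
  define e where "e = (\<lambda>t. exp (2 * of_real pi * \<i> * of_real t))"
  have norm_e: "cmod (e t) = 1" for t by (simp add: e_def)
  have nz: "c + z \<noteq> 0" if "cmod z \<le> R" for z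
    using that assms by (metis add.commute add_eq_0_iff leD norm_minus_cancel)
  let ?Q = "\<lambda>z. (c - z) / (c + z)"
  have "((\<lambda>u. ?Q u / (u - 0)) has_contour_integral (2 * of_real pi * \<i> * ?Q 0)) (circlepath 0 R)"
    by (rule Cauchy_integral_circlepath_simple) (use assms nz in \<open>auto intro!: holomorphic_intros\<close>)
  from has_contour_integral_circlepathD[OF this]
  have *: "((\<lambda>t. ?Q (0 + of_real R * e t) / (0 + of_real R * e t - 0)
        * (2 * of_real pi * \<i> * of_real R * e t)) has_integral (2 * of_real pi * \<i> * ?Q 0)) {0..1}"
    unfolding e_def .
  have nz': "c \<noteq> 0" "R \<noteq> 0" "\<And>t. e t \<noteq> 0" using assms by (auto simp: e_def)
  have eq: "q / (0 + of_real R * e t - 0) * (2 * of_real pi * \<i> * of_real R * e t) = 2 * of_real pi * \<i> * q" for q t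
    using nz' by (simp add: field_simps)
  have "((\<lambda>t. ?Q (of_real R * e t)) has_integral 1) {0..1}"
    using has_integral_mult_right[OF *[unfolded eq], of "1 / (2 * of_real pi * \<i>)"] nz'(1) by simp
  from has_integral_linear[OF this bounded_linear_Re]
  have "((\<lambda>t. Re (?Q (of_real R * e t))) has_integral 1) {0..1}" by (simp add: o_def)
  moreover have "Re (?Q z) = ((cmod c)\<^sup>2 - (cmod z)\<^sup>2) * (1 / (cmod (c + z))\<^sup>2)" for z
    unfolding Re_divide cmod_power2 by (simp add: algebra_simps power2_eq_square)
  ultimately have "((\<lambda>t. ((cmod c)\<^sup>2 - R\<^sup>2) * (1 / (cmod (c + of_real R * e t))\<^sup>2)) has_integral 1) {0..1}"
    using assms by (simp add: norm_mult norm_e)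
  then have "((\<lambda>t. 1 / ((cmod c)\<^sup>2 - R\<^sup>2) * (((cmod c)\<^sup>2 - R\<^sup>2) * (1 / (cmod (c + of_real R * e t))\<^sup>2)))
      has_integral 1 / ((cmod c)\<^sup>2 - R\<^sup>2) * 1) {0..1}"
    by (rule has_integral_mult_right)
  moreover have "(cmod c)\<^sup>2 - R\<^sup>2 \<noteq> 0" using assms by (simp add: power2_eq_iff)
  ultimately show ?thesis by (simp add: e_def)
qed

text \<open>Cauchy's formula with the majorant K/|v|^2 integrated exactly over the circle by
  \<open>mean_inverse_square\<close>. For R close to |c| this mean is much smaller than the maximum
  of the majorant, and the gain keeps the Post-Widder bound independent of n.\<close>

lemma deriv_bound_by_mean:
  assumes holf: "f holomorphic_on ball c R'" and R: "0 < R" "R < R'" "R < cmod c"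
    and bd: "\<And>v. v \<in> sphere c R \<Longrightarrow> cmod (f v) \<le> K / (cmod v)\<^sup>2"
  shows "cmod ((deriv ^^ n) f c) \<le> fact n * K / (R ^ n * ((cmod c)\<^sup>2 - R\<^sup>2))"
proof -
  define e where "e = (\<lambda>t. exp (2 * of_real pi * \<i> * of_real t))"
  have norm_e: "cmod (e t) = 1" for t by (simp add: e_def)
  have "continuous_on (cball c R) f" "f holomorphic_on ball c R"
    using R by (auto intro!: holomorphic_on_imp_continuous_on intro: holomorphic_on_subset[OF holf])
  then have "((\<lambda>u. f u / (u - c) ^ Suc n) has_contour_integral
     (2 * pi * \<i> / fact n * (deriv ^^ n) f c)) (circlepath c R)"
    using R by (intro Cauchy_has_contour_integral_higher_derivative_circlepath) auto
  from has_contour_integral_circlepathD[OF this]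
  have 1: "((\<lambda>t. f (c + of_real R * e t) / (of_real R * e t) ^ Suc n
        * (2 * pi * \<i> * of_real R * e t)) has_integral (2 * pi * \<i> / fact n * (deriv ^^ n) f c)) {0..1}"
    by (simp add: e_def)
  have 2: "((\<lambda>t. 2 * pi * K / R ^ n * (1 / (cmod (c + of_real R * e t))\<^sup>2))
       has_integral 2 * pi * K / R ^ n * (1 / ((cmod c)\<^sup>2 - R\<^sup>2))) {0..1}"
    unfolding e_def by (intro has_integral_mult_right mean_inverse_square) (use R in auto)
  have 3: "cmod (f (c + of_real R * e t) / (of_real R * e t) ^ Suc n * (2 * pi * \<i> * of_real R * e t))
     \<le> 2 * pi * K / R ^ n * (1 / (cmod (c + of_real R * e t))\<^sup>2)" for t
  proof -
    have "cmod (f (c + of_real R * e t)) \<le> K / (cmod (c + of_real R * e t))\<^sup>2"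
      using R by (intro bd) (auto simp: dist_norm norm_mult norm_e)
    then have "cmod (f (c + of_real R * e t)) * (2 * pi / R ^ n) \<le> K / (cmod (c + of_real R * e t))\<^sup>2 * (2 * pi / R ^ n)"
      using R by (intro mult_right_mono) auto
    moreover have "e t \<noteq> 0" by (simp add: e_def)
    ultimately show ?thesis using R
      by (simp add: norm_mult norm_divide norm_power norm_e mult_ac)
  qed
  have "cmod (2 * pi * \<i> / fact n * (deriv ^^ n) f c) \<le> 2 * pi * K / R ^ n * (1 / ((cmod c)\<^sup>2 - R\<^sup>2))"
    using has_integral_norm_bound_integral_component[OF 1 2, of 1] 3 by simp
  then have "2 * pi * (cmod ((deriv ^^ n) f c) / fact n) \<le> 2 * pi * (K / (R ^ n * ((cmod c)\<^sup>2 - R\<^sup>2)))"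
    by (simp add: norm_mult norm_divide)
  then have "cmod ((deriv ^^ n) f c) / fact n \<le> K / (R ^ n * ((cmod c)\<^sup>2 - R\<^sup>2))"
    by (simp only: mult_le_cancel_left_pos pi_gt_zero zero_less_mult_iff zero_less_numeral simp_thms)
  then show ?thesis by (simp only: divide_le_eq times_divide_eq_right mult.commute fact_gt_zero split: if_splits)
qed

text \<open>The quotient v/c lies in the unit disc around 1, hence has positive real part and
  argument below pi/2 in modulus. So the discs used in Cauchy's formula, with centres in a sector of
  half-opening \<delta>, stay in the sector of half-opening \<delta> + pi/2 and off the branch cut
  of \<open>Ln\<close>.\<close>

lemma ball_subset_wide_sector:
  assumes c: "c \<noteq> 0" "\<bar>Im (Ln c)\<bar> < \<delta>" "\<delta> \<le> pi / 2" and v: "v \<in> ball c (cmod c - L)" "0 \<le> L"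
  shows "L < cmod v" "v \<notin> \<real>\<^sub>\<le>\<^sub>0" "\<bar>Im (Ln v)\<bar> < \<delta> + pi / 2"
proof -
  have "cmod c - cmod v \<le> cmod (c - v)" by (rule norm_triangle_ineq2)
  then show L: "L < cmod v" using v by (simp add: dist_norm)
  then have v0: "v \<noteq> 0" using v by auto
  define u where "u = v / c"
  have u: "v = u * c" "u \<noteq> 0" using c v0 by (auto simp: u_def)
  have "cmod (c - u * c) < cmod c" using v u by (auto simp: dist_norm)
  moreover have "cmod (c - u * c) = cmod (1 - u) * cmod c"
    by (simp add: algebra_simps flip: norm_mult)
  ultimately have "cmod (1 - u) < 1" using c by simp
  moreover have "Re (1 - u) \<le> cmod (1 - u)" by (rule complex_Re_le_cmod)
  ultimately have "Re u > 0" by simp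
  then have Imu: "\<bar>Im (Ln u)\<bar> < pi / 2" by (rule Re_Ln_pos_lt_imp)
  have Ln: "Ln v = Ln u + Ln c" unfolding u(1) using c u Imu
    by (intro Ln_times_simple) auto
  then show "\<bar>Im (Ln v)\<bar> < \<delta> + pi / 2" using Imu c by auto
  then have "\<bar>Im (Ln v)\<bar> < pi" using c by auto
  then show "v \<notin> \<real>\<^sub>\<le>\<^sub>0" using v0 Im_Ln_eq_pi[of v] by (auto simp: complex_nonpos_Reals_iff)
     (metis Im_Ln_eq_pi abs_of_pos complex_eq_iff less_eq_real_def less_irrefl pi_gt_zero zero_complex.sel(1) zero_complex.sel(2))
qed

text \<open>The n-th Post-Widder approximation of the inverse Laplace transform of \<open>G\<close>,
  taken also at complex \<open>x\<close>; it depends only on the germ of \<open>G\<close> at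
  n/x.\<close>

definition post_widder :: "nat \<Rightarrow> (complex \<Rightarrow> complex) \<Rightarrow> complex \<Rightarrow> complex" where
  "post_widder n G x = (-1) ^ n / fact n * (of_nat n / x) ^ (n + 1) * (deriv ^^ n) G (of_nat n / x)"

lemma higher_deriv_powr_minus:
  fixes z s :: complex
  assumes "z \<notin> \<real>\<^sub>\<le>\<^sub>0"
  shows "(deriv ^^ n) (\<lambda>v. v powr (- s)) z = (-1) ^ n * pochhammer s n * z powr (- s - of_nat n)"
  using assms
proof (induction n arbitrary: z)
  case (Suc n)
  let ?g = "\<lambda>v::complex. (-1) ^ n * pochhammer s n * v powr (- s - of_nat n)"
  have "open (- \<real>\<^sub>\<le>\<^sub>0 :: complex set)" by (simp add: open_Compl)
  then have "eventually (\<lambda>v. (deriv ^^ n) (\<lambda>v. v powr (- s)) v = ?g v) (nhds z)"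
    using Suc by (auto simp: eventually_nhds)
  then have "deriv ((deriv ^^ n) (\<lambda>v. v powr (- s))) z = deriv ?g z" by (rule deriv_cong_ev) simp
  also have "\<dots> = (-1) ^ n * pochhammer s n * ((- s - of_nat n) * z powr (- s - of_nat n - 1))"
    using Suc.prems by (intro DERIV_imp_deriv) (auto intro!: derivative_eq_intros)
  also have "\<dots> = (-1) ^ Suc n * pochhammer s (Suc n) * z powr (- s - of_nat (Suc n))"
    by (simp add: pochhammer_Suc algebra_simps)
  finally show ?case by simp
qed simp

text \<open>On the power v^(-z-1), the Laplace transform of x^z / Gamma(1+z), the operator can be
  evaluated: what multiplies x^z is, up to a factor tending to 1, the approximant
  \<open>rGamma_series\<close> of 1/Gamma(z+1).\<close>

lemma post_widder_powr:
  assumes "x > 0" "n > 0" "z \<ge> 0"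
  shows "post_widder n (\<lambda>v. v powr (- of_real (z + 1))) (of_real x)
     = of_real (x powr z * (rGamma_series (z + 1) n * (real n / (z + 1 + real n))))"
proof -
  define c where "c = real n / x"
  have c: "c > 0" using assms by (simp add: c_def)
  have "complex_of_real c \<notin> \<real>\<^sub>\<le>\<^sub>0" using c by (auto simp: complex_nonpos_Reals_iff)
  then have "(deriv ^^ n) (\<lambda>v. v powr (- of_real (z + 1))) (complex_of_real c)
      = (-1) ^ n * pochhammer (of_real (z + 1)) n * of_real c powr (- of_real (z + 1) - of_nat n)"
    by (rule higher_deriv_powr_minus)
  also have "of_real c powr (- of_real (z + 1) - of_nat n) = complex_of_real (c powr (- (z + 1) - real n))"
    using c by (subst powr_of_real[symmetric]) auto
  finally have "post_widder n (\<lambda>v. v powr (- of_real (z + 1))) (of_real x)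
     = (-1) ^ n / fact n * of_real c ^ (n + 1) *
       ((-1) ^ n * pochhammer (of_real (z + 1)) n * complex_of_real (c powr (- (z + 1) - real n)))"
    unfolding post_widder_def c_def by simp
  also have "\<dots> = of_real (pochhammer (z + 1) n / fact n * (c ^ (n + 1) * c powr (- (z + 1) - real n)))"
    unfolding pochhammer_of_real by (simp flip: power_mult_distrib)
  also have "c ^ (n + 1) = c powr (real n + 1)" using c by (simp add: powr_add powr_realpow)
  also have "c powr (real n + 1) * c powr (- (z + 1) - real n) = c powr (- z)"
    by (simp flip: powr_add)
  also have "c powr (- z) = x powr z * real n powr (- z)"
    using assms by (simp add: c_def powr_divide powr_minus field_simps)
  also have "pochhammer (z + 1) n / fact n * (x powr z * real n powr (- z))
     = x powr z * (rGamma_series (z + 1) n * (real n / (z + 1 + real n)))"   proof -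
    define a where "a = z + 1 + real n"
    have "exp ((z + 1) * ln (real n)) = real n powr z * real n"
      using assms by (simp add: powr_def distrib_right exp_add)
    moreover have "pochhammer (z + 1) (n + 1) = pochhammer (z + 1) n * a"
      by (simp add: pochhammer_Suc a_def)
    moreover have "real n powr z > 0" "a > 0" using assms by (auto simp: a_def)
    ultimately show ?thesis using assms unfolding rGamma_series_def a_def[symmetric] powr_minus
      by (simp add: divide_simps)
  qed
  finally show ?thesis .
qed

lemma post_widder_powr_tendsto:
  assumes "x > 0" "z \<ge> 0"
  shows "(\<lambda>n. post_widder n (\<lambda>v. v powr (- of_real (z + 1))) (of_real x))
           \<longlonglongrightarrow> of_real (x powr z / Gamma (1 + z))"
proof -
  have "(\<lambda>n. real n / (z + 1 + real n)) \<longlonglongrightarrow> 1" by real_asymp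
  then have "(\<lambda>n. x powr z * (rGamma_series (z + 1) n * (real n / (z + 1 + real n))))
     \<longlonglongrightarrow> x powr z * (rGamma (z + 1) * 1)"
    by (intro tendsto_intros)
  then have "(\<lambda>n. complex_of_real (x powr z * (rGamma_series (z + 1) n * (real n / (z + 1 + real n)))))
     \<longlonglongrightarrow> of_real (x powr z * (rGamma (z + 1) * 1))"
    by (rule tendsto_of_real)
  then have "(\<lambda>n. complex_of_real (x powr z * (rGamma_series (z + 1) n * (real n / (z + 1 + real n)))))
     \<longlonglongrightarrow> of_real (x powr z / Gamma (1 + z))"
    by (simp add: rGamma_inverse_Gamma divide_inverse add.commute)
  moreover have "\<forall>\<^sub>F n in sequentially.
      complex_of_real (x powr z * (rGamma_series (z + 1) n * (real n / (z + 1 + real n))))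
      = post_widder n (\<lambda>v. v powr (- of_real (z + 1))) (of_real x)"
    using eventually_gt_at_top[of 0] by eventually_elim (simp only: post_widder_powr[OF assms(1) _ assms(2)])
  ultimately show ?thesis by (rule Lim_transform_eventually)
qed

text \<open>The circle around c = n/x passes at distance L from the origin. With t = L/|c| the
  powers of its radius contribute (1-t)^(-n), which is at most exp(2 t n) = exp(2 L |x|) once t
  \<le> 1/2; this is the condition on n. The gap between L0 and L places the closed disc inside the
  domain of \<open>G\<close>.\<close>

lemma post_widder_bound:
  assumes n: "2 * L * cmod x \<le> real n" and x: "x \<noteq> 0" and L: "0 \<le> L0" "L0 < L" and K: "K \<ge> 0"
    and holG: "G holomorphic_on ball (of_nat n / x) (cmod (of_nat n / x) - L0)"
    and bd: "\<And>v. v \<in> ball (of_nat n / x) (cmod (of_nat n / x) - L0) \<Longrightarrow> L \<le> cmod v \<Longrightarrow> cmod (G v) \<le> K / (cmod v)\<^sup>2"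
  shows "cmod (post_widder n G x) \<le> K / L * exp (2 * L * cmod x)"
proof -
  define c where "c = of_nat n / x"
  define R where "R = cmod c - L"
  define t where "t = L / cmod c"
  have n0: "n > 0" using n x L by (intro Nat.gr0I) (auto simp: mult_le_0_iff)
  have cn: "cmod c = real n / cmod x" by (simp add: c_def norm_divide)
  have c: "2 * L \<le> cmod c" using n x by (simp add: cn field_simps)
  have R: "0 < R" "R < cmod c - L0" "R < cmod c" using c L by (auto simp: R_def)
  have cpos: "cmod c > 0" using c L by linarith
  have t: "0 \<le> t" "t \<le> 1 / 2" using c cpos L by (auto simp: t_def divide_le_eq)
  have R_eq: "R = cmod c * (1 - t)" using cpos by (simp add: R_def t_def field_simps)
  have "cmod ((deriv ^^ n) G c) \<le> fact n * K / (R ^ n * ((cmod c)\<^sup>2 - R\<^sup>2))"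
  proof (rule deriv_bound_by_mean[OF holG[folded c_def] R])
    fix v assume v: "v \<in> sphere c R"
    have "cmod c - cmod v \<le> cmod (c - v)" by (rule norm_triangle_ineq2)
    then have "L \<le> cmod v" using v by (simp add: dist_norm R_def)
    then show "cmod (G v) \<le> K / (cmod v)\<^sup>2" using v R by (intro bd) (auto simp: c_def)
  qed
  also have "\<dots> \<le> fact n * K / (R ^ n * (L * cmod c))"
  proof -
    have "(cmod c)\<^sup>2 - R\<^sup>2 = L * (2 * cmod c - L)" by (simp add: R_def power2_eq_square algebra_simps)
    also have "\<dots> \<ge> L * cmod c" using L c by (intro mult_left_mono) auto
    finally have le: "L * cmod c \<le> (cmod c)\<^sup>2 - R\<^sup>2" .
    have "0 < L * cmod c" using L cpos by simp
    with le have "0 < (cmod c)\<^sup>2 - R\<^sup>2" by linarith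
    then show ?thesis using R L K cpos le
      by (intro divide_left_mono mult_left_mono mult_pos_pos) auto
  qed
  finally have D: "cmod ((deriv ^^ n) G c) \<le> fact n * K / (R ^ n * (L * cmod c))" .
  have "cmod (post_widder n G x) = 1 / fact n * cmod c ^ (n + 1) * cmod ((deriv ^^ n) G c)"
    by (simp add: post_widder_def c_def norm_mult norm_divide norm_power)
  also have "\<dots> \<le> 1 / fact n * cmod c ^ (n + 1) * (fact n * K / (R ^ n * (L * cmod c)))"
    by (intro mult_left_mono D) auto
  also have "\<dots> = K / L * (1 / (1 - t)) ^ n"
    using R cpos L t by (simp add: R_eq power_mult_distrib power_divide)
  also have "\<dots> \<le> K / L * exp (2 * t) ^ n"
  proof -
    have "0 \<le> t * (1 - 2 * t)" using t by simp
    then have "1 \<le> (1 - t) * (1 + 2 * t)" by (simp add: algebra_simps)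
    also have "\<dots> \<le> (1 - t) * exp (2 * t)" using t by (intro mult_left_mono) auto
    finally have "1 / (1 - t) \<le> exp (2 * t)" using t by (simp add: field_simps)
    then show ?thesis using K L t by (intro mult_left_mono power_mono) auto
  qed
  also have "exp (2 * t) ^ n = exp (2 * L * cmod x)"
    using n0 x by (simp add: t_def cn field_simps flip: exp_of_nat_mult)
  finally show ?thesis .
qed

section \<open>Factorials and the Gamma function\<close>

lemma power_self_le_exp_fact: "real n ^ n \<le> exp (real n) * fact n"
proof -
  have "(\<lambda>k. real n ^ k /\<^sub>R fact k) sums exp (real n)" by (rule exp_converges)
  then have s: "summable (\<lambda>k. real n ^ k /\<^sub>R fact k)" "(\<Sum>k. real n ^ k /\<^sub>R fact k) = exp (real n)"
    by (auto simp: sums_iff)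
  have "(\<Sum>k\<in>{n}. real n ^ k /\<^sub>R fact k) \<le> (\<Sum>k. real n ^ k /\<^sub>R fact k)"
    by (rule sum_le_suminf[OF s(1)]) auto
  then show ?thesis using s(2) by (simp add: field_simps)
qed

lemma fact_le_power_self: "(fact n :: real) \<le> real n ^ n"
  using fact_le_power[of n, where 'a = real] by simp

text \<open>The comparison is made at Gamma(2+x) = (1+x) Gamma(1+x), because Gamma is increasing
  only to the right of its minimum, which lies between 1 and 2.\<close>

lemma Gamma_between_fact:
  fixes x :: real
  assumes "x \<ge> 0"
  shows "fact (nat \<lfloor>x\<rfloor> + 1) \<le> (1 + x) * Gamma (1 + x)" "Gamma (1 + x) \<le> fact (nat \<lfloor>x\<rfloor> + 2)"
proof -
  define j where "j = nat \<lfloor>x\<rfloor>"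
  have j: "real j \<le> x" "x < real j + 1" using assms unfolding j_def by linarith+
  have G: "Gamma (2 + x) = (1 + x) * Gamma (1 + x)"
    using Gamma_plus1[of "1 + x"] assms by (simp add: nonpos_Ints_def add_ac)
  have mono: "Gamma y \<le> Gamma z" if "y \<ge> 2" "y \<le> z" for y z :: real
    using Gamma_real_strict_mono[of y z] that by (cases "y = z") auto
  have "Gamma (2 + real j) = fact (j + 1)" "Gamma (3 + real j) = fact (j + 2)"
    using Gamma_fact[of "j + 1", where 'a = real] Gamma_fact[of "j + 2", where 'a = real] by (simp_all add: add_ac)
  moreover have "Gamma (2 + real j) \<le> Gamma (2 + x)" "Gamma (2 + x) \<le> Gamma (3 + real j)"
    using j by (auto intro!: mono)
  ultimately have *: "fact (j + 1) \<le> Gamma (2 + x)" "Gamma (2 + x) \<le> fact (j + 2)" by auto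
  show "fact (nat \<lfloor>x\<rfloor> + 1) \<le> (1 + x) * Gamma (1 + x)" using * G j_def by simp
  have "0 < Gamma (1 + x)" using assms by (intro Gamma_real_pos) auto
  then have "Gamma (1 + x) \<le> (1 + x) * Gamma (1 + x)" using assms by (simp add: algebra_simps)
  then show "Gamma (1 + x) \<le> fact (nat \<lfloor>x\<rfloor> + 2)" using * G j_def by simp
qed

text \<open>One half of a Stirling formula up to exponential factors, obtained by rounding x to an
  integer; \<open>Gamma_le_powr_self\<close> is the other half. The lost factors exp(c x) become
  geometric for x = n \<mu>.\<close>

lemma powr_self_le_Gamma:
  fixes x :: real
  assumes "x > 0"
  shows "x powr x \<le> exp (1 + 2 * x) * Gamma (1 + x)"
proof -
  define j where "j = nat \<lfloor>x\<rfloor>"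
  have j: "real j \<le> x" "x < real j + 1" using assms unfolding j_def by linarith+
  have "x powr x \<le> (real j + 1) powr x" using j assms by (intro powr_mono2) auto
  also have "\<dots> \<le> (real j + 1) powr (real (j + 1))" using j by (intro powr_mono) auto
  also have "\<dots> = real (j + 1) ^ (j + 1)" by (subst powr_realpow) (auto simp: add.commute)
  also have "\<dots> \<le> exp (real (j + 1)) * fact (j + 1)" by (rule power_self_le_exp_fact)
  also have "\<dots> \<le> exp (1 + x) * ((1 + x) * Gamma (1 + x))"
    using Gamma_between_fact(1)[of x] j assms unfolding j_def by (intro mult_mono) auto
  also have "\<dots> \<le> exp (1 + x) * (exp x * Gamma (1 + x))"
    using assms Gamma_real_pos[of "1 + x"] exp_ge_add_one_self[of x]
    by (intro mult_left_mono mult_right_mono) auto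
  also have "\<dots> = exp (1 + 2 * x) * Gamma (1 + x)" by (simp flip: exp_add mult.assoc)
  finally show ?thesis .
qed

lemma Gamma_le_powr_self:
  fixes x :: real
  assumes "x > 0"
  shows "Gamma (1 + x) \<le> 4 * exp (1 + 2 * x) * x powr x"
proof -
  define j where "j = nat \<lfloor>x\<rfloor>"
  have j: "real j \<le> x" "x < real j + 1" using assms unfolding j_def by linarith+
  have 1: "fact j \<le> exp 1 * x powr x"
  proof (cases "j = 0")
    case True
    \<comment> \<open>Here x < 1 and rounding down to 0 gives nothing; instead x ln x stays above
      -1.\<close>
    have "ln (1 / x) \<le> 1 / x - 1" using assms by (intro ln_le_minus_one) auto
    then have "- 1 \<le> x * ln x" using assms by (simp add: ln_div field_simps)
    then have "exp (-1) \<le> x powr x" using assms by (simp add: powr_def)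
    then have "exp 1 * exp (-1) \<le> exp 1 * x powr x" by (intro mult_left_mono) auto
    then show ?thesis using True by (simp flip: exp_add)
  next
    case False
    then have x1: "x \<ge> 1" using j by linarith
    have "fact j \<le> real j ^ j" by (rule fact_le_power_self)
    also have "\<dots> \<le> x ^ j" using j by (intro power_mono) auto
    also have "\<dots> = x powr real j" using assms by (simp add: powr_realpow)
    also have "\<dots> \<le> x powr x" using x1 j by (intro powr_mono) auto
    also have "\<dots> \<le> exp 1 * x powr x"
      using one_le_exp_iff[of "1::real"] mult_right_mono[of 1 "exp 1" "x powr x"] by simp
    finally show ?thesis .
  qed
  have 2: "real (j + 1) * real (j + 2) \<le> 4 * exp (2 * x)"
  proof -
    have "real j + 2 \<le> 2 * exp x" using j exp_ge_add_one_self[of x] assms by linarith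
    then have "real (j + 1) * real (j + 2) \<le> (2 * exp x) * (2 * exp x)"
      by (intro mult_mono) auto
    then show ?thesis by (simp flip: exp_add)
  qed
  have "Gamma (1 + x) \<le> fact (j + 2)" using Gamma_between_fact(2)[of x] assms j_def by simp
  also have "\<dots> = (real (j + 1) * real (j + 2)) * fact j" by (simp add: algebra_simps)
  also have "\<dots> \<le> (4 * exp (2 * x)) * (exp 1 * x powr x)"
    by (rule mult_mono[OF 2 1]) auto
  also have "\<dots> = 4 * exp (1 + 2 * x) * x powr x" by (simp add: exp_add)
  finally show ?thesis .
qed

text \<open>Both sides are (n \<mu>)^(n \<mu>) up to geometric factors. With the converse
  \<open>Gamma_le_fact_powr\<close>, dividing by Gamma(1 + n \<mu>) is as good as dividing by
  (n!)^\<mu> in the estimates of Borel transforms.\<close>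

lemma fact_powr_le_Gamma:
  assumes "\<mu> > 0"
  obtains K c where "K > 0" "c > 0" "\<And>n. fact n powr \<mu> \<le> K * c ^ n * Gamma (1 + real n * \<mu>)"
proof
  show "exp 1 > (0::real)" "(exp 2 / \<mu>) powr \<mu> > 0" using assms by auto
  fix n :: nat
  show "fact n powr \<mu> \<le> exp 1 * ((exp 2 / \<mu>) powr \<mu>) ^ n * Gamma (1 + real n * \<mu>)"
  proof (cases "n = 0")
    case False
    define x where "x = real n * \<mu>"
    have x: "x > 0" "real n = x / \<mu>" using False assms by (auto simp: x_def)
    have "fact n powr \<mu> \<le> (real n ^ n) powr \<mu>"
      using fact_le_power_self[of n] assms by (intro powr_mono2) auto
    also have "\<dots> = real n powr x" using False by (simp add: x_def powr_powr flip: powr_realpow)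
    also have "\<dots> = (1 / \<mu>) powr x * x powr x"
      using x assms by (simp add: powr_divide)
    also have "\<dots> \<le> (1 / \<mu>) powr x * (exp (1 + 2 * x) * Gamma (1 + x))"
      using powr_self_le_Gamma[OF x(1)] by (intro mult_left_mono) auto
    also have "\<dots> = exp 1 * (exp 2 / \<mu>) powr x * Gamma (1 + x)"
      using assms by (simp add: powr_divide exp_add exp_powr_real mult_ac)
    also have "(exp 2 / \<mu>) powr x = ((exp 2 / \<mu>) powr \<mu>) ^ n"
      using assms by (simp add: x_def powr_powr mult.commute powr_def flip: powr_realpow)
    finally show ?thesis by (simp add: x_def)
  qed simp
qed

lemma Gamma_le_fact_powr:
  assumes "\<mu> > 0"
  obtains K c where "K > 0" "c > 0" "\<And>n. Gamma (1 + real n * \<mu>) \<le> K * c ^ n * fact n powr \<mu>"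
proof
  show "4 * exp 1 > (0::real)" "(exp 3 * \<mu>) powr \<mu> > 0" using assms by auto
  fix n :: nat
  show "Gamma (1 + real n * \<mu>) \<le> 4 * exp 1 * ((exp 3 * \<mu>) powr \<mu>) ^ n * fact n powr \<mu>"
  proof (cases "n = 0")
    case True
    have "(1::real) \<le> 4 * exp 1" using one_le_exp_iff[of "1::real"] by linarith
    with True show ?thesis by simp
  next
    case False
    define x where "x = real n * \<mu>"
    have x: "x > 0" "x = \<mu> * real n" using False assms by (auto simp: x_def)
    have "real n powr x = (real n ^ n) powr \<mu>"
      using False by (simp add: x_def powr_powr flip: powr_realpow)
    also have "\<dots> \<le> (exp (real n) * fact n) powr \<mu>"
      using power_self_le_exp_fact[of n] assms by (intro powr_mono2) auto
    also have "\<dots> = exp x * fact n powr \<mu>" by (simp add: powr_mult exp_powr_real x_def)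
    finally have 1: "real n powr x \<le> exp x * fact n powr \<mu>" .
    have "Gamma (1 + x) \<le> 4 * exp (1 + 2 * x) * x powr x" using Gamma_le_powr_self[OF x(1)] .
    also have "x powr x = \<mu> powr x * real n powr x"
      using x assms by (simp add: powr_mult)
    also have "4 * exp (1 + 2 * x) * (\<mu> powr x * real n powr x)
        \<le> 4 * exp (1 + 2 * x) * (\<mu> powr x * (exp x * fact n powr \<mu>))"
      using 1 by (intro mult_left_mono) auto
    also have "\<dots> = 4 * exp 1 * (exp 3 * \<mu>) powr x * fact n powr \<mu>"
      using assms by (simp add: powr_mult exp_add exp_powr_real mult_ac flip: exp_add)
    also have "(exp 3 * \<mu>) powr x = ((exp 3 * \<mu>) powr \<mu>) ^ n"
      using assms by (simp add: x_def powr_powr mult.commute powr_def flip: powr_realpow)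
    finally show ?thesis by (simp add: x_def)
  qed
qed

text \<open>The left side is the e-th power of Y^n/n! with Y = X^(1/e). Comparing with the
  exponential series at 2Y instead of Y leaves the factor 2^(-e n), which makes the bound summable
  in n.\<close>

lemma power_over_fact_powr_bound:
  fixes X e :: real
  assumes "e > 0" "X \<ge> 0"
  shows "X ^ n / fact n powr e \<le> exp (2 * e * X powr (1 / e)) * (2 powr (- e)) ^ n"
proof (cases "X = 0")
  case True
  then show ?thesis by (cases n) auto
next
  case False
  then have X: "X > 0" using assms by simp
  define Y where "Y = X powr (1 / e)"
  have Y: "Y > 0" "X = Y powr e" using X assms by (auto simp: Y_def powr_powr)
  have "(2 * Y) ^ n / fact n \<le> exp (2 * Y)"
  proof -
    have "(\<lambda>k. (2 * Y) ^ k /\<^sub>R fact k) sums exp (2 * Y)" by (rule exp_converges)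
    then have s: "summable (\<lambda>k. (2 * Y) ^ k /\<^sub>R fact k)" "(\<Sum>k. (2 * Y) ^ k /\<^sub>R fact k) = exp (2 * Y)"
      by (auto simp: sums_iff)
    have "(\<Sum>k\<in>{n}. (2 * Y) ^ k /\<^sub>R fact k) \<le> (\<Sum>k. (2 * Y) ^ k /\<^sub>R fact k)"
      using Y by (intro sum_le_suminf[OF s(1)]) auto
    then show ?thesis using s(2) by (simp add: field_simps)
  qed
  then have "((2 * Y) ^ n / fact n) powr e \<le> exp (2 * Y) powr e"
    using Y assms by (intro powr_mono2) auto
  then have *: "2 powr (n * e) * (X ^ n / fact n powr e) \<le> exp (2 * e * Y)"
    using Y by (simp add: powr_divide powr_mult power_mult_distrib exp_powr_real powr_powr mult_ac
        flip: powr_realpow)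
  moreover have "2 powr (n * e) * (2 powr (- e)) ^ n = 1"
    by (simp add: powr_powr mult.commute flip: powr_realpow powr_add)
  ultimately have "X ^ n / fact n powr e = (2 powr (- e)) ^ n * (2 powr (n * e) * (X ^ n / fact n powr e))"
    by (metis mult.assoc mult.commute mult.left_neutral)
  also have "\<dots> \<le> (2 powr (- e)) ^ n * exp (2 * e * Y)"
    by (intro mult_left_mono *) auto
  finally show ?thesis by (simp add: Y_def mult_ac)
qed

section \<open>Borel transforms of sums in a half-strip\<close>

lemma post_widder_add:
  assumes "f holomorphic_on S" "g holomorphic_on S" "open S" "of_nat n / x \<in> S"
  shows "post_widder n (\<lambda>v. f v + a * g v) x = post_widder n f x + a * post_widder n g x"
proof -
  have "(deriv ^^ n) (\<lambda>v. f v + a * g v) (of_nat n / x)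
      = (deriv ^^ n) f (of_nat n / x) + (deriv ^^ n) (\<lambda>v. a * g v) (of_nat n / x)"
    using assms by (intro higher_deriv_add) (auto intro!: holomorphic_intros)
  also have "(deriv ^^ n) (\<lambda>v. a * g v) (of_nat n / x) = a * (deriv ^^ n) g (of_nat n / x)"
    using assms by (intro higher_deriv_cmult) auto
  finally show ?thesis unfolding post_widder_def by (simp only: distrib_left) (simp only: mult_ac)
qed

text \<open>The coefficients of the Borel transform decay like (n!)^(-(\<mu>-\<sigma>)) up to
  geometric factors, so it is entire of order at most 1/(\<mu>-\<sigma>). \<open>K\<close> is
  quantified before \<open>C\<close> and \<open>a\<close>: one constant has to serve all slices and
  all functionals.\<close>

lemma borel_coeff_bound:
  fixes \<mu> A \<sigma> :: real
  assumes "\<mu> > 0" "\<sigma> < \<mu>" "A > 0"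
  shows "\<exists>K>0. \<forall>C\<ge>0. \<forall>a :: nat \<Rightarrow> complex. (\<forall>n. cmod (a n) \<le> C * A ^ n * fact n powr \<sigma>) \<longrightarrow>
     (\<forall>y\<ge>0. summable (\<lambda>n. cmod (a n) / Gamma (1 + real n * \<mu>) * y ^ n) \<and>
       (\<Sum>n. cmod (a n) / Gamma (1 + real n * \<mu>) * y ^ n) \<le> K * C * exp (K * y powr (1 / (\<mu> - \<sigma>))))"
proof -
  obtain K c where Kc: "K > 0" "c > 0" "\<And>n. fact n powr \<mu> \<le> K * c ^ n * Gamma (1 + real n * \<mu>)"
    using fact_powr_le_Gamma[OF assms(1)] by blast
  define e where "e = \<mu> - \<sigma>"
  have e: "e > 0" using assms by (simp add: e_def)
  define q where "q = 2 powr (- e)"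
  have q: "0 < q" "q < 1" using e powr_less_mono[of "- e" 0 2] by (auto simp: q_def)
  define K' where "K' = max (K / (1 - q)) (2 * e * (A * c) powr (1 / e))"
  have K': "K' > 0" using Kc q by (auto simp: K'_def less_max_iff_disj)
  have main: "summable (\<lambda>n. cmod (a n) / Gamma (1 + real n * \<mu>) * y ^ n) \<and>
       (\<Sum>n. cmod (a n) / Gamma (1 + real n * \<mu>) * y ^ n) \<le> K' * C * exp (K' * y powr (1 / (\<mu> - \<sigma>)))"
    if C: "C \<ge> 0" and a: "\<And>n. cmod (a n) \<le> C * A ^ n * fact n powr \<sigma>" and y: "y \<ge> 0" for C y and a :: "nat \<Rightarrow> complex"
  proof -
    define E where "E = exp (2 * e * (A * c * y) powr (1 / e))"
    have Gpos: "Gamma (1 + real n * \<mu>) > 0" for n using assms by (intro Gamma_real_pos) (simp add: add_pos_nonneg)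
    have b: "cmod (a n) / Gamma (1 + real n * \<mu>) * y ^ n \<le> C * K * E * q ^ n" for n
    proof -
      have "cmod (a n) / Gamma (1 + real n * \<mu>) \<le> (C * A ^ n * fact n powr \<sigma>) / (fact n powr \<mu> / (K * c ^ n))"
        using Kc a[of n] C Gpos[of n] assms by (intro frac_le) (auto simp: field_simps)
      also have "\<dots> = C * K * ((A * c) ^ n / fact n powr e)"
        using Kc by (simp add: e_def powr_diff field_simps power_mult_distrib)
      finally have "cmod (a n) / Gamma (1 + real n * \<mu>) * y ^ n \<le> C * K * ((A * c) ^ n / fact n powr e) * y ^ n"
        using y by (intro mult_right_mono) auto
      also have "\<dots> = C * K * ((A * c * y) ^ n / fact n powr e)" by (simp add: power_mult_distrib)
      also have "\<dots> \<le> C * K * (E * q ^ n)"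
        unfolding E_def q_def using C Kc assms y e by (intro mult_left_mono power_over_fact_powr_bound) auto
      finally show ?thesis by (simp add: mult_ac)
    qed
    have nonneg: "0 \<le> cmod (a n) / Gamma (1 + real n * \<mu>) * y ^ n" for n
      using y Gpos[of n] by simp
    have sg: "summable (\<lambda>n. C * K * E * q ^ n)" using q by (intro summable_mult summable_geometric) auto
    have s: "summable (\<lambda>n. cmod (a n) / Gamma (1 + real n * \<mu>) * y ^ n)"
      by (rule summable_comparison_test'[OF sg, of 0]) (metis b nonneg abs_of_nonneg real_norm_def)
    have "(\<Sum>n. cmod (a n) / Gamma (1 + real n * \<mu>) * y ^ n) \<le> (\<Sum>n. C * K * E * q ^ n)"
      by (rule suminf_le[OF b s sg])
    also have "\<dots> = C * (K / (1 - q)) * E" using q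
      by (subst suminf_mult) (auto simp: suminf_geometric intro!: summable_geometric)
    also have "\<dots> \<le> C * K' * exp (K' * y powr (1 / e))"
    proof (intro mult_mono)
      show "K / (1 - q) \<le> K'" by (simp add: K'_def)
      have "2 * e * (A * c * y) powr (1 / e) = 2 * e * (A * c) powr (1 / e) * y powr (1 / e)"
        using assms Kc y by (simp add: powr_mult)
      also have "\<dots> \<le> K' * y powr (1 / e)" by (intro mult_right_mono) (auto simp: K'_def)
      finally show "E \<le> exp (K' * y powr (1 / e))" by (simp add: E_def)
    qed (use C K' Kc q in \<open>auto simp: E_def\<close>)
    finally show ?thesis using s by (simp add: e_def mult_ac)
  qed
  with K' show ?thesis by blast
qed

lemma entire_power_series:
  fixes b :: "nat \<Rightarrow> complex"
  assumes "\<And>y. y \<ge> 0 \<Longrightarrow> summable (\<lambda>n. cmod (b n) * y ^ n)"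
  shows "summable (\<lambda>n. b n * z ^ n)" "(\<lambda>z. \<Sum>n. b n * z ^ n) holomorphic_on S"
    "cmod (\<Sum>n. b n * z ^ n) \<le> (\<Sum>n. cmod (b n) * cmod z ^ n)"
proof -
  have s: "summable (\<lambda>n. norm (b n * z ^ n))" for z
    using assms[of "cmod z"] by (simp add: norm_mult norm_power)
  show *: "summable (\<lambda>n. b n * z ^ n)" for z using s by (rule summable_norm_cancel)
  have "(\<lambda>z. \<Sum>n. b n * z ^ n) field_differentiable at z" for z
  proof -
    have "(\<lambda>z. \<Sum>n. b n * z ^ n) holomorphic_on ball 0 (cmod z + 1)"
      by (rule power_series_holomorphic[where a = b]) (use * in \<open>auto simp: summable_sums\<close>)
    then show ?thesis by (rule holomorphic_on_imp_differentiable_at) auto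
  qed
  then show "(\<lambda>z. \<Sum>n. b n * z ^ n) holomorphic_on S"
    by (auto simp: holomorphic_on_def intro: field_differentiable_at_within)
  show "cmod (\<Sum>n. b n * z ^ n) \<le> (\<Sum>n. cmod (b n) * cmod z ^ n)"
    using summable_norm[OF s[of z]] by (simp add: norm_mult norm_power)
qed

text \<open>The Post-Widder operators applied to \<open>v \<mapsto> R (- Ln v) / v\<close>, where \<open>R\<close> is the remainder of order \<open>N0\<close>,
  are locally bounded independently of their index, so by Montel's theorem a subsequence has a
  holomorphic limit. The limit is the tail of the Borel transform near the origin, hence everywhere by
  the identity theorem.\<close>

lemma borel_tail_bound:
  fixes \<mu> \<theta> l A \<sigma> C u :: real and H :: "complex \<Rightarrow> complex" and a :: "nat \<Rightarrow> complex"
  assumes \<mu>: "\<mu> > 0" and \<theta>: "pi / 2 < \<theta>" "\<theta> \<le> pi" and l: "l \<ge> 0" and A: "A > 0" and \<sigma>: "\<sigma> < \<mu>" and C: "C \<ge> 0"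
    and holH: "H holomorphic_on {w. Re w < - l \<and> \<bar>Im w\<bar> < \<theta>}"
    and asym: "\<And>N w. Re w < - l \<Longrightarrow> \<bar>Im w\<bar> < \<theta> \<Longrightarrow>
        cmod (H w - (\<Sum>n<N. a n * exp (of_real (real n * \<mu>) * w))) \<le> C * A ^ N * fact N powr \<mu> * exp (\<mu> * real N * Re w)"
    and coeff: "\<And>n. cmod (a n) \<le> C * A ^ n * fact n powr \<sigma>"
    and N0: "real N0 * \<mu> \<ge> 1"
  defines "L \<equiv> exp l + 1"
  shows "cmod ((\<Sum>n. a n / of_real (Gamma (1 + real n * \<mu>)) * exp (of_real (\<mu> * u)) ^ n)
             - (\<Sum>n<N0. a n / of_real (Gamma (1 + real n * \<mu>)) * exp (of_real (\<mu> * u)) ^ n))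
        \<le> C * A ^ N0 * fact N0 powr \<mu> * exp (2 * L * exp u)"
proof -
  \<comment> \<open>Under w = -Ln v the half-strip Re w < -l becomes the part |v| > exp l of a
    sector.\<close>
  define L0 where "L0 = exp l"
  have L: "L0 \<ge> 1" "L0 < L" "L > 0" using l by (auto simp: L0_def L_def add_pos_pos)
  define \<delta> where "\<delta> = \<theta> - pi / 2"
  have \<delta>: "0 < \<delta>" "\<delta> \<le> pi / 2" using \<theta> by (auto simp: \<delta>_def)
  define b where "b = (\<lambda>n. a n / of_real (Gamma (1 + real n * \<mu>)))"
  have Gpos: "Gamma (1 + real n * \<mu>) > 0" for n using \<mu> by (intro Gamma_real_pos) (simp add: add_pos_nonneg)
  have bsum: "summable (\<lambda>n. cmod (b n) * y ^ n)" if "y \<ge> 0" for y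
  proof -
    have "cmod (b n) = cmod (a n) / Gamma (1 + real n * \<mu>)" for n
      using Gpos[of n] by (simp add: b_def norm_divide)
    then show ?thesis using borel_coeff_bound[OF \<mu> \<sigma> A] coeff C that by auto
  qed
  define T where "T = (\<lambda>z. (\<Sum>n. b n * z ^ n) - (\<Sum>n<N0. b n * z ^ n))"
  have holT: "T holomorphic_on S" for S unfolding T_def
    by (intro holomorphic_on_diff entire_power_series(2) bsum) (auto intro!: holomorphic_intros)
  define G where "G = (\<lambda>N v. (H (- Ln v) - (\<Sum>n<N. a n * exp (of_real (real n * \<mu>) * (- Ln v)))) / v)"
  \<comment> \<open>Possible centres n/x for x in the sector |arg x| < \<delta>; the discs around
    them keep the distance L0 from the origin. All remainders are holomorphic on the union of these
    discs.\<close>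
  define D where "D = {c. c \<noteq> 0 \<and> \<bar>Im (Ln c)\<bar> < \<delta>}"
  define U where "U = (\<Union>c\<in>D. ball c (cmod c - L0))"
  have U: "open U" unfolding U_def by auto
  have inU: "L0 < cmod v" "v \<notin> \<real>\<^sub>\<le>\<^sub>0" "\<bar>Im (Ln v)\<bar> < \<theta>" "v \<noteq> 0" "Re (- Ln v) < - l" if vU: "v \<in> U" for v
  proof -
    obtain c where c: "c \<noteq> 0" "\<bar>Im (Ln c)\<bar> < \<delta>" "v \<in> ball c (cmod c - L0)" using vU by (auto simp: U_def D_def)
    have L00: "0 \<le> L0" using L by simp
    show *: "L0 < cmod v" "v \<notin> \<real>\<^sub>\<le>\<^sub>0" using ball_subset_wide_sector[OF c(1,2) \<delta>(2) c(3) L00] by auto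
    show "\<bar>Im (Ln v)\<bar> < \<theta>" using ball_subset_wide_sector[OF c(1,2) \<delta>(2) c(3) L00] by (auto simp: \<delta>_def)
    show "v \<noteq> 0" using * by auto
    then show "Re (- Ln v) < - l" using * ln_less_cancel_iff[of L0 "cmod v"] L by (simp add: L0_def)
  qed
  have holG: "G N holomorphic_on U" for N
  proof -
    have "(\<lambda>v. H (- Ln v)) holomorphic_on U"
      by (rule holomorphic_on_compose_gen[OF _ holH, unfolded o_def])
         (use inU in \<open>auto intro!: holomorphic_intros\<close>)
    then show ?thesis unfolding G_def using inU by (auto intro!: holomorphic_intros)
  qed
  \<comment> \<open>Dividing the remainder by v gives decay |v|^(-1 - \<mu> N). Since \<mu> N \<ge>
    1, this is at most |v|^-2 times a power of any lower bound L' for |v|; hence the requirement on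
    N0. L' is left free because it will later depend on N.\<close>
  have Gbd: "cmod (G N v) \<le> C * A ^ N * fact N powr \<mu> * L' powr (1 - \<mu> * real N) / (cmod v)\<^sup>2"
    if "v \<in> U" "L' \<le> cmod v" "0 < L'" "real N * \<mu> \<ge> 1" for N v L'
  proof -
    note v = inU[OF that(1)]
    have "cmod (H (- Ln v) - (\<Sum>n<N. a n * exp (of_real (real n * \<mu>) * (- Ln v))))
        \<le> C * A ^ N * fact N powr \<mu> * exp (\<mu> * real N * Re (- Ln v))"
      using v by (intro asym) auto
    also have "exp (\<mu> * real N * Re (- Ln v)) = cmod v powr (1 - \<mu> * real N) / cmod v"
      using v by (simp add: powr_def algebra_simps exp_diff exp_minus divide_inverse)
    also have "cmod v powr (1 - \<mu> * real N) \<le> L' powr (1 - \<mu> * real N)"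
      using that by (intro powr_mono2') (auto simp: mult.commute)
    finally have "cmod (H (- Ln v) - (\<Sum>n<N. a n * exp (of_real (real n * \<mu>) * (- Ln v))))
        \<le> C * A ^ N * fact N powr \<mu> * (L' powr (1 - \<mu> * real N) / cmod v)"
      using C A by (simp add: divide_right_mono mult_left_mono)
    then have "cmod (G N v) \<le> C * A ^ N * fact N powr \<mu> * (L' powr (1 - \<mu> * real N) / cmod v) / cmod v"
      unfolding G_def norm_divide by (rule divide_right_mono) simp
    then show ?thesis by (simp add: power2_eq_square)
  qed
  have c_in: "of_nat n / exp w \<in> D" "cmod (of_nat n / exp w) = real n / exp (Re w)"
    if "n > 0" "\<bar>Im w\<bar> < \<delta>" for n w
  proof -
    have "of_nat n / exp w = exp (of_real (ln (real n)) - w)"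
      using that by (simp add: exp_diff exp_of_real)
    moreover have "Ln (exp (of_real (ln (real n)) - w)) = of_real (ln (real n)) - w"
      using that \<delta> by (intro Ln_exp) auto
    ultimately show "of_nat n / exp w \<in> D" using that by (simp add: D_def)
    show "cmod (of_nat n / exp w) = real n / exp (Re w)" by (simp add: norm_divide)
  qed
  have c_inU: "of_nat n / exp w \<in> U" if "n > 0" "\<bar>Im w\<bar> < \<delta>" "L0 * exp (Re w) < real n" for n w
  proof -
    have "L0 < cmod (of_nat n / exp w)" unfolding c_in(2)[OF that(1,2)] using that(3) by (simp add: pos_less_divide_eq)
    then have "of_nat n / exp w \<in> ball (of_nat n / exp w) (cmod (of_nat n / exp w) - L0)" by simp
    then show ?thesis unfolding U_def using c_in(1)[OF that(1,2)] by blast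
  qed
  have PWbd: "cmod (post_widder n (G N) (exp w)) \<le> C * A ^ N * fact N powr \<mu> * L' powr (- \<mu> * real N) * exp (2 * L' * exp (Re w))"
    if w: "\<bar>Im w\<bar> < \<delta>" and n: "2 * L' * exp (Re w) \<le> real n" and L': "L0 < L'" and N: "real N * \<mu> \<ge> 1" for n N w L'
  proof -
    have "0 < 2 * L' * exp (Re w)" using L L' by simp
    then have n0: "n > 0" using n by (intro Nat.gr0I) auto
    have sub: "ball (of_nat n / exp w) (cmod (of_nat n / exp w) - L0) \<subseteq> U"
      unfolding U_def using c_in[OF n0 w] by blast
    have "cmod (post_widder n (G N) (exp w)) \<le> (C * A ^ N * fact N powr \<mu> * L' powr (1 - \<mu> * real N)) / L' * exp (2 * L' * cmod (exp w))"
    proof (rule post_widder_bound[OF _ _ _ L' _ holomorphic_on_subset[OF holG sub]])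
      show "2 * L' * cmod (exp w) \<le> real n" "0 \<le> L0" using n L by auto
      show "cmod (G N v) \<le> C * A ^ N * fact N powr \<mu> * L' powr (1 - \<mu> * real N) / (cmod v)\<^sup>2"
        if "v \<in> ball (of_nat n / exp w) (cmod (of_nat n / exp w) - L0)" "L' \<le> cmod v" for v
        using that sub L L' N by (intro Gbd) auto
    qed (use C A in auto)
    also have "L' powr (1 - \<mu> * real N) = L' powr (- \<mu> * real N) * L'" using L L' powr_add[of L' 1 "- \<mu> * real N"] by simp
    finally show ?thesis using L L' by simp
  qed
  \<comment> \<open>Cutting at Re w < u + 1 bounds exp w on R, so a single offset n0 makes
    \<open>PWbd\<close> available for every index j + n0, while u stays in the interior.\<close>
  define X where "X = u + 1"
  define R where "R = {w. Re w < X \<and> \<bar>Im w\<bar> < \<delta>}"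
  have "R = {w. Re w < X} \<inter> {w. Im w < \<delta>} \<inter> {w. Im w > - \<delta>}" by (auto simp: R_def)
  then have R: "open R" "convex R"
    by (auto intro!: open_Int convex_Int open_halfspace_Re_lt open_halfspace_Im_lt open_halfspace_Im_gt
        convex_halfspace_Re_lt convex_halfspace_Im_lt convex_halfspace_Im_gt)
  have uR: "of_real u \<in> R" using \<delta> by (simp add: R_def X_def)
  define n0 where "n0 = nat \<lceil>2 * L * exp X\<rceil>"
  have n0: "2 * L * exp (Re w) \<le> real (j + n0)" if "w \<in> R" for j w
  proof -
    have "2 * L * exp (Re w) \<le> 2 * L * exp X" using that L by (intro mult_left_mono) (auto simp: R_def)
    also have "\<dots> \<le> real n0" unfolding n0_def by linarith
    finally show ?thesis by simp
  qed
  define F where "F = (\<lambda>j w. post_widder (j + n0) (G N0) (exp w))"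
  have Fbd: "cmod (F j w) \<le> C * A ^ N0 * fact N0 powr \<mu> * exp (2 * L * exp (Re w))" if "w \<in> R" for j w
  proof -
    have "cmod (F j w) \<le> C * A ^ N0 * fact N0 powr \<mu> * L powr (- \<mu> * real N0) * exp (2 * L * exp (Re w))"
      unfolding F_def using that n0[OF that] L N0 by (intro PWbd) (auto simp: R_def)
    also have "L powr (- \<mu> * real N0) \<le> L powr 0" using L \<mu> by (intro powr_mono) auto
    finally show ?thesis using L C A by (simp add: mult_left_mono mult_right_mono)
  qed
  have holF: "F j holomorphic_on R" for j
  proof (cases "j + n0 = 0")
    case True
    moreover have "0 < 2 * L * exp (Re (of_real u))" using L by simp
    ultimately show ?thesis using n0[OF uR, of j] by simp
  next
    case False
    have "(\<lambda>w. (deriv ^^ (j + n0)) (G N0) (of_nat (j + n0) / exp w)) holomorphic_on R"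
    proof (rule holomorphic_on_compose_gen[of "\<lambda>w. of_nat (j + n0) / exp w" R _ U, unfolded o_def])
      show "(deriv ^^ (j + n0)) (G N0) holomorphic_on U" by (intro holomorphic_higher_deriv holG U)
      show "(\<lambda>w. of_nat (j + n0) / exp w) ` R \<subseteq> U"
      proof (rule image_subsetI)
        fix w assume w: "w \<in> R"
        have "L0 * exp (Re w) < 2 * L * exp (Re w)" using L by simp
        then have "L0 * exp (Re w) < real (j + n0)" using n0[OF w, of j] by linarith
        then show "of_nat (j + n0) / exp w \<in> U" using w False by (intro c_inU) (auto simp: R_def)
      qed
    qed (auto intro!: holomorphic_intros)
    then show ?thesis unfolding F_def post_widder_def by (auto intro!: holomorphic_intros)
  qed
  obtain g r where g: "g holomorphic_on R" "strict_mono (r :: nat \<Rightarrow> nat)" "\<And>w. w \<in> R \<Longrightarrow> (\<lambda>j. F (r j) w) \<longlonglongrightarrow> g w"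
  proof (rule Montel[of R "range F" F, OF R(1)])
    show "\<exists>B. \<forall>h\<in>range F. \<forall>z\<in>K. cmod (h z) \<le> B" if K: "compact K" "K \<subseteq> R" for K
    proof (intro exI ballI)
      fix h z assume "h \<in> range F" "z \<in> K"
      then obtain j where "h = F j" "z \<in> R" using K by auto
      then have "cmod (h z) \<le> C * A ^ N0 * fact N0 powr \<mu> * exp (2 * L * exp (Re z))" using Fbd by auto
      also have "\<dots> \<le> C * A ^ N0 * fact N0 powr \<mu> * exp (2 * L * exp X)"
        using C A L \<open>z \<in> R\<close> by (intro mult_left_mono) (auto simp: R_def)
      finally show "cmod (h z) \<le> C * A ^ N0 * fact N0 powr \<mu> * exp (2 * L * exp X)" .
    qed
  qed (use holF in auto)
  \<comment> \<open>The terms subtracted in passing from \<open>G N0\<close> to \<open>G N\<close>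
    are multiples of these powers, whose Post-Widder limits are known.\<close>
  define k where "k = (\<lambda>m v. v powr (- complex_of_real (real m * \<mu> + 1)))"
  have holk: "k m holomorphic_on U" for m
    unfolding k_def using inU(2) by (auto intro!: holomorphic_intros)
  have G_step: "G N v = G (Suc N) v + a N * k N v" if "v \<in> U" for N v
  proof -
    have "k N v = exp (of_real (real N * \<mu>) * (- Ln v)) / v"
    proof -
      have "k N v = exp (of_real (real N * \<mu>) * (- Ln v) + (- Ln v))"
        using inU(4)[OF that] by (simp add: k_def powr_def algebra_simps)
      also have "\<dots> = exp (of_real (real N * \<mu>) * (- Ln v)) * exp (- Ln v)" by (rule exp_add)
      also have "exp (- Ln v) = 1 / v" using inU(4)[OF that] by (simp add: exp_minus divide_inverse)
      finally show ?thesis by simp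
    qed
    then show ?thesis by (simp add: G_def diff_divide_distrib add_divide_distrib)
  qed
  have expand: "post_widder n (G N0) x = post_widder n (G N) x + (\<Sum>m = N0..<N. a m * post_widder n (k m) x)"
    if "of_nat n / x \<in> U" "N0 \<le> N" for n N x
    using that(2)
  proof (induction N rule: dec_induct)
    case (step N)
    have hol: "(\<lambda>v. G (Suc N) v + a N * k N v) holomorphic_on U"
      by (intro holomorphic_on_add holomorphic_on_mult holomorphic_on_const holG holk)
    have "post_widder n (G N) x = post_widder n (\<lambda>v. G (Suc N) v + a N * k N v) x"
      unfolding post_widder_def
      using higher_deriv_transform_within_open[OF holG hol U that(1) G_step] by simp
    also have "\<dots> = post_widder n (G (Suc N)) x + a N * post_widder n (k N) x"
      by (rule post_widder_add[OF holG holk U that(1)])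
    finally show ?case using step by (simp add: algebra_simps)
  qed simp
  \<comment> \<open>The three bounds place v in R, make exp(-v) exceed L0, and bring the ratio q = A
    exp(2) exp(\<mu> v) of the geometric error below exp(-1).\<close>
  define v0 where "v0 = min (min X (- l - 1)) (ln (1 / (A * exp 3)) / \<mu>)"
  have small: "g (of_real v) = T (exp (of_real (\<mu> * v)))" if v: "v < v0" for v
  proof -
    define z where "z = exp (\<mu> * v)"
    define q where "q = A * exp 2 * z"
    have vR: "of_real v \<in> R" using v \<delta> by (simp add: R_def v0_def)
    have "v * \<mu> < ln (1 / (A * exp 3))" using v \<mu> by (simp add: v0_def pos_less_divide_eq)
    then have "z < 1 / (A * exp 3)" using A
      by (metis exp_less_mono exp_ln mult.commute z_def zero_less_divide_1_iff zero_less_mult_iff exp_gt_zero)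
    then have "q < A * exp 2 * (1 / (A * exp 3))" unfolding q_def using A by (intro mult_strict_left_mono) auto
    also have "\<dots> = exp (-1)" using A by (simp flip: exp_diff)
    also have "\<dots> < 1" by simp
    finally have q: "0 < q" "q < 1" using A by (auto simp: q_def z_def)
    have est: "cmod (g (of_real v) - (\<Sum>m = N0..<N. b m * of_real z ^ m)) \<le> C * q ^ N" if N: "N0 \<le> N" for N
    proof -
      have "N0 > 0" using N0 by (intro Nat.gr0I) auto
      then have N1: "N \<ge> 1" using N by simp
      have Nmu: "real N * \<mu> \<ge> 1" using N N0 \<mu> mult_right_mono[of "real N0" "real N" \<mu>] by linarith
      \<comment> \<open>This choice balances the factors that depend on N: exp(2 L' exp v) becomes
        exp(2 N), while L'^(-\<mu> N) = N^(-\<mu> N) z^N cancels (N!)^\<mu>. The error is then C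
        q^N, and the condition on the index n reads 2 N \<le> n.\<close>
      define L' where "L' = real N * exp (- v)"
      have "L0 < exp (- v)" using v by (simp add: L0_def v0_def)
      also have "\<dots> \<le> L'" using N1 by (simp add: L'_def)
      finally have L': "L0 < L'" .
      have ev: "\<forall>\<^sub>F j in sequentially. 2 * N \<le> r j + n0"
        using eventually_ge_at_top[of "2 * N"]
      proof eventually_elim
        case (elim j)
        then show ?case using seq_suble[OF g(2), of j] by linarith
      qed
      have LN: "L' * exp v = real N" by (simp add: L'_def flip: exp_add)
      have PWn: "cmod (F (r j) (of_real v) - (\<Sum>m = N0..<N. a m * post_widder (r j + n0) (k m) (exp (of_real v)))) \<le> C * q ^ N"
        if j: "2 * N \<le> r j + n0" for j
      proof -
        define n where "n = r j + n0"
        have n: "real (2 * N) \<le> real n" using j unfolding n_def of_nat_le_iff .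
        have 1: "2 * L' * exp (Re (of_real v)) \<le> real n"
          using n LN by (simp add: mult.assoc)
        have "L0 * exp (Re (of_real v)) < L' * exp (Re (of_real v))" using L' by simp
        also have "\<dots> \<le> real n" using 1 L' L by simp
        finally have "of_nat n / exp (of_real v) \<in> U" using n N1 \<delta> by (intro c_inU) auto
        from expand[OF this N]
        have "cmod (F (r j) (of_real v) - (\<Sum>m = N0..<N. a m * post_widder (r j + n0) (k m) (exp (of_real v))))
            = cmod (post_widder n (G N) (exp (of_real v)))"
          by (simp add: F_def n_def)
        also have "\<dots> \<le> C * A ^ N * fact N powr \<mu> * L' powr (- \<mu> * real N) * exp (2 * L' * exp (Re (of_real v)))"
          using 1 L' Nmu \<delta> by (intro PWbd) auto
        also have "exp (2 * L' * exp (Re (of_real v))) = exp 2 ^ N"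
          using LN by (simp add: mult.assoc mult.commute[of 2] flip: exp_of_nat_mult)
        also have "fact N powr \<mu> * L' powr (- \<mu> * real N) \<le> z ^ N"
        proof -
          have "fact N powr \<mu> \<le> (real N ^ N) powr \<mu>"
            using fact_le_power_self[of N] \<mu> by (intro powr_mono2) auto
          also have "(real N ^ N) powr \<mu> = real N powr (\<mu> * real N)"
            using N1 by (simp add: powr_powr mult.commute flip: powr_realpow)
          finally have *: "fact N powr \<mu> \<le> real N powr (\<mu> * real N)" .
          have "exp (- v) powr (- \<mu> * real N) = z ^ N"
            by (simp add: z_def exp_powr_real mult_ac flip: exp_of_nat_mult)
          then have Lp: "L' powr (- \<mu> * real N) = real N powr (- (\<mu> * real N)) * z ^ N"
            unfolding L'_def powr_mult by simp
          have "fact N powr \<mu> * L' powr (- \<mu> * real N) \<le> real N powr (\<mu> * real N) * (real N powr (- (\<mu> * real N)) * z ^ N)"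
            unfolding Lp by (intro mult_right_mono *) (simp add: z_def)
          also have "\<dots> = z ^ N" using N1 by (simp add: powr_minus)
          finally show ?thesis .
        qed
        then have "C * A ^ N * fact N powr \<mu> * L' powr (- \<mu> * real N) * exp 2 ^ N \<le> C * A ^ N * z ^ N * exp 2 ^ N"
          using C A by (simp add: mult.assoc mult_left_mono mult_right_mono)
        also have "\<dots> = C * q ^ N" by (simp add: q_def power_mult_distrib)
        finally show ?thesis by simp
      qed
      \<comment> \<open>The index tends to infinity first, with N fixed, since the estimate needs it
        to be at least 2 N; N tends to infinity afterwards.\<close>
      have lim: "(\<lambda>j. F (r j) (of_real v) - (\<Sum>m = N0..<N. a m * post_widder (r j + n0) (k m) (exp (of_real v))))
          \<longlonglongrightarrow> g (of_real v) - (\<Sum>m = N0..<N. b m * of_real z ^ m)"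
      proof (intro tendsto_diff tendsto_sum g(3) vR)
        fix m
        have "(\<lambda>n. post_widder n (k m) (exp (of_real v))) \<longlonglongrightarrow> of_real (exp v powr (real m * \<mu>) / Gamma (1 + real m * \<mu>))"
          using post_widder_powr_tendsto[of "exp v" "real m * \<mu>"] \<mu> unfolding k_def exp_of_real by simp
        moreover have "filterlim (\<lambda>j. r j + n0) sequentially sequentially"
          using filterlim_subseq[OF g(2)] by (rule filterlim_at_top_mono) auto
        ultimately have "(\<lambda>j. post_widder (r j + n0) (k m) (exp (of_real v))) \<longlonglongrightarrow> of_real (exp v powr (real m * \<mu>) / Gamma (1 + real m * \<mu>))"
          by (rule filterlim_compose)
        then have "(\<lambda>j. a m * post_widder (r j + n0) (k m) (exp (of_real v))) \<longlonglongrightarrow>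
           a m * of_real (exp v powr (real m * \<mu>) / Gamma (1 + real m * \<mu>))" by (rule tendsto_mult_left)
        moreover have "exp v powr (real m * \<mu>) = z ^ m"
          by (simp add: z_def exp_powr_real mult_ac flip: exp_of_nat_mult)
        ultimately show "(\<lambda>j. a m * post_widder (r j + n0) (k m) (exp (of_real v))) \<longlonglongrightarrow> b m * of_real z ^ m"
          by (simp add: b_def)
      qed
      show ?thesis
        by (rule tendsto_upperbound[OF tendsto_norm[OF lim]]) (use eventually_mono[OF ev PWn] in auto)
    qed
    have "(\<lambda>N. (\<Sum>m<N. b m * of_real z ^ m) - (\<Sum>m<N0. b m * of_real z ^ m)) \<longlonglongrightarrow> T (of_real z)"
      unfolding T_def using summable_LIMSEQ[OF entire_power_series(1)[OF bsum]]
      by (intro tendsto_diff tendsto_const) auto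
    moreover have "\<forall>\<^sub>F N in sequentially. (\<Sum>m<N. b m * of_real z ^ m) - (\<Sum>m<N0. b m * of_real z ^ m) = (\<Sum>m = N0..<N. b m * of_real z ^ m)"
      using eventually_ge_at_top[of N0]
    proof eventually_elim
      case (elim N)
      then show ?case
        using sum.atLeastLessThan_concat[of 0 N0 N "\<lambda>m. b m * of_real z ^ m"]
        by (simp add: lessThan_atLeast0 algebra_simps)
    qed
    ultimately have "(\<lambda>N. \<Sum>m = N0..<N. b m * of_real z ^ m) \<longlonglongrightarrow> T (of_real z)"
      by (rule Lim_transform_eventually)
    then have "(\<lambda>N. cmod (g (of_real v) - (\<Sum>m = N0..<N. b m * of_real z ^ m))) \<longlonglongrightarrow> cmod (g (of_real v) - T (of_real z))"
      by (intro tendsto_norm tendsto_diff tendsto_const)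
    moreover have "(\<lambda>N. C * q ^ N) \<longlonglongrightarrow> C * 0" using q by (intro tendsto_intros LIMSEQ_realpow_zero) auto
    moreover have "\<exists>M. \<forall>N\<ge>M. cmod (g (of_real v) - (\<Sum>m = N0..<N. b m * of_real z ^ m)) \<le> C * q ^ N"
      using est by blast
    ultimately have "cmod (g (of_real v) - T (of_real z)) \<le> C * 0"
      by (rule LIMSEQ_le)
    then have "g (of_real v) = T (of_real z)" by simp
    also have "complex_of_real z = exp (of_real (\<mu> * v))" unfolding z_def exp_of_real ..
    finally show ?thesis .
  qed
  have "g w - T (exp (of_real \<mu> * w)) = 0" if "w \<in> R" for w
  proof (rule analytic_continuation[of "\<lambda>w. g w - T (exp (of_real \<mu> * w))" R "of_real ` {..<v0}" "of_real (v0 - 1)"])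
    show "(\<lambda>w. g w - T (exp (of_real \<mu> * w))) holomorphic_on R"
      using holomorphic_on_compose_gen[of "\<lambda>w. exp (of_real \<mu> * w)" R T UNIV] holT g(1)
      by (auto simp: o_def intro!: holomorphic_intros)
    show "connected R" using R(2) by (rule convex_connected)
    show "of_real ` {..<v0} \<subseteq> R" using \<delta> by (auto simp: R_def v0_def)
    show "of_real (v0 - 1) \<in> R" using \<delta> by (auto simp: R_def v0_def)
    show "of_real (v0 - 1) islimpt (of_real ` {..<v0} :: complex set)"
      unfolding islimpt_approachable
    proof (intro allI impI)
      fix e :: real assume "e > 0"
      then show "\<exists>x'\<in>of_real ` {..<v0}. x' \<noteq> of_real (v0 - 1) \<and> dist x' (complex_of_real (v0 - 1)) < e"
        by (intro bexI[of _ "of_real (v0 - 1 - e / 2)"]) (auto simp: dist_norm simp flip: of_real_diff)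
    qed
    show "g z - T (exp (of_real \<mu> * z)) = 0" if "z \<in> of_real ` {..<v0}" for z
      using that small by auto
  qed (use R that in auto)
  then have "g (of_real u) = T (exp (of_real (\<mu> * u)))" using uR by simp
  moreover have "cmod (g (of_real u)) \<le> C * A ^ N0 * fact N0 powr \<mu> * exp (2 * L * exp u)"
    by (rule LIMSEQ_le_const2[OF tendsto_norm[OF g(3)[OF uR]]]) (use Fbd[OF uR] in auto)
  ultimately show ?thesis by (simp add: T_def b_def)
qed

section \<open>Cauchy's estimate and the Phragmen-Lindelof principle\<close>

lemma power_series_coeff_bound:
  fixes b :: "nat \<Rightarrow> complex"
  assumes "\<And>z. z \<in> ball 0 R' \<Longrightarrow> (\<lambda>n. b n * z ^ n) sums f z" and R: "0 < R" "R < R'"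
    and bd: "\<And>z. cmod z = R \<Longrightarrow> cmod (f z) \<le> M"
  shows "cmod (b n) \<le> M / R ^ n"
proof -
  have hol: "f holomorphic_on ball 0 R'"
    by (rule power_series_holomorphic[where a = b]) (use assms(1) in auto)
  have "f has_fps_expansion Abs_fps b"
  proof (rule has_fps_expansionI)
    show "\<forall>\<^sub>F u in nhds 0. (\<lambda>n. fps_nth (Abs_fps b) n * u ^ n) sums f u"
      using R assms(1) eventually_nhds_in_open[of "ball 0 R'" "0::complex"] by (auto elim!: eventually_mono)
  qed
  from fps_nth_fps_expansion[OF this, of n] have b: "b n = (deriv ^^ n) f 0 / fact n" by simp
  have "cmod ((deriv ^^ n) f 0) \<le> fact n * M / R ^ n"
    using R bd by (intro Cauchy_inequality holomorphic_on_subset[OF hol] holomorphic_on_imp_continuous_on) auto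
  then show ?thesis by (simp add: b norm_divide field_simps)
qed

text \<open>In the logarithmic coordinate a sector is a half-strip and z^\<nu> is exp(\<nu> w). The
  factor exp(-K' exp(\<nu> w) - \<epsilon> exp(\<kappa>' w)) makes f bounded on the boundary of a
  long rectangle: K' = K/cos(\<nu> h) neutralises the bound on the horizontal sides, the
  \<epsilon>-term beats the growth with exponent \<kappa> on the far side because cos(\<kappa>' h) >
  0, and exp K pays for the side Re w = 0. Then \<epsilon> tends to 0.\<close>

lemma phragmen_lindelof_strip:
  fixes f :: "complex \<Rightarrow> complex"
  assumes hol: "f holomorphic_on UNIV" and h: "0 \<le> h" and \<kappa>: "0 < \<nu>" "\<nu> < \<kappa>" "\<kappa> < \<kappa>'" "\<kappa>' * h < pi / 2"
    and M: "M \<ge> 0" and K: "K \<ge> 0"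
    and growth: "\<And>w. Re w \<ge> 0 \<Longrightarrow> \<bar>Im w\<bar> \<le> h \<Longrightarrow> cmod (f w) \<le> M * exp (K * exp (\<kappa> * Re w))"
    and rays: "\<And>w. Re w \<ge> 0 \<Longrightarrow> \<bar>Im w\<bar> = h \<Longrightarrow> cmod (f w) \<le> M * exp (K * exp (\<nu> * Re w))"
    and w: "Re w \<ge> 0" "\<bar>Im w\<bar> \<le> h"
  shows "cmod (f w) \<le> M * exp K * exp (K / cos (\<nu> * h) * exp (\<nu> * Re w))"
proof -
  define K' where "K' = K / cos (\<nu> * h)"
  define c' where "c' = cos (\<kappa>' * h)"
  have nh: "0 \<le> \<nu> * h" "\<nu> * h \<le> \<kappa>' * h" using h \<kappa> by (auto intro: mult_right_mono)
  have "cos (\<nu> * h) > 0" by (rule cos_gt_zero_pi) (use nh \<kappa>(4) pi_gt_zero in linarith)+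
  moreover have "c' > 0" unfolding c'_def by (rule cos_gt_zero_pi) (use nh \<kappa>(4) pi_gt_zero in linarith)+
  ultimately have c: "cos (\<nu> * h) > 0" "c' > 0" .
  have K': "K' \<ge> 0" "K' * cos (\<nu> * h) = K" using K c by (auto simp: K'_def)
  have cosge: "cos (t * y) \<ge> cos (t * h)" if "\<bar>y\<bar> \<le> h" "0 < t" "t \<le> \<kappa>'" for t y
  proof -
    have "t * \<bar>y\<bar> \<le> t * h" "t * h \<le> \<kappa>' * h" using that h by (auto intro: mult_left_mono mult_right_mono)
    then have "t * h \<le> pi" using \<kappa>(4) pi_gt_zero by linarith
    moreover have "0 \<le> t * \<bar>y\<bar>" using that by simp
    ultimately have "cos (t * h) \<le> cos (t * \<bar>y\<bar>)"
      using \<open>t * \<bar>y\<bar> \<le> t * h\<close> by (intro cos_monotone_0_pi_le)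
    moreover have "cos (t * \<bar>y\<bar>) = cos (t * y)" by (metis abs_mult abs_of_pos cos_abs_real that(2))
    ultimately show ?thesis by simp
  qed
  have main: "cmod (f w) \<le> M * exp K * exp (K' * exp (\<nu> * Re w)) * exp (\<epsilon> * exp (\<kappa>' * Re w))" if \<epsilon>: "\<epsilon> > 0" for \<epsilon>
  proof -
    define Q where "Q = (\<lambda>w. f w * exp (- of_real K' * exp (of_real \<nu> * w) - of_real \<epsilon> * exp (of_real \<kappa>' * w)))"
    have normQ: "cmod (Q w) = cmod (f w) * exp (- K' * (exp (\<nu> * Re w) * cos (\<nu> * Im w)) - \<epsilon> * (exp (\<kappa>' * Re w) * cos (\<kappa>' * Im w)))" for w
      by (simp add: Q_def norm_mult Re_exp)
    have Qle: "cmod (Q w) \<le> cmod (f w) * exp (- K * exp (\<nu> * Re w) - \<epsilon> * c' * exp (\<kappa>' * Re w))" if "\<bar>Im w\<bar> \<le> h" for w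
    proof -
      have "K' * (exp (\<nu> * Re w) * cos (\<nu> * Im w)) \<ge> K' * (exp (\<nu> * Re w) * cos (\<nu> * h))"
        using K' cosge[OF that, of \<nu>] \<kappa> by (intro mult_left_mono) auto
      also have "K' * (exp (\<nu> * Re w) * cos (\<nu> * h)) = K * exp (\<nu> * Re w)" using K'(2) by (metis mult.assoc mult.commute)
      finally have 1: "K' * (exp (\<nu> * Re w) * cos (\<nu> * Im w)) \<ge> K * exp (\<nu> * Re w)" .
      have "\<epsilon> * (exp (\<kappa>' * Re w) * cos (\<kappa>' * Im w)) \<ge> \<epsilon> * (exp (\<kappa>' * Re w) * c')"
        using \<epsilon> cosge[OF that, of \<kappa>'] \<kappa> unfolding c'_def by (intro mult_left_mono) auto
      moreover have "\<epsilon> * (exp (\<kappa>' * Re w) * c') = \<epsilon> * c' * exp (\<kappa>' * Re w)" by simp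
      ultimately have "- K' * (exp (\<nu> * Re w) * cos (\<nu> * Im w)) - \<epsilon> * (exp (\<kappa>' * Re w) * cos (\<kappa>' * Im w))
          \<le> - K * exp (\<nu> * Re w) - \<epsilon> * c' * exp (\<kappa>' * Re w)"
        using 1 by linarith
      then show ?thesis unfolding normQ by (intro mult_left_mono) auto
    qed
    have "\<forall>\<^sub>F X in at_top. K * exp (\<kappa> * X) \<le> \<epsilon> * c' * exp (\<kappa>' * X)"
    proof -
      have "((\<lambda>X. exp ((\<kappa> - \<kappa>') * X)) \<longlongrightarrow> 0) at_top" using \<kappa> by real_asymp
      then have "((\<lambda>X. K * exp ((\<kappa> - \<kappa>') * X)) \<longlongrightarrow> K * 0) at_top" by (rule tendsto_mult_left)
      then have "\<forall>\<^sub>F X in at_top. K * exp ((\<kappa> - \<kappa>') * X) < \<epsilon> * c'" using c \<epsilon> by (intro order_tendstoD) auto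
      then show ?thesis
      proof eventually_elim
        case (elim X)
        then have "K * exp ((\<kappa> - \<kappa>') * X) * exp (\<kappa>' * X) \<le> \<epsilon> * c' * exp (\<kappa>' * X)" by (intro mult_right_mono) auto
        then show ?case by (simp add: mult.assoc algebra_simps flip: exp_add)
      qed
    qed
    then obtain X0 where "\<And>X. X \<ge> X0 \<Longrightarrow> K * exp (\<kappa> * X) \<le> \<epsilon> * c' * exp (\<kappa>' * X)"
      unfolding eventually_at_top_linorder by blast
    then obtain X where X: "X \<ge> Re w" "X > 0" "K * exp (\<kappa> * X) \<le> \<epsilon> * c' * exp (\<kappa>' * X)"
      using that[of "max X0 (max (Re w) 1)"] by (auto simp: max_def split: if_splits)
    define S where "S = cbox (Complex 0 (- h)) (Complex X h)"
    have S: "z \<in> S \<longleftrightarrow> 0 \<le> Re z \<and> Re z \<le> X \<and> \<bar>Im z\<bar> \<le> h" for z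
      by (auto simp: S_def in_cbox_complex_iff)
    have holQ: "Q holomorphic_on UNIV" unfolding Q_def by (intro holomorphic_intros hol)
    have "cmod (Q w) \<le> M * exp K"
    proof (rule maximum_modulus_frontier[of Q S])
      show "bounded S" "w \<in> S" using w X by (auto simp: S) (simp add: S_def)
      show "Q holomorphic_on interior S" "continuous_on (closure S) Q"
        using holQ by (auto intro: holomorphic_on_subset holomorphic_on_imp_continuous_on)
      fix z assume z: "z \<in> frontier S"
      then have "z \<in> S" "Re z = 0 \<or> Re z = X \<or> \<bar>Im z\<bar> = h"
        unfolding S_def frontier_cbox by (auto simp: in_cbox_complex_iff in_box_complex_iff)
      then consider "\<bar>Im z\<bar> = h" "0 \<le> Re z" | "Re z = 0" "\<bar>Im z\<bar> \<le> h" | "Re z = X" "\<bar>Im z\<bar> \<le> h" by (auto simp: S)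
      then show "cmod (Q z) \<le> M * exp K"
      proof cases
        case 1
        have "cmod (Q z) \<le> cmod (f z) * exp (- K * exp (\<nu> * Re z) - \<epsilon> * c' * exp (\<kappa>' * Re z))" using 1 by (intro Qle) auto
        also have "\<dots> \<le> (M * exp (K * exp (\<nu> * Re z))) * exp (- K * exp (\<nu> * Re z))"
          using rays[OF 1(2,1)] c \<epsilon> M by (intro mult_mono) auto
        also have "\<dots> = M" by (simp add: mult.assoc flip: exp_add)
        also have "\<dots> \<le> M * exp K" using M K mult_left_mono[of 1 "exp K" M] by simp
        finally show ?thesis .
      next
        case 2
        have "cmod (Q z) \<le> cmod (f z) * exp (- K * exp (\<nu> * Re z) - \<epsilon> * c' * exp (\<kappa>' * Re z))" using 2 by (intro Qle) auto
        also have "\<dots> \<le> cmod (f z) * 1"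
        proof (rule mult_left_mono)
          have "0 \<le> K * exp (\<nu> * Re z)" "0 \<le> \<epsilon> * c' * exp (\<kappa>' * Re z)" using K c \<epsilon> by auto
          then show "exp (- K * exp (\<nu> * Re z) - \<epsilon> * c' * exp (\<kappa>' * Re z)) \<le> 1" by simp
        qed simp
        also have "\<dots> \<le> M * exp K" using growth[of z] 2 by simp
        finally show ?thesis .
      next
        case 3
        have "cmod (Q z) \<le> cmod (f z) * exp (- K * exp (\<nu> * Re z) - \<epsilon> * c' * exp (\<kappa>' * Re z))" using 3 by (intro Qle) auto
        also have "\<dots> \<le> (M * exp (K * exp (\<kappa> * Re z))) * exp (- \<epsilon> * c' * exp (\<kappa>' * Re z))"
          using growth[of z] 3 K M X by (intro mult_mono) auto
        also have "\<dots> = M * exp (K * exp (\<kappa> * X) - \<epsilon> * c' * exp (\<kappa>' * X))" using 3 by (simp add: mult.assoc flip: exp_add)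
        also have "\<dots> \<le> M * exp K" using X(3) K M by (intro mult_left_mono) auto
        finally show ?thesis .
      qed
    qed
    then have "cmod (f w) \<le> M * exp K / exp (- K' * (exp (\<nu> * Re w) * cos (\<nu> * Im w)) - \<epsilon> * (exp (\<kappa>' * Re w) * cos (\<kappa>' * Im w)))"
      unfolding normQ by (simp add: pos_le_divide_eq)
    also have "\<dots> = M * exp K * exp (K' * (exp (\<nu> * Re w) * cos (\<nu> * Im w)) + \<epsilon> * (exp (\<kappa>' * Re w) * cos (\<kappa>' * Im w)))"
      by (simp add: exp_minus[symmetric] divide_inverse flip: exp_add)
    also have "\<dots> \<le> M * exp K * exp (K' * (exp (\<nu> * Re w) * 1) + \<epsilon> * (exp (\<kappa>' * Re w) * 1))"
      using M K' \<epsilon> by (intro mult_left_mono) (auto intro!: add_mono mult_left_mono)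
    finally show ?thesis by (simp add: exp_add mult.assoc)
  qed
  have "((\<lambda>\<epsilon>. M * exp K * exp (K' * exp (\<nu> * Re w)) * exp (\<epsilon> * exp (\<kappa>' * Re w))) \<longlongrightarrow>
      M * exp K * exp (K' * exp (\<nu> * Re w)) * exp (0 * exp (\<kappa>' * Re w))) (at_right 0)"
    by (intro tendsto_intros)
  then have "cmod (f w) \<le> M * exp K * exp (K' * exp (\<nu> * Re w)) * exp (0 * exp (\<kappa>' * Re w))"
    by (rule tendsto_lowerbound) (use main in \<open>auto simp: eventually_at_filter\<close>)
  then show ?thesis by (simp add: K'_def)
qed

section \<open>The Tauberian theorem in one variable\<close>

text \<open>A \<mu>-Gevrey expansion in the variable exp(\<mu> w). The scaling normalises the
  opening: a half-strip of height greater than pi is a sector of opening greater than pi \<mu>, the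
  threshold beyond which a sum is determined by its series.\<close>

definition sum_in_strip :: "real \<Rightarrow> real \<Rightarrow> real \<Rightarrow> real \<Rightarrow> real \<Rightarrow> (complex \<Rightarrow> complex) \<Rightarrow> (nat \<Rightarrow> complex) \<Rightarrow> bool" where
  "sum_in_strip \<mu> \<theta> l A C H a \<longleftrightarrow> H holomorphic_on {w. Re w < - l \<and> \<bar>Im w\<bar> < \<theta>} \<and>
     (\<forall>N w. Re w < - l \<longrightarrow> \<bar>Im w\<bar> < \<theta> \<longrightarrow>
        cmod (H w - (\<Sum>n<N. a n * exp (of_real (real n * \<mu>) * w))) \<le> C * A ^ N * fact N powr \<mu> * exp (\<mu> * real N * Re w))"

text \<open>This is \<open>borel_tail_bound\<close> with the first N0 terms restored; each of them
  is exponential in u, hence of size exp(K exp u) because u \<le> exp u. Again \<open>K\<close>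
  precedes \<open>C\<close>, \<open>H\<close> and \<open>a\<close>.\<close>

lemma borel_ray_bound:
  fixes \<mu> \<theta> l A \<sigma> :: real
  assumes \<mu>: "\<mu> > 0" and \<theta>: "pi / 2 < \<theta>" "\<theta> \<le> pi" and l: "l \<ge> 0" and A: "A > 0" and \<sigma>: "\<sigma> < \<mu>"
  shows "\<exists>K>0. \<forall>C\<ge>0. \<forall>H a. sum_in_strip \<mu> \<theta> l A C H a \<longrightarrow> (\<forall>n. cmod (a n) \<le> C * A ^ n * fact n powr \<sigma>) \<longrightarrow>
     (\<forall>u\<ge>0. cmod (\<Sum>n. a n / of_real (Gamma (1 + real n * \<mu>)) * exp (of_real (\<mu> * u)) ^ n) \<le> K * C * exp (K * exp u))"
proof -
  \<comment> \<open>The least N0 with \<mu> N0 \<ge> 1, as \<open>borel_tail_bound\<close>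
    demands.\<close>
  define N0 where "N0 = nat \<lceil>1 / \<mu>\<rceil>"
  have "1 / \<mu> \<le> real N0" unfolding N0_def by linarith
  then have N0: "real N0 * \<mu> \<ge> 1" using \<mu> by (simp add: pos_divide_le_eq)
  have Gpos: "Gamma (1 + real n * \<mu>) > 0" for n using \<mu> by (intro Gamma_real_pos) (simp add: add_pos_nonneg)
  define B where "B = (\<Sum>n<N0. A ^ n * fact n powr \<sigma> / Gamma (1 + real n * \<mu>))"
  have B: "B \<ge> 0" unfolding B_def using A Gpos by (intro sum_nonneg divide_nonneg_pos) auto
  define K where "K = max (A ^ N0 * fact N0 powr \<mu> + B) (2 * (exp l + 1) + \<mu> * real N0)"
  have K: "K > 0" "A ^ N0 * fact N0 powr \<mu> + B \<le> K" "2 * (exp l + 1) \<le> K" "\<mu> * real N0 \<le> K"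
    using A B \<mu> by (auto simp: K_def less_max_iff_disj add_pos_nonneg intro: max.coboundedI2)
  show ?thesis
  proof (intro exI[of _ K] conjI allI impI)
    fix C :: real and H :: "complex \<Rightarrow> complex" and a :: "nat \<Rightarrow> complex" and u :: real
    assume C: "C \<ge> 0" and H: "sum_in_strip \<mu> \<theta> l A C H a" and a: "\<forall>n. cmod (a n) \<le> C * A ^ n * fact n powr \<sigma>" and u: "u \<ge> 0"
    let ?b = "\<lambda>n. a n / of_real (Gamma (1 + real n * \<mu>)) * exp (of_real (\<mu> * u)) ^ n"
    have 1: "cmod ((\<Sum>n. ?b n) - (\<Sum>n<N0. ?b n)) \<le> C * A ^ N0 * fact N0 powr \<mu> * exp (2 * (exp l + 1) * exp u)"
      using H a by (intro borel_tail_bound[OF \<mu> \<theta> l A \<sigma> C, where H = H]) (auto simp: sum_in_strip_def N0)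
    also have "\<dots> \<le> C * A ^ N0 * fact N0 powr \<mu> * exp (K * exp u)"
      using K C A by (intro mult_left_mono) auto
    finally have 1: "cmod ((\<Sum>n. ?b n) - (\<Sum>n<N0. ?b n)) \<le> C * A ^ N0 * fact N0 powr \<mu> * exp (K * exp u)" .
    have "cmod (\<Sum>n<N0. ?b n) \<le> (\<Sum>n<N0. C * (A ^ n * fact n powr \<sigma> / Gamma (1 + real n * \<mu>)) * exp (K * exp u))"
    proof (rule sum_norm_le)
      fix n assume "n \<in> {..<N0}"
      have "cmod (exp (of_real (\<mu> * u)) ^ n) = exp (real n * (\<mu> * u))"
        by (simp add: norm_power flip: exp_of_nat_mult)
      also have "real n * (\<mu> * u) \<le> real N0 * (\<mu> * u)" using \<open>n \<in> _\<close> \<mu> u by (intro mult_right_mono) auto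
      also have "\<dots> = \<mu> * real N0 * u" by simp
      also have "\<dots> \<le> K * exp u" using K u exp_ge_add_one_self[of u] by (intro mult_mono) linarith+
      finally have e: "cmod (exp (of_real (\<mu> * u)) ^ n) \<le> exp (K * exp u)" by simp
      have "cmod (?b n) = cmod (a n) / Gamma (1 + real n * \<mu>) * cmod (exp (of_real (\<mu> * u)) ^ n)"
        using Gpos[of n] by (simp add: norm_mult norm_divide)
      also have "\<dots> \<le> (C * A ^ n * fact n powr \<sigma>) / Gamma (1 + real n * \<mu>) * exp (K * exp u)"
        using a Gpos[of n] C A by (intro mult_mono divide_right_mono e) auto
      finally show "cmod (?b n) \<le> C * (A ^ n * fact n powr \<sigma> / Gamma (1 + real n * \<mu>)) * exp (K * exp u)" by simp
    qed
    also have "\<dots> = C * B * exp (K * exp u)" by (simp add: B_def sum_distrib_left sum_distrib_right mult_ac)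
    finally have 2: "cmod (\<Sum>n<N0. ?b n) \<le> C * B * exp (K * exp u)" .
    have "cmod (\<Sum>n. ?b n) \<le> cmod ((\<Sum>n. ?b n) - (\<Sum>n<N0. ?b n)) + cmod (\<Sum>n<N0. ?b n)"
      using norm_triangle_ineq[of "(\<Sum>n. ?b n) - (\<Sum>n<N0. ?b n)" "\<Sum>n<N0. ?b n"] by simp
    also have "\<dots> \<le> C * A ^ N0 * fact N0 powr \<mu> * exp (K * exp u) + C * B * exp (K * exp u)" using 1 2 by simp
    also have "\<dots> = (A ^ N0 * fact N0 powr \<mu> + B) * C * exp (K * exp u)" by (simp add: algebra_simps)
    also have "\<dots> \<le> K * C * exp (K * exp u)" using K C by (intro mult_right_mono) auto
    finally show "cmod (\<Sum>n. ?b n) \<le> K * C * exp (K * exp u)" .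
  qed (use K in auto)
qed

text \<open>Borel summability along sufficiently many directions bounds the entire Borel transform on
  rays, Phragmen-Lindelof fills the gaps, and Cauchy's estimate then undoes the Borel transform.\<close>

lemma tauberian_one_variable:
  fixes \<mu> \<theta> l A \<sigma> \<gamma> :: real
  assumes \<mu>: "\<mu> > 0" and \<theta>: "pi / 2 < \<theta>" "\<theta> \<le> pi" and l: "l \<ge> 0" and A: "A > 0" and \<sigma>: "0 < \<sigma>" "\<sigma> < \<mu>"
    and \<gamma>: "0 < \<gamma>" "\<gamma> < pi * (\<mu> - \<sigma>)"
  shows "\<exists>K>0. \<forall>C\<ge>0. \<forall>a. (\<forall>n. cmod (a n) \<le> C * A ^ n * fact n powr \<sigma>) \<longrightarrow>
     (\<forall>\<alpha>\<in>{0..2*pi}. \<exists>\<delta>1 \<delta>2. \<delta>1 \<le> \<alpha> \<and> \<alpha> \<le> \<delta>2 \<and> \<delta>2 - \<delta>1 \<le> \<gamma> \<and>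
        (\<forall>\<delta>\<in>{\<delta>1, \<delta>2}. \<exists>H. sum_in_strip \<mu> \<theta> l A C H (\<lambda>n. a n * exp (\<i> * of_real (real n * \<delta>))))) \<longrightarrow>
     (\<forall>n. cmod (a n) \<le> K * C * K ^ n)"
proof -
  define \<nu> where "\<nu> = 1 / \<mu>"
  define \<kappa> where "\<kappa> = 1 / (\<mu> - \<sigma>)"
  \<comment> \<open>The midpoint between the growth order \<kappa> and pi/\<gamma>, the critical
    order for an angle \<gamma>; the upper bound on \<gamma> says exactly that there is a
    gap.\<close>
  define \<kappa>' where "\<kappa>' = (\<kappa> + pi / \<gamma>) / 2"
  have "\<kappa> < pi / \<gamma>" using \<gamma> \<sigma> by (simp add: \<kappa>_def field_simps)
  moreover have "x < (x + y) / 2" "(x + y) / 2 < y" if "x < y" for x y :: real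
    using that by auto
  ultimately have k': "\<kappa> < \<kappa>'" "\<kappa>' < pi / \<gamma>" unfolding \<kappa>'_def by blast+
  have "\<kappa>' * (\<gamma> / 2) < pi / \<gamma> * (\<gamma> / 2)" using k' \<gamma> by (intro mult_strict_right_mono) auto
  then have "\<kappa>' * (\<gamma> / 2) < pi / 2" using \<gamma> by simp
  moreover have "\<nu> < \<kappa>" unfolding \<nu>_def \<kappa>_def using \<sigma> by (intro divide_strict_left_mono) auto
  moreover have "0 < \<nu>" using \<mu> by (simp add: \<nu>_def)
  ultimately have \<kappa>: "0 < \<nu>" "\<nu> < \<kappa>" "\<kappa> < \<kappa>'" "\<kappa>' * (\<gamma> / 2) < pi / 2"
    using k' by auto
  from borel_ray_bound[OF \<mu> \<theta> l A \<sigma>(2)] obtain K1 where K1r: "K1 > 0 \<and> (\<forall>C\<ge>0. \<forall>H a. sum_in_strip \<mu> \<theta> l A C H a \<longrightarrow> (\<forall>n. cmod (a n) \<le> C * A ^ n * fact n powr \<sigma>) \<longrightarrow>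
     (\<forall>u\<ge>0. cmod (\<Sum>n. a n / of_real (Gamma (1 + real n * \<mu>)) * exp (of_real (\<mu> * u)) ^ n) \<le> K1 * C * exp (K1 * exp u)))" ..
  note K1 = conjunct1[OF K1r] and ray = conjunct2[OF K1r]
  from borel_coeff_bound[OF \<mu> \<sigma>(2) A] obtain K2 where K2r: "K2 > 0 \<and> (\<forall>C\<ge>0. \<forall>a :: nat \<Rightarrow> complex. (\<forall>n. cmod (a n) \<le> C * A ^ n * fact n powr \<sigma>) \<longrightarrow>
     (\<forall>y\<ge>0. summable (\<lambda>n. cmod (a n) / Gamma (1 + real n * \<mu>) * y ^ n) \<and>
       (\<Sum>n. cmod (a n) / Gamma (1 + real n * \<mu>) * y ^ n) \<le> K2 * C * exp (K2 * y powr (1 / (\<mu> - \<sigma>)))))" ..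
  note K2 = conjunct1[OF K2r] and all = conjunct2[OF K2r]
  obtain K4 c where K4: "K4 > 0" "c > 0" "\<And>n. Gamma (1 + real n * \<mu>) \<le> K4 * c ^ n * fact n powr \<mu>"
    using Gamma_le_fact_powr[OF \<mu>] by blast
  define Km where "Km = max K1 K2"
  have Km: "0 < Km" "K1 \<le> Km" "K2 \<le> Km" using K1 K2 by (auto simp: Km_def)
  define K3 where "K3 = Km / cos (\<nu> * (\<gamma> / 2))"
  have "\<nu> * (\<gamma> / 2) \<le> \<kappa>' * (\<gamma> / 2)" using \<kappa> \<gamma> by (intro mult_right_mono) auto
  moreover have "0 < \<nu> * (\<gamma> / 2)" using \<kappa> \<gamma> by simp
  ultimately have cos: "cos (\<nu> * (\<gamma> / 2)) > 0" using \<kappa>(4) pi_gt_zero by (intro cos_gt_zero_pi) linarith+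
  then have K3: "K3 > 0" using Km by (simp add: K3_def)
  define Kf where "Kf = max (max 1 (Km * exp Km * K4)) (exp K3 * c)"
  have Kf: "Kf \<ge> 1" "Km * exp Km * K4 \<le> Kf" "exp K3 * c \<le> Kf" by (auto simp: Kf_def)
  have "cmod (a n) \<le> Kf * C * Kf ^ n"
    if C: "C \<ge> 0" and a: "\<forall>n. cmod (a n) \<le> C * A ^ n * fact n powr \<sigma>"
      and dirs: "\<forall>\<alpha>\<in>{0..2*pi}. \<exists>\<delta>1 \<delta>2. \<delta>1 \<le> \<alpha> \<and> \<alpha> \<le> \<delta>2 \<and> \<delta>2 - \<delta>1 \<le> \<gamma> \<and>
        (\<forall>\<delta>\<in>{\<delta>1, \<delta>2}. \<exists>H. sum_in_strip \<mu> \<theta> l A C H (\<lambda>n. a n * exp (\<i> * of_real (real n * \<delta>))))" for C a n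
  proof (cases "n = 0")
    case True
    have "cmod (a 0) \<le> C" using spec[OF a, of 0] by simp
    also have "\<dots> \<le> Kf * C" using C Kf mult_right_mono[of 1 Kf C] by simp
    finally show ?thesis using True by simp
  next
    case False
    define b where "b = (\<lambda>n. a n / of_real (Gamma (1 + real n * \<mu>)))"
    have Gpos: "Gamma (1 + real n * \<mu>) > 0" for n using \<mu> by (intro Gamma_real_pos) (simp add: add_pos_nonneg)
    have nb: "cmod (b n) = cmod (a n) / Gamma (1 + real n * \<mu>)" for n using Gpos[of n] by (simp add: b_def norm_divide)
    have bsum: "summable (\<lambda>n. cmod (b n) * y ^ n)" if "y \<ge> 0" for y
      unfolding nb using mp[OF spec[OF mp[OF spec[OF all] C]] a] that by simp
    define P where "P = (\<lambda>z. \<Sum>n. b n * z ^ n)"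
    have holP: "P holomorphic_on UNIV" unfolding P_def by (rule entire_power_series(2)[OF bsum])
    have growthP: "cmod (P z) \<le> Km * C * exp (Km * cmod z powr \<kappa>)" for z
    proof -
      have "cmod (P z) \<le> (\<Sum>n. cmod (b n) * cmod z ^ n)" unfolding P_def by (rule entire_power_series(3)[OF bsum])
      also have "\<dots> \<le> K2 * C * exp (K2 * cmod z powr (1 / (\<mu> - \<sigma>)))" unfolding nb using mp[OF spec[OF mp[OF spec[OF all] C]] a] by simp
      also have "\<dots> \<le> Km * C * exp (Km * cmod z powr (1 / (\<mu> - \<sigma>)))"
        using Km C K2 by (intro mult_mono) (auto intro: mult_right_mono)
      finally show ?thesis by (simp add: \<kappa>_def)
    qed
    \<comment> \<open>Rotating the coefficients by exp(i n \<delta>) turns the ray of argument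
      \<delta> into the positive axis; there |z| = exp x is the point exp(\<mu> u) with u = \<nu>
      x.\<close>
    have rayP: "cmod (P (exp (of_real x + \<i> * of_real \<delta>))) \<le> Km * C * exp (Km * exp (\<nu> * x))"
      if x: "x \<ge> 0" and H: "sum_in_strip \<mu> \<theta> l A C H (\<lambda>n. a n * exp (\<i> * of_real (real n * \<delta>)))" for x \<delta> H
    proof -
      have a': "\<forall>n. cmod (a n * exp (\<i> * of_real (real n * \<delta>))) \<le> C * A ^ n * fact n powr \<sigma>"
        using a by (simp add: norm_mult)
      have "P (exp (of_real x + \<i> * of_real \<delta>)) =
          (\<Sum>n. a n * exp (\<i> * of_real (real n * \<delta>)) / of_real (Gamma (1 + real n * \<mu>)) * exp (of_real (\<mu> * (\<nu> * x))) ^ n)"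
        unfolding P_def b_def
      proof (rule suminf_cong)
        fix n
        have "exp (of_real x + \<i> * of_real \<delta>) ^ n = exp (\<i> * of_real (real n * \<delta>)) * exp (of_real (\<mu> * (\<nu> * x))) ^ n"
          using \<mu> by (simp add: \<nu>_def exp_add power_mult_distrib mult_ac flip: exp_of_nat_mult)
        then show "a n / of_real (Gamma (1 + real n * \<mu>)) * exp (of_real x + \<i> * of_real \<delta>) ^ n =
           a n * exp (\<i> * of_real (real n * \<delta>)) / of_real (Gamma (1 + real n * \<mu>)) * exp (of_real (\<mu> * (\<nu> * x))) ^ n" by simp
      qed
      also have "cmod \<dots> \<le> K1 * C * exp (K1 * exp (\<nu> * x))"
        using x \<kappa> by (intro mp[OF spec[OF mp[OF mp[OF spec[OF spec[OF mp[OF spec[OF ray] C]]] H] a']]]) simp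
      also have "\<dots> \<le> Km * C * exp (Km * exp (\<nu> * x))"
        using Km C K1 by (intro mult_mono) (auto intro: mult_right_mono)
      finally show ?thesis .
    qed
    have bigP: "cmod (P z) \<le> Km * C * exp Km * exp (K3 * cmod z powr \<nu>)" if z: "cmod z \<ge> 1" for z
    proof -
      define \<alpha> where "\<alpha> = Arg2pi z"
      have z0: "z \<noteq> 0" using z by auto
      have "\<alpha> \<in> {0..2*pi}" unfolding \<alpha>_def using Arg2pi_ge_0[of z] Arg2pi_lt_2pi[of z] by auto
      then obtain \<delta>1 \<delta>2 H1 H2 where \<delta>: "\<delta>1 \<le> \<alpha>" "\<alpha> \<le> \<delta>2" "\<delta>2 - \<delta>1 \<le> \<gamma>"
         and H: "sum_in_strip \<mu> \<theta> l A C H1 (\<lambda>n. a n * exp (\<i> * of_real (real n * \<delta>1)))"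
           "sum_in_strip \<mu> \<theta> l A C H2 (\<lambda>n. a n * exp (\<i> * of_real (real n * \<delta>2)))"
        using dirs by blast
      \<comment> \<open>Recentring between the two good directions makes the strip symmetric about
        the real axis, with the rays of known growth as its edges.\<close>
      define m where "m = (\<delta>1 + \<delta>2) / 2"
      define h where "h = (\<delta>2 - \<delta>1) / 2"
      have h: "0 \<le> h" "h \<le> \<gamma> / 2" "\<delta>2 = m + h" "\<delta>1 = m - h" using \<delta> by (auto simp: h_def m_def field_simps)
      define f where "f = (\<lambda>w. P (exp (w + \<i> * of_real m)))"
      define w where "w = Complex (ln (cmod z)) (\<alpha> - m)"
      have w: "0 \<le> Re w" "\<bar>Im w\<bar> \<le> h" using z \<delta> by (auto simp: w_def h_def m_def abs_le_iff field_simps)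
      have "w + \<i> * of_real m = of_real (ln (cmod z)) + \<i> * of_real \<alpha>" by (simp add: w_def complex_eq_iff)
      moreover have "exp (of_real (ln (cmod z)) + \<i> * of_real \<alpha>) = z"
        unfolding exp_add exp_of_real \<alpha>_def using z0 Arg2pi_eq[of z] by simp
      ultimately have fw: "f w = P z" by (simp add: f_def)
      have holf: "f holomorphic_on UNIV"
        unfolding f_def by (rule holomorphic_on_compose_gen[OF _ holP, unfolded o_def]) (auto intro!: holomorphic_intros)
      have cosle: "cos (\<nu> * h) \<ge> cos (\<nu> * (\<gamma> / 2))"
      proof (rule cos_monotone_0_pi_le)
        show "0 \<le> \<nu> * h" "\<nu> * h \<le> \<nu> * (\<gamma> / 2)" using h \<kappa> by (auto intro: mult_left_mono)
        show "\<nu> * (\<gamma> / 2) \<le> pi" using \<open>\<nu> * (\<gamma> / 2) \<le> \<kappa>' * (\<gamma> / 2)\<close> \<kappa>(4) pi_gt_zero by linarith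
      qed
      have kh: "\<kappa>' * h < pi / 2"
      proof -
        have "\<kappa>' * h \<le> \<kappa>' * (\<gamma> / 2)" using h \<kappa> by (intro mult_left_mono) auto
        then show ?thesis using \<kappa>(4) by linarith
      qed
      have "cmod (f w) \<le> Km * C * exp Km * exp (Km / cos (\<nu> * h) * exp (\<nu> * Re w))"
      proof (rule phragmen_lindelof_strip[OF holf h(1) \<kappa>(1,2,3) kh _ _ _ _ w])
        show "0 \<le> Km * C" "0 \<le> Km" using Km C by auto
        show "cmod (f w) \<le> Km * C * exp (Km * exp (\<kappa> * Re w))" for w
          using growthP[of "exp (w + \<i> * of_real m)"] by (simp add: f_def exp_powr_real mult.commute)
        fix w assume w: "0 \<le> Re w" "\<bar>Im w\<bar> = h"
        have *: "f w = P (exp (of_real (Re w) + \<i> * of_real (m + Im w)))"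
          unfolding f_def by (intro arg_cong[of _ _ P] arg_cong[of _ _ exp]) (simp add: complex_eq_iff)
        from w(2) consider "Im w = h" | "Im w = - h" by linarith
        then show "cmod (f w) \<le> Km * C * exp (Km * exp (\<nu> * Re w))"
          unfolding * using rayP[OF w(1) H(1)] rayP[OF w(1) H(2)] h(3,4) by cases auto
      qed
      also have "\<dots> \<le> Km * C * exp Km * exp (K3 * exp (\<nu> * Re w))"
      proof -
        have "Km / cos (\<nu> * h) \<le> K3" unfolding K3_def using cosle cos Km by (intro divide_left_mono) auto
        then have "Km / cos (\<nu> * h) * exp (\<nu> * Re w) \<le> K3 * exp (\<nu> * Re w)" by (rule mult_right_mono) simp
        then show ?thesis using Km C by (intro mult_left_mono iffD2[OF exp_le_cancel_iff]) auto
      qed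
      also have "exp (\<nu> * Re w) = cmod z powr \<nu>" using z0 by (simp add: w_def powr_def)
      finally show ?thesis unfolding fw .
    qed
    \<comment> \<open>At this radius exp(K3 R^\<nu>) = exp(K3 n) is only geometric, while R^(-n) =
      n^(-n \<mu>) compensates Gamma(1 + n \<mu>).\<close>
    define R where "R = real n powr \<mu>"
    have n1: "real n \<ge> 1" using False by simp
    have R1: "R \<ge> 1" unfolding R_def using n1 \<mu> by (intro ge_one_powr_ge_zero) auto
    have Rnu: "R powr \<nu> = real n" using n1 \<mu> by (simp add: R_def \<nu>_def powr_powr)
    have "cmod (b n) \<le> (Km * C * exp Km * exp (K3 * real n)) / R ^ n"
    proof (rule power_series_coeff_bound[where R' = "R + 1" and f = P])
      show "(\<lambda>n. b n * z ^ n) sums P z" for z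
        unfolding P_def by (rule summable_sums[OF entire_power_series(1)[OF bsum]])
      show "cmod (P z) \<le> Km * C * exp Km * exp (K3 * real n)" if "cmod z = R" for z
        using bigP[of z] that R1 Rnu by simp
    qed (use R1 in auto)
    then have "cmod (a n) \<le> (Km * C * exp Km * exp (K3 * real n)) / R ^ n * Gamma (1 + real n * \<mu>)"
      unfolding nb using Gpos[of n] by (simp add: pos_divide_le_eq)
    also have "\<dots> \<le> (Km * C * exp Km * exp (K3 * real n)) / R ^ n * (K4 * c ^ n * fact n powr \<mu>)"
      using K4 Km C R1 by (intro mult_left_mono) auto
    also have "\<dots> \<le> (Km * C * exp Km * exp (K3 * real n)) / R ^ n * (K4 * c ^ n * R ^ n)"
    proof -
      have "fact n powr \<mu> \<le> (real n ^ n) powr \<mu>"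
        using fact_le_power_self[of n] \<mu> by (intro powr_mono2) auto
      also have "\<dots> = R ^ n" using n1 by (simp add: R_def powr_powr mult.commute flip: powr_realpow)
      finally show ?thesis using K4 Km C R1 by (intro mult_left_mono) auto
    qed
    also have "\<dots> = (Km * exp Km * K4) * C * (exp K3 * c) ^ n"
      using R1 by (simp add: power_mult_distrib mult.commute flip: exp_of_nat_mult)
    also have "\<dots> \<le> Kf * C * Kf ^ n"
      using Kf C Km K4 by (intro mult_mono power_mono) auto
    finally show ?thesis .
  qed
  then show ?thesis using Kf(1) by (intro exI[of _ Kf]) auto
qed

section \<open>Complex functionals of norm at most one\<close>

text \<open>A functional on a subspace is represented by its graph, a subspace of the product with
  the reals. The value c at the new vector y is the supremum of r - norm (u - y); by the triangle
  inequality it exceeds no norm (v + y) - s. Scaling these two inequalities by |t| gives the claim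
  for negative and for positive t.\<close>

lemma hahn_banach_extend:
  fixes M :: "('e::real_normed_vector \<times> real) set"
  assumes M: "subspace M" "\<And>u r. (u, r) \<in> M \<Longrightarrow> r \<le> norm u"
  shows "\<exists>c. \<forall>u r t. (u, r) \<in> M \<longrightarrow> r + t * c \<le> norm (u + t *\<^sub>R y)"
proof -
  define S where "S = (\<lambda>(u, r). r - norm (u - y)) ` M"
  have "(0, 0) \<in> M" using subspace_0[OF M(1)] by (simp add: zero_prod_def)
  then have S: "S \<noteq> {}" by (auto simp: S_def)
  have le: "r - norm (u - y) \<le> norm (v + y) - s" if "(u, r) \<in> M" "(v, s) \<in> M" for u r v s
  proof -
    have "(u + v, r + s) \<in> M" using subspace_add[OF M(1) that] by simp
    then have "r + s \<le> norm (u + v)" by (rule M(2))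
    also have "\<dots> = norm ((u - y) + (v + y))" by (simp add: algebra_simps)
    also have "\<dots> \<le> norm (u - y) + norm (v + y)" by (rule norm_triangle_ineq)
    finally show ?thesis by simp
  qed
  have bdd: "bdd_above S"
  proof (rule bdd_aboveI[of _ "norm (0 + y) - 0"])
    fix z assume "z \<in> S"
    then obtain u r where "(u, r) \<in> M" "z = r - norm (u - y)" by (auto simp: S_def)
    then show "z \<le> norm (0 + y) - 0" using le \<open>(0, 0) \<in> M\<close> by blast
  qed
  define c where "c = Sup S"
  have c1: "r - norm (u - y) \<le> c" if "(u, r) \<in> M" for u r
    unfolding c_def using bdd that by (intro cSup_upper) (auto simp: S_def)
  have c2: "c \<le> norm (v + y) - s" if "(v, s) \<in> M" for v s
    unfolding c_def using S le[OF _ that] by (intro cSup_least) (auto simp: S_def)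
  have "r + t * c \<le> norm (u + t *\<^sub>R y)" if ur: "(u, r) \<in> M" for u r t
  proof -
    have scaled: "((1 / s) *\<^sub>R u, r / s) \<in> M" for s
      using subspace_scale[OF M(1) ur, of "1 / s"] by simp
    consider "t = 0" | "t > 0" | "t < 0" by linarith
    then show ?thesis
    proof cases
      case 1
      then show ?thesis using M(2)[OF ur] by simp
    next
      case 2
      have "t * (norm ((1 / t) *\<^sub>R u + y)) = norm (t *\<^sub>R ((1 / t) *\<^sub>R u + y))" using 2 by simp
      also have "t *\<^sub>R ((1 / t) *\<^sub>R u + y) = u + t *\<^sub>R y" using 2 by (simp add: algebra_simps)
      finally have n: "t * (norm ((1 / t) *\<^sub>R u + y)) = norm (u + t *\<^sub>R y)" .
      have "t * c \<le> t * (norm ((1 / t) *\<^sub>R u + y) - r / t)" using c2[OF scaled, of t] 2 by (intro mult_left_mono) auto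
      also have "\<dots> = norm (u + t *\<^sub>R y) - r" using 2 n by (simp add: right_diff_distrib)
      finally show ?thesis by simp
    next
      case 3
      define s where "s = - t"
      have s: "s > 0" using 3 by (simp add: s_def)
      have "s * (norm ((1 / s) *\<^sub>R u - y)) = norm (s *\<^sub>R ((1 / s) *\<^sub>R u - y))" using s by simp
      also have "s *\<^sub>R ((1 / s) *\<^sub>R u - y) = u + t *\<^sub>R y" using s by (simp add: algebra_simps s_def)
      finally have n: "s * (norm ((1 / s) *\<^sub>R u - y)) = norm (u + t *\<^sub>R y)" .
      have "s * (r / s - norm ((1 / s) *\<^sub>R u - y)) \<le> s * c" using c1[OF scaled, of s] s by (intro mult_left_mono) auto
      then have "r - norm (u + t *\<^sub>R y) \<le> s * c" using s n by (simp add: right_diff_distrib)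
      then show ?thesis by (simp add: s_def)
    qed
  qed
  then show ?thesis by blast
qed

text \<open>For graphs, extension is inclusion, so Zorn's lemma applies to plain sets.
  Single-valuedness comes from the bound r \<le> norm u at u = 0, applied to r and -r; a maximal
  graph is total by \<open>hahn_banach_extend\<close>.\<close>

lemma hahn_banach_real:
  fixes x :: "'e::real_normed_vector"
  obtains f :: "'e \<Rightarrow> real" where "linear f" "\<And>y. f y \<le> norm y" "f x = norm x"
proof -
  define A where "A = {M :: ('e \<times> real) set. subspace M \<and> (x, norm x) \<in> M \<and> (\<forall>u r. (u, r) \<in> M \<longrightarrow> r \<le> norm u)}"
  have "\<exists>M\<in>A. \<forall>X\<in>A. M \<subseteq> X \<longrightarrow> X = M"
  proof (rule subset_Zorn_nonempty)
    have "t * norm x \<le> \<bar>t\<bar> * norm x" for t by (intro mult_right_mono) auto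
    then have "r \<le> norm u" if "(u, r) \<in> span {(x, norm x)}" for u r
      using that by (auto simp: span_singleton)
    then have "span {(x, norm x)} \<in> A" unfolding A_def by (simp add: span_base)
    then show "A \<noteq> {}" by blast
    fix C assume C: "C \<noteq> {}" "subset.chain A C"
    have sub: "subspace X" if "X \<in> C" for X using C that by (auto simp: subset.chain_def A_def)
    have "subspace (\<Union>C)"
      unfolding subspace_def
    proof (intro conjI ballI allI)
      show "0 \<in> \<Union>C" using C(1) sub subspace_0 by blast
      fix u v assume "u \<in> \<Union>C" "v \<in> \<Union>C"
      then obtain X Y where XY: "X \<in> C" "u \<in> X" "Y \<in> C" "v \<in> Y" by blast
      then have "X \<subseteq> Y \<or> Y \<subseteq> X" using C(2) by (auto simp: subset.chain_def)
      then show "u + v \<in> \<Union>C" using XY sub subspace_add by (metis UnionI subsetD)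
    next
      fix t :: real and u assume "u \<in> \<Union>C"
      then show "t *\<^sub>R u \<in> \<Union>C" using sub subspace_scale by blast
    qed
    moreover have "(x, norm x) \<in> \<Union>C" "\<forall>u r. (u, r) \<in> \<Union>C \<longrightarrow> r \<le> norm u"
      using C by (auto simp: subset.chain_def A_def)
    ultimately show "\<Union>C \<in> A" by (simp add: A_def)
  qed
  then obtain M where M: "M \<in> A" "\<And>X. X \<in> A \<Longrightarrow> M \<subseteq> X \<Longrightarrow> X = M" by blast
  have subM: "subspace M" and xM: "(x, norm x) \<in> M" and leM: "\<And>u r. (u, r) \<in> M \<Longrightarrow> r \<le> norm u"
    using M(1) by (auto simp: A_def)
  have total: "\<exists>r. (y, r) \<in> M" for y
  proof -
    obtain c where c: "\<And>u r t. (u, r) \<in> M \<Longrightarrow> r + t * c \<le> norm (u + t *\<^sub>R y)"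
      using hahn_banach_extend[OF subM leM] by blast
    define X where "X = {a + b | a b. a \<in> M \<and> b \<in> span {(y, c)}}"
    have "subspace X" unfolding X_def by (intro subspace_sums subM subspace_span)
    moreover have MX: "M \<subseteq> X"
    proof
      fix a assume "a \<in> M"
      then have "a = a + 0 \<and> a \<in> M \<and> 0 \<in> span {(y, c)}" by (simp add: span_zero)
      then show "a \<in> X" unfolding X_def by blast
    qed
    moreover have "r \<le> norm u" if urX: "(u, r) \<in> X" for u r
    proof -
      obtain a b t where "(u, r) = (a, b) + t *\<^sub>R (y, c)" "(a, b) \<in> M"
      proof -
        obtain p v where p: "(u, r) = p + v" "p \<in> M" "v \<in> span {(y, c)}" using urX unfolding X_def by blast
        then obtain t where "v = t *\<^sub>R (y, c)" by (auto simp: span_singleton)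
        then show ?thesis using p that[of "fst p" "snd p" t] by simp
      qed
      then show ?thesis using c[of a b t] by simp
    qed
    ultimately have "X \<in> A" using xM by (auto simp: A_def)
    then have "X = M" using MX by (rule M(2))
    moreover have "(y, c) \<in> X"
    proof -
      have "(y, c) = 0 + (y, c) \<and> 0 \<in> M \<and> (y, c) \<in> span {(y, c)}"
        using subspace_0[OF subM] span_base[of "(y, c)" "{(y, c)}"] by simp
      then show ?thesis unfolding X_def by blast
    qed
    ultimately show ?thesis by blast
  qed
  have zero: "r = 0" if "(0, r) \<in> M" for r
    using leM[OF that] leM[of 0 "- r"] subspace_neg[OF subM that] by simp
  have uniq: "r = s" if "(y, r) \<in> M" "(y, s) \<in> M" for y r s
    using zero[of "r - s"] subspace_diff[OF subM that] by simp
  define f where "f y = (THE r. (y, r) \<in> M)" for y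
  have fM: "(y, f y) \<in> M" for y
    unfolding f_def using total[of y] uniq by (auto intro: theI)
  have f: "f y = r" if "(y, r) \<in> M" for y r using uniq[OF fM that] .
  show thesis
  proof
    show "linear f"
    proof
      show "f (u + v) = f u + f v" for u v using subspace_add[OF subM fM[of u] fM[of v]] by (simp add: f)
      show "f (t *\<^sub>R u) = t *\<^sub>R f u" for t u using subspace_scale[OF subM fM[of u], of t] by (simp add: f)
    qed
    show "f y \<le> norm y" for y using leM[OF fM] .
    show "f x = norm x" using f[OF xM] .
  qed
qed

definition dual_unit :: "('e::complex_normed_vector \<Rightarrow> complex) \<Rightarrow> bool" where
  "dual_unit \<phi> \<longleftrightarrow> (\<forall>x y. \<phi> (x + y) = \<phi> x + \<phi> y) \<and> (\<forall>c x. \<phi> (c *\<^sub>C x) = c * \<phi> x) \<and> (\<forall>x. cmod (\<phi> x) \<le> norm x)"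

text \<open>The real functional f of the Hahn-Banach theorem is complexified to y \<mapsto> f y - i
  f(i y). Its norm is at most one because a rotation of u makes the value real and thus a value of
  f.\<close>

lemma norm_le_by_dual:
  fixes x :: "'e::complex_normed_vector"
  assumes "\<And>\<phi>. dual_unit \<phi> \<Longrightarrow> cmod (\<phi> x) \<le> M"
  shows "norm x \<le> M"
proof -
  obtain f :: "'e \<Rightarrow> real" where f: "linear f" "\<And>y. f y \<le> norm y" "f x = norm x"
    using hahn_banach_real by blast
  define \<phi> where "\<phi> y = Complex (f y) (- f (\<i> *\<^sub>C y))" for y
  have add: "\<phi> (u + v) = \<phi> u + \<phi> v" for u v
    using f(1) by (simp add: \<phi>_def complex_eq_iff scaleC_add_right linear_add)
  have split: "c *\<^sub>C y = Re c *\<^sub>R y + Im c *\<^sub>R (\<i> *\<^sub>C y)" for c and y :: 'e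
  proof -
    have "c *\<^sub>C y = (of_real (Re c) + of_real (Im c) * \<i>) *\<^sub>C y"
      by (simp add: complex_eq mult.commute flip: complex_eq)
    also have "\<dots> = Re c *\<^sub>R y + Im c *\<^sub>R (\<i> *\<^sub>C y)"
      by (simp add: scaleC_add_left scaleC_of_real flip: scaleC_scaleC)
    finally show ?thesis .
  qed
  have ii: "\<i> *\<^sub>C \<i> *\<^sub>C y = - y" for y :: 'e
    using scaleC_of_real[of "-1" y] by (simp add: scaleC_scaleC)
  have mult: "\<phi> (c *\<^sub>C u) = c * \<phi> u" for c u
  proof -
    have "\<i> *\<^sub>C c *\<^sub>C u = Re c *\<^sub>R (\<i> *\<^sub>C u) - Im c *\<^sub>R u"
      using split[of c "\<i> *\<^sub>C u"] ii[of u] by (simp add: scaleC_scaleC mult.commute)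
    then show ?thesis using f(1) split[of c u]
      by (simp add: \<phi>_def complex_eq_iff linear_add linear_diff linear_scale)
  qed
  have norm: "cmod (\<phi> u) \<le> norm u" for u
  proof (cases "\<phi> u = 0")
    case False
    define c where "c = cnj (\<phi> u) / of_real (cmod (\<phi> u))"
    have c: "cmod c = 1" using False by (simp add: c_def norm_divide)
    have "\<phi> (c *\<^sub>C u) = of_real (cmod (\<phi> u))"
      using False complex_norm_square[of "\<phi> u"] by (simp add: mult c_def field_simps power2_eq_square)
    then have "cmod (\<phi> u) = Re (\<phi> (c *\<^sub>C u))" by simp
    also have "\<dots> = f (c *\<^sub>C u)" by (simp add: \<phi>_def)
    also have "\<dots> \<le> norm (c *\<^sub>C u)" by (rule f(2))
    also have "\<dots> = norm u" by (simp add: norm_scaleC c)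
    finally show ?thesis .
  qed simp
  have "dual_unit \<phi>" using add mult norm by (simp add: dual_unit_def)
  then have "cmod (\<phi> x) \<le> M" by (rule assms)
  moreover have "norm x \<le> cmod (\<phi> x)" using f(3) complex_Re_le_cmod[of "\<phi> x"] by (simp add: \<phi>_def)
  ultimately show ?thesis by linarith
qed

lemma dual_unit_bounded_linear:
  assumes "dual_unit \<phi>"
  shows "bounded_linear \<phi>"
proof (rule bounded_linear_intro[where K = 1])
  show "\<phi> (r *\<^sub>R x) = r *\<^sub>R \<phi> x" for r x
    using assms scaleC_of_real[of r x] by (metis dual_unit_def scaleR_conv_of_real)
qed (use assms in \<open>auto simp: dual_unit_def\<close>)

lemma bounded_bilinear_scaleC: "bounded_bilinear (\<lambda>c x::'e::complex_normed_vector. c *\<^sub>C x)"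
proof
  show "(r *\<^sub>R c) *\<^sub>C x = r *\<^sub>R (c *\<^sub>C x)" for r c and x :: 'e
    using scaleC_of_real[of r "c *\<^sub>C x"] by (simp add: scaleC_scaleC scaleR_conv_of_real)
  show "c *\<^sub>C (r *\<^sub>R x) = r *\<^sub>R (c *\<^sub>C x)" for r c and x :: 'e
    using scaleC_of_real[of r x] scaleC_of_real[of r "c *\<^sub>C x"] by (metis scaleC_scaleC mult.commute)
  show "\<exists>K. \<forall>a (b::'e). norm (a *\<^sub>C b) \<le> norm a * norm b * K"
    by (rule exI[of _ 1]) (simp add: norm_scaleC)
qed (simp_all add: scaleC_add_left scaleC_add_right)

section \<open>Double power series\<close>

definition double_sum :: "'e::complex_banach series2 \<Rightarrow> complex \<Rightarrow> complex \<Rightarrow> 'e \<Rightarrow> bool" where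
  "double_sum c x1 x2 s \<longleftrightarrow> ((\<lambda>(m, j). (x1 ^ m * x2 ^ j) *\<^sub>C c m j) has_sum s) UNIV"

lemma expands_2_iff: "expands_2 r c g \<longleftrightarrow> (\<forall>x1 x2. cmod x1 < r \<longrightarrow> cmod x2 < r \<longrightarrow> double_sum c x1 x2 (g (x1, x2)))"
  by (auto simp: expands_2_def double_sum_def polydisc_def)

lemma scaleC_zero [simp]: "0 *\<^sub>C x = (0::'e::complex_normed_vector)" "c *\<^sub>C (0::'e) = 0"
  by (rule bounded_bilinear.zero_left[OF bounded_bilinear_scaleC])
     (rule bounded_bilinear.zero_right[OF bounded_bilinear_scaleC])

lemma scaleC_one [simp]: "1 *\<^sub>C x = (x::'e::complex_normed_vector)"
  using scaleC_of_real[of 1 x] by simp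

lemma bounded_linear_scaleC: "bounded_linear (\<lambda>x::'e::complex_normed_vector. c *\<^sub>C x)"
  by (rule bounded_bilinear.bounded_linear_right[OF bounded_bilinear_scaleC])

lemma bounded_linear_scaleC_left: "bounded_linear (\<lambda>c. c *\<^sub>C (x::'e::complex_normed_vector))"
  by (rule bounded_bilinear.bounded_linear_left[OF bounded_bilinear_scaleC])

lemma scaleC_diff_right: "c *\<^sub>C (x - y) = c *\<^sub>C x - c *\<^sub>C (y::'e::complex_normed_vector)"
  by (rule bounded_bilinear.diff_right[OF bounded_bilinear_scaleC])

lemma product_has_sum:
  fixes f g :: "nat \<Rightarrow> real"
  assumes "(f has_sum a) UNIV" "(g has_sum b) UNIV" "\<And>n. f n \<ge> 0" "\<And>n. g n \<ge> 0"
  shows "((\<lambda>(m, j). f m * g j) has_sum a * b) UNIV"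
proof -
  have 1: "((\<lambda>j. (\<lambda>(m, j). f m * g j) (m, j)) has_sum f m * b) UNIV" for m
    using has_sum_cmult_right[OF assms(2), of "f m"] by simp
  have 2: "((\<lambda>m. f m * b) has_sum a * b) UNIV" using has_sum_cmult_left[OF assms(1), of b] .
  have "(\<lambda>(m, j). f m * g j) summable_on (SIGMA m:UNIV. UNIV)"
    by (rule summable_on_SigmaI[OF 1]) (use 2 assms in \<open>auto simp: summable_on_def\<close>)
  then have "((\<lambda>(m, j). f m * g j) has_sum a * b) (SIGMA m:UNIV. UNIV)"
    by (intro has_sum_SigmaI[OF 1 2])
  then show ?thesis by simp
qed

lemma has_sum_geometric_nat:
  fixes q :: real assumes "0 \<le> q" "q < 1"
  shows "((\<lambda>n. q ^ n) has_sum 1 / (1 - q)) UNIV"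
  using assms by (intro sums_nonneg_imp_has_sum) (auto intro: geometric_sums)

lemma double_sum_bounded:
  fixes c :: "'e::complex_banach series2"
  assumes c: "\<And>m j. norm (c m j) \<le> M * A ^ m * A ^ j" and A: "A \<ge> 0"
    and q: "A * cmod x1 \<le> q" "A * cmod x2 \<le> q" "q < 1"
  obtains s where "double_sum c x1 x2 s" "norm s \<le> M / (1 - q)\<^sup>2"
proof -
  have q0: "0 \<le> q" using q A by (meson mult_nonneg_nonneg norm_ge_zero order_trans)
  have M: "M \<ge> 0" using c[of 0 0] norm_ge_zero[of "c 0 0"] by (simp del: norm_ge_zero)
  have g: "((\<lambda>(m, j). q ^ m * q ^ j) has_sum 1 / (1 - q) * (1 / (1 - q))) UNIV"
    using q0 q by (intro product_has_sum has_sum_geometric_nat) auto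
  then have g': "((\<lambda>x. M * (\<lambda>(m, j). q ^ m * q ^ j) x) has_sum M * (1 / (1 - q) * (1 / (1 - q)))) UNIV"
    by (rule has_sum_cmult_right)
  have le: "norm (case x of (m, j) \<Rightarrow> (x1 ^ m * x2 ^ j) *\<^sub>C c m j) \<le> M * (\<lambda>(m, j). q ^ m * q ^ j) x" for x
  proof -
    obtain m j where x: "x = (m, j)" by (cases x)
    have "norm ((x1 ^ m * x2 ^ j) *\<^sub>C c m j) \<le> (cmod x1 ^ m * cmod x2 ^ j) * (M * A ^ m * A ^ j)"
      unfolding norm_scaleC norm_mult norm_power by (intro mult_left_mono c) auto
    also have "\<dots> = M * ((A * cmod x1) ^ m * (A * cmod x2) ^ j)" by (simp add: power_mult_distrib)
    also have "\<dots> \<le> M * (q ^ m * q ^ j)" using q A M q0 by (intro mult_left_mono mult_mono power_mono) auto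
    finally show ?thesis by (simp add: x)
  qed
  have abs: "(\<lambda>x. case x of (m, j) \<Rightarrow> (x1 ^ m * x2 ^ j) *\<^sub>C c m j) abs_summable_on UNIV"
    by (rule summable_on_comparison_test[OF has_sum_imp_summable[OF g']]) (use le in auto)
  then obtain s where s: "double_sum c x1 x2 s"
    unfolding double_sum_def using abs_summable_summable[OF abs] by (auto simp: summable_on_def)
  have "norm s = norm (infsum (\<lambda>x. case x of (m, j) \<Rightarrow> (x1 ^ m * x2 ^ j) *\<^sub>C c m j) UNIV)"
    using s unfolding double_sum_def by (simp add: infsumI)
  also have "\<dots> \<le> infsum (\<lambda>x. norm (case x of (m, j) \<Rightarrow> (x1 ^ m * x2 ^ j) *\<^sub>C c m j)) UNIV"
    by (rule norm_infsum_bound[OF abs])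
  also have "\<dots> \<le> M * (1 / (1 - q) * (1 / (1 - q)))"
    by (rule has_sum_mono[OF has_sum_infsum[OF abs] g']) (use le in auto)
  finally show thesis using s by (intro that) (auto simp: power2_eq_square)
qed

lemma double_sum_unique: "double_sum c x1 x2 s \<Longrightarrow> double_sum c x1 x2 t \<Longrightarrow> s = t"
  unfolding double_sum_def by (rule has_sum_unique)

lemma double_sum_alt:
  "double_sum c x1 x2 s \<longleftrightarrow> ((\<lambda>x. (x1 ^ fst x * x2 ^ snd x) *\<^sub>C c (fst x) (snd x)) has_sum s) UNIV"
  unfolding double_sum_def case_prod_unfold ..

lemma double_sum_add:
  assumes "double_sum c x1 x2 s" "double_sum d x1 x2 t"
  shows "double_sum (\<lambda>m j. c m j + d m j) x1 x2 (s + t)"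
  using has_sum_add[OF assms[unfolded double_sum_alt]]
  unfolding double_sum_alt scaleC_add_right[symmetric] .

lemma double_sum_diff:
  assumes "double_sum c x1 x2 s" "double_sum d x1 x2 t"
  shows "double_sum (\<lambda>m j. c m j - d m j) x1 x2 (s - t)"
proof -
  have "((\<lambda>x. - ((x1 ^ fst x * x2 ^ snd x) *\<^sub>C d (fst x) (snd x))) has_sum - t) UNIV"
    using assms(2) unfolding double_sum_alt has_sum_uminus by simp
  from has_sum_add[OF assms(1)[unfolded double_sum_alt] this]
  show ?thesis unfolding double_sum_alt by (simp add: scaleC_diff_right)
qed

lemma double_sum_swap:
  assumes "double_sum c x1 x2 s"
  shows "double_sum (\<lambda>m j. c j m) x2 x1 s"
proof -
  have "((\<lambda>(m, j). (x1 ^ m * x2 ^ j) *\<^sub>C c m j) has_sum s) (UNIV \<times> UNIV)"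
    using assms by (simp add: double_sum_def)
  then have "((\<lambda>(x, y). (x1 ^ y * x2 ^ x) *\<^sub>C c y x) has_sum s) (UNIV \<times> UNIV)"
    by (subst (asm) has_sum_swap) simp
  then show ?thesis by (simp add: double_sum_def mult.commute)
qed

lemma double_sum_shift:
  assumes "double_sum d x1 x2 s"
  shows "double_sum (\<lambda>m j. if P \<le> m \<and> Q \<le> j then d (m - P) (j - Q) else 0) x1 x2 ((x1 ^ P * x2 ^ Q) *\<^sub>C s)"
proof -
  define h where "h = (\<lambda>(m::nat, j::nat). (m + P, j + Q))"
  have inj: "inj_on h UNIV" by (auto simp: h_def inj_on_def)
  let ?f = "\<lambda>(m, j). (x1 ^ m * x2 ^ j) *\<^sub>C (if P \<le> m \<and> Q \<le> j then d (m - P) (j - Q) else 0)"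
  have "((\<lambda>x. (x1 ^ P * x2 ^ Q) *\<^sub>C (case x of (m, j) \<Rightarrow> (x1 ^ m * x2 ^ j) *\<^sub>C d m j)) has_sum (x1 ^ P * x2 ^ Q) *\<^sub>C s) UNIV"
    using assms unfolding double_sum_def by (rule has_sum_bounded_linear[OF bounded_linear_scaleC])
  also have "(\<lambda>x. (x1 ^ P * x2 ^ Q) *\<^sub>C (case x of (m, j) \<Rightarrow> (x1 ^ m * x2 ^ j) *\<^sub>C d m j)) = ?f \<circ> h"
    by (auto simp: h_def fun_eq_iff scaleC_scaleC power_add mult_ac)
  finally have "(?f has_sum (x1 ^ P * x2 ^ Q) *\<^sub>C s) (h ` UNIV)"
    by (subst has_sum_reindex[OF inj])
  moreover have "(?f has_sum (x1 ^ P * x2 ^ Q) *\<^sub>C s) (h ` UNIV) \<longleftrightarrow> (?f has_sum (x1 ^ P * x2 ^ Q) *\<^sub>C s) UNIV"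
  proof (rule has_sum_cong_neutral)
    fix x assume "x \<in> UNIV - h ` UNIV"
    obtain m j where x: "x = (m, j)" by (cases x)
    have "\<not> (P \<le> m \<and> Q \<le> j)"
    proof
      assume "P \<le> m \<and> Q \<le> j"
      then have "x = h (m - P, j - Q)" by (simp add: x h_def)
      then show False using \<open>x \<in> UNIV - h ` UNIV\<close> by blast
    qed
    then show "?f x = 0" by (auto simp: x)
  qed auto
  ultimately show ?thesis by (simp add: double_sum_def)
qed

text \<open>Multiplication by (x1^p x2^q)^n moves the L-shaped support of f_n to the n-th shell, and
  the shells n < N fill the complement of the quadrant m \<ge> N p, j \<ge> N q. Partial sums of
  decompositions for different monomials thus become truncations of the same array to different
  index sets.\<close>

lemma double_sum_truncation:
  assumes "\<And>n. n < N \<Longrightarrow> double_sum (monomial_part p q a n) x1 x2 (F n)"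
  shows "double_sum (\<lambda>m j. if m < N * p \<or> j < N * q then a m j else 0) x1 x2
           (\<Sum>n<N. (x1 ^ p * x2 ^ q) ^ n *\<^sub>C F n)"
  using assms
proof (induction N)
  case 0
  then show ?case by (simp add: double_sum_def case_prod_unfold)
next
  case (Suc N)
  have "double_sum (\<lambda>m j. (if m < N * p \<or> j < N * q then a m j else 0) +
      (if N * p \<le> m \<and> N * q \<le> j then monomial_part p q a N (m - N * p) (j - N * q) else 0)) x1 x2
      ((\<Sum>n<N. (x1 ^ p * x2 ^ q) ^ n *\<^sub>C F n) + (x1 ^ (N * p) * x2 ^ (N * q)) *\<^sub>C F N)"
    using Suc by (intro double_sum_add double_sum_shift) auto
  also have "(\<lambda>m j. (if m < N * p \<or> j < N * q then a m j else 0) +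
      (if N * p \<le> m \<and> N * q \<le> j then monomial_part p q a N (m - N * p) (j - N * q) else 0))
     = (\<lambda>m j. if m < Suc N * p \<or> j < Suc N * q then a m j else 0)"
    by (auto simp: monomial_part_def fun_eq_iff)
  also have "x1 ^ (N * p) * x2 ^ (N * q) = (x1 ^ p * x2 ^ q) ^ N"
    by (simp add: power_mult_distrib power_mult[symmetric] mult.commute)
  finally show ?case by simp
qed

text \<open>Adding one index to a large finite set changes the partial sum by less than 2; the
  finitely many terms inside that set are bounded by the sum of their norms.\<close>

lemma summable_on_imp_bounded_terms:
  fixes f :: "'a \<Rightarrow> 'b::real_normed_vector"
  assumes "f summable_on A"
  obtains K where "K > 0" "\<And>x. x \<in> A \<Longrightarrow> norm (f x) \<le> K"
proof -
  obtain s where "(f has_sum s) A" using assms by (auto simp: summable_on_def)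
  then have "\<forall>\<^sub>F X in finite_subsets_at_top A. dist (sum f X) s < 1"
    unfolding has_sum_def by (rule tendstoD) simp
  then have "\<exists>X. finite X \<and> X \<subseteq> A \<and> (\<forall>Y. finite Y \<and> X \<subseteq> Y \<and> Y \<subseteq> A \<longrightarrow> dist (sum f Y) s < 1)"
    unfolding eventually_finite_subsets_at_top .
  then obtain X where "finite X \<and> X \<subseteq> A \<and> (\<forall>Y. finite Y \<and> X \<subseteq> Y \<and> Y \<subseteq> A \<longrightarrow> dist (sum f Y) s < 1)" ..
  then have X: "finite X" "X \<subseteq> A" "\<And>Y. finite Y \<Longrightarrow> X \<subseteq> Y \<Longrightarrow> Y \<subseteq> A \<Longrightarrow> dist (sum f Y) s < 1"
    by auto
  define K where "K = 2 + (\<Sum>x\<in>X. norm (f x))"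
  have nn: "0 \<le> (\<Sum>x\<in>X. norm (f x))" by (simp add: sum_nonneg)
  have "norm (f x) \<le> K" if x: "x \<in> A" for x
  proof (cases "x \<in> X")
    case True
    then have "norm (f x) \<le> (\<Sum>x\<in>X. norm (f x))" using X(1) by (intro member_le_sum) auto
    then show ?thesis by (simp add: K_def)
  next
    case False
    have "dist (sum f (insert x X)) s < 1" using X x by (intro X(3)) auto
    moreover have "dist (sum f X) s < 1" using X by (intro X(3)) auto
    ultimately have "dist (sum f (insert x X)) (sum f X) < 2"
      using dist_triangle2[of "sum f (insert x X)" "sum f X" s] by linarith
    moreover have "dist (sum f (insert x X)) (sum f X) = norm (f x)" using False X(1) by (simp add: dist_norm)
    ultimately show ?thesis using nn by (simp add: K_def)
  qed
  then show thesis using nn by (intro that[of K]) (auto simp: K_def)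
qed

lemma double_sum_coeff_bound:
  assumes "double_sum c (of_real \<rho>) (of_real \<rho>) s" "\<rho> > 0"
  obtains K where "K > 0" "\<And>m j. norm (c m j) \<le> K * (1 / \<rho>) ^ m * (1 / \<rho>) ^ j"
proof -
  have "(\<lambda>(m, j). (of_real \<rho> ^ m * of_real \<rho> ^ j) *\<^sub>C c m j) summable_on UNIV"
    using assms(1) by (auto simp: double_sum_def summable_on_def)
  then obtain K where K: "K > 0" "\<And>x. norm (case x of (m, j) \<Rightarrow> (of_real \<rho> ^ m * of_real \<rho> ^ j) *\<^sub>C c m j) \<le> K"
    by (rule summable_on_imp_bounded_terms) auto
  have "norm (c m j) \<le> K * (1 / \<rho>) ^ m * (1 / \<rho>) ^ j" for m j
    using K(2)[of "(m, j)"] assms(2)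
    by (simp add: norm_scaleC norm_mult norm_power power_one_over field_simps)
  then show thesis using K(1) by (intro that) auto
qed

lemma double_sum_dual:
  assumes "double_sum c x1 x2 s" "dual_unit \<phi>"
  shows "double_sum (\<lambda>m j. \<phi> (c m j)) x1 x2 (\<phi> s)"
proof -
  have "\<phi> (z *\<^sub>C x) = z *\<^sub>C \<phi> x" for z x using assms(2) by (simp add: dual_unit_def scaleC_complex_def)
  then show ?thesis
    using has_sum_bounded_linear[OF dual_unit_bounded_linear[OF assms(2)] assms(1)[unfolded double_sum_alt]]
    unfolding double_sum_alt by simp
qed

section \<open>Termwise differentiation and Taylor coefficients\<close>

text \<open>The majorant \<open>B\<close> makes the series of derivatives converge uniformly. The
  domain is a general complex normed space so that power series in one and in two variables are both
  covered.\<close>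

lemma holomorphic_map_series:
  fixes f :: "nat \<Rightarrow> 'a::complex_normed_vector \<Rightarrow> 'b::complex_banach"
  assumes S: "open S" "convex S"
    and D: "\<And>n x. x \<in> S \<Longrightarrow> (f n has_derivative D n x) (at x)"
    and lin: "\<And>n x c h. x \<in> S \<Longrightarrow> D n x (c *\<^sub>C h) = c *\<^sub>C D n x h"
    and B: "\<And>n x h. x \<in> S \<Longrightarrow> norm (D n x h) \<le> B n * norm h" "summable B"
    and sums: "\<And>x. x \<in> S \<Longrightarrow> (\<lambda>n. f n x) sums g x"
  shows "\<And>x. x \<in> S \<Longrightarrow> (g has_derivative (\<lambda>h. \<Sum>n. D n x h)) (at x)"
    and "\<And>x h. x \<in> S \<Longrightarrow> summable (\<lambda>n. D n x h)"
    and "holomorphic_map S g"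
proof -
  have sm: "summable (\<lambda>n. norm (D n x h))" if "x \<in> S" for x h
    by (rule summable_comparison_test'[OF summable_mult2[OF B(2), of "norm h"], of 0]) (use B(1)[OF that] in simp)
  show sm': "summable (\<lambda>n. D n x h)" if "x \<in> S" for x h using sm[OF that] by (rule summable_norm_cancel)
  have unif: "\<forall>\<^sub>F n in sequentially. \<forall>x\<in>S. \<forall>h. norm (sum (\<lambda>i. D i x h) {..<n} - (\<Sum>i. D i x h)) \<le> e * norm h"
    if e: "e > 0" for e
  proof -
    obtain N where N: "\<And>n. n \<ge> N \<Longrightarrow> norm (\<Sum>i. B (i + n)) < e" using suminf_exist_split[OF e B(2)] by blast
    show ?thesis unfolding eventually_sequentially
    proof (intro exI allI impI ballI)
      fix n :: nat and x h :: 'a assume n: "N \<le> n" and x: "x \<in> S"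
      have sB: "summable (\<lambda>i. B (i + n) * norm h)" using B(2) by (intro summable_mult2) (simp add: summable_iff_shift)
      have sD: "summable (\<lambda>i. norm (D (i + n) x h))" using summable_iff_shift[of "\<lambda>i. norm (D i x h)" n] sm[OF x] by simp
      have "(\<Sum>i. D i x h) = (\<Sum>i. D (i + n) x h) + (\<Sum>i<n. D i x h)"
        by (rule suminf_split_initial_segment[OF sm'[OF x]])
      then have "norm ((\<Sum>i<n. D i x h) - (\<Sum>i. D i x h)) = norm (\<Sum>i. D (i + n) x h)"
        by (metis add_diff_cancel_right' norm_minus_commute add.commute)
      also have "\<dots> \<le> (\<Sum>i. norm (D (i + n) x h))" by (rule summable_norm[OF sD])
      also have "\<dots> \<le> (\<Sum>i. B (i + n) * norm h)" by (rule suminf_le[OF B(1)[OF x] sD sB])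
      also have "\<dots> = (\<Sum>i. B (i + n)) * norm h"
        using B(2) by (intro suminf_mult2[symmetric]) (simp add: summable_iff_shift)
      also have "\<dots> \<le> e * norm h" using N[OF n] by (intro mult_right_mono) auto
      finally show "norm ((\<Sum>i<n. D i x h) - (\<Sum>i. D i x h)) \<le> e * norm h" .
    qed
  qed
  show der: "(g has_derivative (\<lambda>h. \<Sum>n. D n x h)) (at x)" if x: "x \<in> S" for x
  proof -
    have "\<exists>g'. \<forall>x\<in>S. (\<lambda>n. f n x) sums (g' x) \<and> (g' has_derivative (\<lambda>h. \<Sum>n. D n x h)) (at x within S)"
      by (rule has_derivative_series[where f = f and f' = D and x = x and l = "g x", OF S(2) _ unif x sums[OF x]])
         (use D in \<open>auto intro: has_derivative_at_withinI\<close>)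
    then obtain g' where g': "\<And>x. x \<in> S \<Longrightarrow> (\<lambda>n. f n x) sums (g' x)" "\<And>x. x \<in> S \<Longrightarrow> (g' has_derivative (\<lambda>h. \<Sum>n. D n x h)) (at x within S)"
      by blast
    have "(g' has_derivative (\<lambda>h. \<Sum>n. D n x h)) (at x)" using g'(2)[OF x] at_within_open[OF x S(1)] by simp
    moreover have "g' y = g y" if "y \<in> S" for y using sums_unique2[OF g'(1)[OF that] sums[OF that]] .
    ultimately show ?thesis using has_derivative_transform_within_open[OF _ S(1) x] by blast
  qed
  have "(\<Sum>n. D n x (c *\<^sub>C h)) = c *\<^sub>C (\<Sum>n. D n x h)" if "x \<in> S" for x c h
    unfolding lin[OF that] by (rule bounded_linear.suminf[OF bounded_linear_scaleC sm'[OF that], symmetric])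
  then show "holomorphic_map S g" using der unfolding holomorphic_map_def by blast
qed

lemma complex_deriv_eq:
  assumes "(f has_derivative D) (at z)" "\<And>h. D h = h *\<^sub>C v"
  shows "complex_deriv f z = v"
proof -
  have D: "D = (\<lambda>h. h *\<^sub>C v)" using assms(2) by auto
  show ?thesis unfolding complex_deriv_def
  proof (rule the_equality)
    show "(f has_derivative (\<lambda>h. h *\<^sub>C v)) (at z)" using assms(1) D by simp
    fix w assume "(f has_derivative (\<lambda>h. h *\<^sub>C w)) (at z)"
    then have "(\<lambda>h. h *\<^sub>C w) = D" using assms(1) by (rule has_derivative_unique)
    then have "1 *\<^sub>C w = 1 *\<^sub>C v" using D by metis
    then show "w = v" by simp
  qed
qed

lemma summable_derivative_majorant:
  fixes \<rho> :: real
  assumes "0 \<le> \<rho>" "\<rho> < \<rho>'"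
  shows "summable (\<lambda>n. real n * \<rho> ^ (n - 1) * (1 / \<rho>') ^ n)"
proof -
  have "summable (\<lambda>n. diffs (\<lambda>n. (1 / \<rho>') ^ n) n * \<rho> ^ n)"
  proof (rule termdiff_converges[of \<rho> \<rho>'])
    show "norm \<rho> < \<rho>'" using assms by simp
    fix x :: real assume "norm x < \<rho>'"
    then have "norm (x / \<rho>') < 1" by simp
    then have "summable (\<lambda>n. (x / \<rho>') ^ n)" by (rule summable_geometric)
    then show "summable (\<lambda>n. (1 / \<rho>') ^ n * x ^ n)" by (simp add: power_divide)
  qed
  then have "summable (\<lambda>n. real (Suc n) * \<rho> ^ (Suc n - 1) * (1 / \<rho>') ^ Suc n)"
    by (simp add: diffs_def mult_ac)
  then show ?thesis by (subst (asm) summable_Suc_iff)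
qed

lemma has_derivative_power_scaleC:
  fixes c :: "'e::complex_normed_vector"
  shows "((\<lambda>z. z ^ n *\<^sub>C c) has_derivative (\<lambda>h. h *\<^sub>C ((of_nat n * z ^ (n - 1)) *\<^sub>C c))) (at z)"
proof -
  have "((\<lambda>z. z ^ n) has_derivative (\<lambda>h. h * (of_nat n * z ^ (n - 1)))) (at z)"
    by (rule has_derivative_eq_rhs[OF has_derivative_power[OF has_derivative_ident]]) (simp add: fun_eq_iff mult_ac)
  from bounded_linear.has_derivative[OF bounded_linear_scaleC_left[of c] this]
  show ?thesis by (simp add: scaleC_scaleC)
qed

lemma expands_1_coeff_bound:
  assumes "expands_1 r c g" "0 < \<rho>" "\<rho> < r"
  obtains K where "K > 0" "\<And>n. norm (c n) \<le> K * (1 / \<rho>) ^ n"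
proof -
  have "summable (\<lambda>m. of_real \<rho> ^ m *\<^sub>C c m)" using assms by (auto simp: expands_1_def sums_iff)
  then have "Bseq (\<lambda>m. of_real \<rho> ^ m *\<^sub>C c m)" using summable_LIMSEQ_zero convergent_imp_Bseq convergentI by blast
  then obtain K where K: "K > 0" "\<And>n. norm (of_real \<rho> ^ n *\<^sub>C c n) \<le> K" unfolding Bseq_def by blast
  have "norm (c n) \<le> K * (1 / \<rho>) ^ n" for n
    using K(2)[of n] assms by (simp add: norm_scaleC norm_power power_one_over field_simps)
  with K(1) show thesis by (rule that)
qed

lemma expands_1_deriv:
  fixes c :: "nat \<Rightarrow> 'e::complex_banach"
  assumes ex: "expands_1 r c g"
  shows "holomorphic_map (ball 0 r) g" "expands_1 r (\<lambda>n. of_nat (Suc n) *\<^sub>C c (Suc n)) (complex_deriv g)"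
proof -
  have loc: "\<exists>D. (g has_derivative D) (at z) \<and> (\<forall>c h. D (c *\<^sub>C h) = c *\<^sub>C D h) \<and>
       (\<lambda>n. z ^ n *\<^sub>C (of_nat (Suc n) *\<^sub>C c (Suc n))) sums complex_deriv g z" if z: "z \<in> ball 0 r" for z
  proof -
    \<comment> \<open>Two radii beyond |z|: the larger \<rho>' for the coefficient bound, \<rho> for
      the ball on which the derivatives are majorised.\<close>
    obtain \<rho> where \<rho>: "cmod z < \<rho>" "\<rho> < r" using z dense[of "cmod z" r] by auto
    obtain \<rho>' where \<rho>': "\<rho> < \<rho>'" "\<rho>' < r" using \<rho> dense[of \<rho> r] by auto
    have \<rho>0: "0 < \<rho>" using \<rho>(1) by (meson norm_ge_zero order_le_less_trans)
    obtain K where K: "K > 0" "\<And>n. norm (c n) \<le> K * (1 / \<rho>') ^ n"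
      using expands_1_coeff_bound[OF ex, of \<rho>'] \<rho>0 \<rho>' by auto
    define D where "D = (\<lambda>n z h. h *\<^sub>C ((of_nat n * z ^ (n - 1)) *\<^sub>C c n))"
    define B where "B = (\<lambda>n. K * (real n * \<rho> ^ (n - 1) * (1 / \<rho>') ^ n))"
    have sB: "summable B" unfolding B_def using \<rho>0 \<rho>' by (intro summable_mult summable_derivative_majorant) auto
    have bd: "norm (D n x h) \<le> B n * norm h" if "x \<in> ball 0 \<rho>" for n x h
    proof -
      have "norm (D n x h) = (real n * cmod x ^ (n - 1) * norm (c n)) * norm h"
        by (simp add: D_def norm_scaleC norm_mult norm_power)
      also have "real n * cmod x ^ (n - 1) * norm (c n) \<le> real n * \<rho> ^ (n - 1) * (K * (1 / \<rho>') ^ n)"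
        using that K \<rho>0 by (intro mult_mono power_mono) auto
      also have "\<dots> = B n" by (simp add: B_def)
      finally show ?thesis by (simp add: mult_right_mono)
    qed
    have der: "((\<lambda>z. z ^ n *\<^sub>C c n) has_derivative D n x) (at x)" for n x
      unfolding D_def by (rule has_derivative_power_scaleC)
    have lin: "D n x (a *\<^sub>C h) = a *\<^sub>C D n x h" for n x a h by (simp add: D_def scaleC_complex_def scaleC_scaleC mult_ac)
    have sums: "(\<lambda>n. x ^ n *\<^sub>C c n) sums g x" if "x \<in> ball 0 \<rho>" for x
      using ex that \<rho> by (auto simp: expands_1_def)
    have zin: "z \<in> ball 0 \<rho>" using \<rho> by simp
    have d1: "(g has_derivative (\<lambda>h. \<Sum>n. D n z h)) (at z)"
      by (rule holomorphic_map_series(1)[OF open_ball convex_ball der lin bd sB sums zin])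
    have d2: "summable (\<lambda>n. D n z h)" for h
      by (rule holomorphic_map_series(2)[OF open_ball convex_ball der lin bd sB sums zin])
    have d3: "holomorphic_map (ball 0 \<rho>) g"
      by (rule holomorphic_map_series(3)[OF open_ball convex_ball der lin bd sB sums])
    have Dsum: "(\<Sum>n. D n z h) = h *\<^sub>C (\<Sum>n. D n z 1)" for h
    proof -
      have "D n z h = h *\<^sub>C D n z 1" for n by (simp add: D_def)
      then show ?thesis using bounded_linear.suminf[OF bounded_linear_scaleC d2, of h 1] by simp
    qed
    have cd: "complex_deriv g z = (\<Sum>n. D n z 1)" by (rule complex_deriv_eq[OF d1 Dsum])
    have "(\<lambda>n. D n z 1) sums complex_deriv g z" unfolding cd by (rule summable_sums[OF d2])
    moreover have "D 0 z 1 = 0" by (simp add: D_def)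
    ultimately have "(\<lambda>n. D (Suc n) z 1) sums complex_deriv g z"
      using sums_Suc_iff[of "\<lambda>n. D n z 1" "complex_deriv g z"] by simp
    then have "(\<lambda>n. z ^ n *\<^sub>C (of_nat (Suc n) *\<^sub>C c (Suc n))) sums complex_deriv g z"
      by (simp add: D_def scaleC_scaleC mult.commute)
    moreover have "\<exists>D. (g has_derivative D) (at z) \<and> (\<forall>c h. D (c *\<^sub>C h) = c *\<^sub>C D h)"
      using d3 zin unfolding holomorphic_map_def by blast
    ultimately show ?thesis by blast
  qed
  then show "holomorphic_map (ball 0 r) g" unfolding holomorphic_map_def by blast
  show "expands_1 r (\<lambda>n. of_nat (Suc n) *\<^sub>C c (Suc n)) (complex_deriv g)"
    unfolding expands_1_def using loc by blast
qed

lemma double_sum_iterate: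
  fixes c :: "'e::complex_banach series2"
  assumes "double_sum c x1 x2 s" "\<And>j. ((\<lambda>m. x1 ^ m *\<^sub>C c m j) has_sum d j) UNIV"
  shows "((\<lambda>j. x2 ^ j *\<^sub>C d j) has_sum s) UNIV"
proof -
  have "double_sum (\<lambda>m j. c j m) x2 x1 s" by (rule double_sum_swap[OF assms(1)])
  then have "((\<lambda>(j, m). (x2 ^ j * x1 ^ m) *\<^sub>C c m j) has_sum s) (Sigma UNIV (\<lambda>_. UNIV))"
    by (simp add: double_sum_def)
  moreover have "((\<lambda>m. (\<lambda>(j, m). (x2 ^ j * x1 ^ m) *\<^sub>C c m j) (j, m)) has_sum x2 ^ j *\<^sub>C d j) UNIV" for j
    using has_sum_bounded_linear[OF bounded_linear_scaleC assms(2), of "x2 ^ j" j] by (simp add: scaleC_scaleC)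
  ultimately show ?thesis by (rule has_sum_SigmaD)
qed

lemma double_sum_row_summable:
  fixes c :: "'e::complex_banach series2"
  assumes ex: "expands_2 r c g" and x: "cmod x1 < r"
  shows "(\<lambda>m. x1 ^ m *\<^sub>C c m j) summable_on UNIV"
proof -
  obtain \<rho> where \<rho>: "cmod x1 < \<rho>" "\<rho> < r" using x dense by blast
  then have \<rho>0: "0 < \<rho>" by (meson norm_ge_zero order_le_less_trans)
  have "double_sum c (of_real \<rho>) (of_real \<rho>) (g (of_real \<rho>, of_real \<rho>))"
    using ex \<rho> \<rho>0 by (simp add: expands_2_iff)
  then obtain K where K: "K > 0" "\<And>m j. norm (c m j) \<le> K * (1 / \<rho>) ^ m * (1 / \<rho>) ^ j"
    using double_sum_coeff_bound[OF _ \<rho>0] by blast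
  have le: "norm (x1 ^ m *\<^sub>C c m j) \<le> K * (1 / \<rho>) ^ j * (cmod x1 / \<rho>) ^ m" for m
  proof -
    have "norm (x1 ^ m *\<^sub>C c m j) \<le> cmod x1 ^ m * (K * (1 / \<rho>) ^ m * (1 / \<rho>) ^ j)"
      unfolding norm_scaleC norm_power by (intro mult_left_mono K) auto
    also have "\<dots> = K * (1 / \<rho>) ^ j * (cmod x1 * (1 / \<rho>)) ^ m" by (simp only: power_mult_distrib mult_ac)
    finally show ?thesis by simp
  qed
  have "(\<lambda>m. K * (1 / \<rho>) ^ j * (cmod x1 / \<rho>) ^ m) summable_on UNIV"
    using \<rho> \<rho>0 by (intro summable_on_cmult_right has_sum_imp_summable[OF has_sum_geometric_nat]) auto
  then have "(\<lambda>m. x1 ^ m *\<^sub>C c m j) abs_summable_on UNIV"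
    by (rule summable_on_comparison_test[OF _ le norm_ge_zero])
  then show ?thesis by (rule abs_summable_summable)
qed

lemma expands_2_fix_1:
  fixes c :: "'e::complex_banach series2"
  assumes ex: "expands_2 r c g" and x: "cmod x1 < r"
  shows "expands_1 r (\<lambda>j. infsum (\<lambda>m. x1 ^ m *\<^sub>C c m j) UNIV) (\<lambda>z. g (x1, z))"
  unfolding expands_1_def
proof
  fix z :: complex assume "z \<in> ball 0 r"
  then have "double_sum c x1 z (g (x1, z))" using ex x by (simp add: expands_2_iff)
  then have "((\<lambda>j. z ^ j *\<^sub>C infsum (\<lambda>m. x1 ^ m *\<^sub>C c m j) UNIV) has_sum g (x1, z)) UNIV"
    by (rule double_sum_iterate) (intro has_sum_infsum double_sum_row_summable[OF ex x])
  then show "(\<lambda>m. z ^ m *\<^sub>C infsum (\<lambda>m'. x1 ^ m' *\<^sub>C c m' m) UNIV) sums g (x1, z)" by (rule has_sum_imp_sums)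
qed

lemma expands_2_swap: "expands_2 r c g \<Longrightarrow> expands_2 r (\<lambda>m j. c j m) (\<lambda>(x1, x2). g (x2, x1))"
  by (auto simp: expands_2_iff intro: double_sum_swap)

text \<open>For fixed x1 the series is a power series in x2, whose derivative is known from one
  variable. Unconditional convergence of the differentiated double series needs its own majorant;
  iterated summation then identifies its value with the derivative.\<close>

lemma expands_2_partial_2:
  fixes c :: "'e::complex_banach series2"
  assumes ex: "expands_2 r c g"
  shows "expands_2 r (\<lambda>m j. of_nat (Suc j) *\<^sub>C c m (Suc j)) (partial_2 g)"
  unfolding expands_2_iff
proof (intro allI impI)
  fix x1 x2 :: complex assume x: "cmod x1 < r" "cmod x2 < r"
  let ?c = "\<lambda>m j. of_nat (Suc j) *\<^sub>C c m (Suc j)"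
  define d where "d j = infsum (\<lambda>m. x1 ^ m *\<^sub>C c m j) UNIV" for j
  have "expands_1 r d (\<lambda>z. g (x1, z))" unfolding d_def by (rule expands_2_fix_1[OF ex x(1)])
  from expands_1_deriv(2)[OF this] x(2)
  have 1: "(\<lambda>j. x2 ^ j *\<^sub>C (of_nat (Suc j) *\<^sub>C d (Suc j))) sums partial_2 g (x1, x2)"
    by (simp add: expands_1_def partial_2_def)
  obtain \<rho> where \<rho>: "cmod x1 < \<rho>" "cmod x2 < \<rho>" "\<rho> < r"
    using x dense[of "max (cmod x1) (cmod x2)" r] by auto
  then have \<rho>0: "0 < \<rho>" by (meson norm_ge_zero order_le_less_trans)
  have "double_sum c (of_real \<rho>) (of_real \<rho>) (g (of_real \<rho>, of_real \<rho>))"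
    using ex \<rho> \<rho>0 by (simp add: expands_2_iff)
  then obtain K where K: "K > 0" "\<And>m j. norm (c m j) \<le> K * (1 / \<rho>) ^ m * (1 / \<rho>) ^ j"
    using double_sum_coeff_bound[OF _ \<rho>0] by blast
  have "\<exists>s. double_sum ?c x1 x2 s"
  proof -
    have maj: "(\<lambda>(m, j). K * ((cmod x1 / \<rho>) ^ m * (real (Suc j) * cmod x2 ^ j * (1 / \<rho>) ^ Suc j))) summable_on UNIV"
    proof -
      have "summable (\<lambda>j. real (Suc j) * cmod x2 ^ (Suc j - 1) * (1 / \<rho>) ^ Suc j)"
        using summable_derivative_majorant[of "cmod x2" \<rho>] \<rho> by (subst summable_Suc_iff) auto
      then have "((\<lambda>j. real (Suc j) * cmod x2 ^ j * (1 / \<rho>) ^ Suc j) has_sum (\<Sum>j. real (Suc j) * cmod x2 ^ j * (1 / \<rho>) ^ Suc j)) UNIV"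
        using \<rho>0 by (intro sums_nonneg_imp_has_sum summable_sums) auto
      moreover have "((\<lambda>m. (cmod x1 / \<rho>) ^ m) has_sum 1 / (1 - cmod x1 / \<rho>)) UNIV"
        using \<rho> \<rho>0 by (intro has_sum_geometric_nat) auto
      ultimately have "(\<lambda>(m, j). (cmod x1 / \<rho>) ^ m * (real (Suc j) * cmod x2 ^ j * (1 / \<rho>) ^ Suc j)) summable_on UNIV"
        using \<rho>0 by (intro has_sum_imp_summable[OF product_has_sum]) auto
      then show ?thesis using summable_on_cmult_right[of "\<lambda>(m, j). (cmod x1 / \<rho>) ^ m * (real (Suc j) * cmod x2 ^ j * (1 / \<rho>) ^ Suc j)" UNIV K]
        by (simp add: case_prod_unfold)
    qed
    have le: "norm (case x of (m, j) \<Rightarrow> (x1 ^ m * x2 ^ j) *\<^sub>C ?c m j)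
        \<le> (case x of (m, j) \<Rightarrow> K * ((cmod x1 / \<rho>) ^ m * (real (Suc j) * cmod x2 ^ j * (1 / \<rho>) ^ Suc j)))" for x
    proof -
      obtain m j where x: "x = (m, j)" by (cases x)
      have "norm ((x1 ^ m * x2 ^ j) *\<^sub>C ?c m j) = (cmod x1 ^ m * cmod x2 ^ j * real (Suc j)) * norm (c m (Suc j))"
        by (simp add: norm_scaleC norm_mult norm_power del: of_nat_Suc)
      also have "\<dots> \<le> (cmod x1 ^ m * cmod x2 ^ j * real (Suc j)) * (K * (1 / \<rho>) ^ m * (1 / \<rho>) ^ Suc j)"
        by (intro mult_left_mono K) auto
      also have "\<dots> = K * ((cmod x1 / \<rho>) ^ m * (real (Suc j) * cmod x2 ^ j * (1 / \<rho>) ^ Suc j))"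
        by (simp add: power_divide)
      finally show ?thesis by (simp add: x)
    qed
    have "(\<lambda>x. case x of (m, j) \<Rightarrow> (x1 ^ m * x2 ^ j) *\<^sub>C ?c m j) abs_summable_on UNIV"
      by (rule summable_on_comparison_test[OF maj le norm_ge_zero])
    from abs_summable_summable[OF this] show ?thesis by (auto simp: double_sum_def summable_on_def)
  qed
  then obtain s where s: "double_sum ?c x1 x2 s" by blast
  have "((\<lambda>m. x1 ^ m *\<^sub>C ?c m j) has_sum of_nat (Suc j) *\<^sub>C d (Suc j)) UNIV" for j
  proof -
    have "((\<lambda>m. x1 ^ m *\<^sub>C c m (Suc j)) has_sum d (Suc j)) UNIV"
      unfolding d_def by (intro has_sum_infsum double_sum_row_summable[OF ex x(1)])
    from has_sum_bounded_linear[OF bounded_linear_scaleC this, of "of_nat (Suc j)"]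
    show ?thesis by (simp add: scaleC_scaleC mult.commute)
  qed
  from has_sum_imp_sums[OF double_sum_iterate[OF s this]] 1 have "s = partial_2 g (x1, x2)"
    by (rule sums_unique2)
  with s show "double_sum ?c x1 x2 (partial_2 g (x1, x2))" by simp
qed

lemma expands_2_partial_1:
  fixes c :: "'e::complex_banach series2"
  assumes ex: "expands_2 r c g"
  shows "expands_2 r (\<lambda>m j. of_nat (Suc m) *\<^sub>C c (Suc m) j) (partial_1 g)"
proof -
  have "partial_1 g = (\<lambda>(x1, x2). partial_2 (\<lambda>(x1, x2). g (x2, x1)) (x2, x1))"
    by (auto simp: partial_1_def partial_2_def)
  then show ?thesis using expands_2_swap[OF expands_2_partial_2[OF expands_2_swap[OF ex]]] by simp
qed

lemma expands_2_at_0: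
  assumes "expands_2 r c g" "r > 0"
  shows "g (0, 0) = c 0 0"
proof -
  have 1: "double_sum c 0 0 (g (0, 0))" using assms by (simp add: expands_2_iff)
  have "((\<lambda>(m, j). (0 ^ m * 0 ^ j) *\<^sub>C c m j) has_sum c 0 0) {(0, 0)}"
    by (rule has_sum_finiteI) auto
  moreover have "(case x of (m, j) \<Rightarrow> (0 ^ m * 0 ^ j) *\<^sub>C c m j) = 0" if "x \<noteq> (0, 0)" for x
  proof (cases x)
    case (Pair m j)
    then have "m \<noteq> 0 \<or> j \<noteq> 0" using that by auto
    then have z: "(0::complex) ^ m * 0 ^ j = 0" by auto
    show ?thesis by (simp only: Pair prod.case z scaleC_zero)
  qed
  ultimately have "double_sum c 0 0 (c 0 0)" unfolding double_sum_def
    by (rule has_sum_cong_neutral[THEN iffD1, rotated -1]) simp_all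
  with 1 show ?thesis by (rule double_sum_unique)
qed

lemma fact_ratio_Suc:
  "of_nat (Suc j) * (fact (Suc (j + m)) / fact (Suc j)) = (fact (Suc (j + m)) / fact j :: complex)"
  unfolding fact_Suc[of j] by (simp del: of_nat_Suc fact_Suc)

text \<open>This gives access to the vanishing condition in \<open>space_E\<close>. The induction
  carries the whole array of coefficients, since each derivative shifts it.\<close>

lemma partials_at_0:
  fixes c :: "'e::complex_banach series2"
  assumes ex: "expands_2 r c g" "r > 0"
  shows "(partial_1 ^^ n) ((partial_2 ^^ m) g) (0, 0) = (fact n * fact m) *\<^sub>C c n m"
proof -
  have 2: "\<exists>c'. expands_2 r c' ((partial_2 ^^ m) g) \<and> (\<forall>i j. c' i j = (fact (j + m) / fact j) *\<^sub>C c i (j + m))"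
  proof (induction m)
    case 0
    then show ?case using ex by auto
  next
    case (Suc m)
    then obtain c' where c': "expands_2 r c' ((partial_2 ^^ m) g)" "\<And>i j. c' i j = (fact (j + m) / fact j) *\<^sub>C c i (j + m)" by blast
    have "of_nat (Suc j) *\<^sub>C c' i (Suc j) = (fact (j + Suc m) / fact j) *\<^sub>C c i (j + Suc m)" for i j
      by (simp only: c'(2) scaleC_scaleC add_Suc add_Suc_right fact_ratio_Suc)
    then show ?case using expands_2_partial_2[OF c'(1)] by auto
  qed
  then obtain d where d: "expands_2 r d ((partial_2 ^^ m) g)" "\<And>i j. d i j = (fact (j + m) / fact j) *\<^sub>C c i (j + m)" by blast
  have 1: "\<exists>c'. expands_2 r c' ((partial_1 ^^ n) ((partial_2 ^^ m) g)) \<and> (\<forall>i j. c' i j = (fact (i + n) / fact i) *\<^sub>C d (i + n) j)"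
  proof (induction n)
    case 0
    then show ?case using d by auto
  next
    case (Suc n)
    then obtain c' where c': "expands_2 r c' ((partial_1 ^^ n) ((partial_2 ^^ m) g))" "\<And>i j. c' i j = (fact (i + n) / fact i) *\<^sub>C d (i + n) j" by blast
    have "of_nat (Suc i) *\<^sub>C c' (Suc i) j = (fact (i + Suc n) / fact i) *\<^sub>C d (i + Suc n) j" for i j
      by (simp only: c'(2) scaleC_scaleC add_Suc add_Suc_right fact_ratio_Suc)
    then show ?case using expands_2_partial_1[OF c'(1)] by auto
  qed
  then obtain e where e: "expands_2 r e ((partial_1 ^^ n) ((partial_2 ^^ m) g))" "\<And>i j. e i j = (fact (i + n) / fact i) *\<^sub>C d (i + n) j" by blast
  show ?thesis using expands_2_at_0[OF e(1) ex(2)] by (simp add: e(2) d(2) scaleC_scaleC)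
qed

text \<open>Enumerating the pairs of exponents by \<open>prod_decode\<close> turns the double series
  into an ordinary one, to which \<open>holomorphic_map_series\<close> applies. The coefficient
  bound at radius \<rho>' leaves a summable majorant of the derivatives on the smaller polydisc of
  radius \<rho>.\<close>

lemma expands_2_holomorphic:
  fixes c :: "'e::complex_banach series2"
  assumes ex: "expands_2 r c g"
  shows "holomorphic_map (polydisc r) g"
  unfolding holomorphic_map_def
proof
  fix x assume "x \<in> polydisc r"
  then obtain x1 x2 where xx: "x = (x1, x2)" and x: "cmod x1 < r" "cmod x2 < r" by (auto simp: polydisc_def)
  obtain \<rho> where \<rho>: "cmod x1 < \<rho>" "cmod x2 < \<rho>" "\<rho> < r"
    using x dense[of "max (cmod x1) (cmod x2)" r] by auto
  obtain \<rho>' where \<rho>': "\<rho> < \<rho>'" "\<rho>' < r" using \<rho>(3) dense by blast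
  have \<rho>0: "0 < \<rho>" using \<rho>(1) by (meson norm_ge_zero order_le_less_trans)
  have "double_sum c (of_real \<rho>') (of_real \<rho>') (g (of_real \<rho>', of_real \<rho>'))"
    using ex \<rho>' \<rho>0 by (simp add: expands_2_iff)
  then obtain K where K: "K > 0" "\<And>m j. norm (c m j) \<le> K * (1 / \<rho>') ^ m * (1 / \<rho>') ^ j"
    using double_sum_coeff_bound[of c \<rho>'] \<rho>' \<rho>0 by (metis less_trans)
  define S :: "(complex \<times> complex) set" where "S = ball 0 \<rho> \<times> ball 0 \<rho>"
  have S: "open S" "convex S" by (auto simp: S_def open_Times convex_Times)
  define f where "f = (\<lambda>n (y :: complex \<times> complex). (fst y ^ fst (prod_decode n) * snd y ^ snd (prod_decode n)) *\<^sub>C c (fst (prod_decode n)) (snd (prod_decode n)))"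
  define L where "L = (\<lambda>m j (y :: complex \<times> complex) h. fst h * (of_nat m * fst y ^ (m - 1)) * snd y ^ j + fst y ^ m * (snd h * (of_nat j * snd y ^ (j - 1))))"
  define D where "D = (\<lambda>n y h. L (fst (prod_decode n)) (snd (prod_decode n)) y h *\<^sub>C c (fst (prod_decode n)) (snd (prod_decode n)))"
  define u where "u = (\<lambda>m. real m * \<rho> ^ (m - 1) * (1 / \<rho>') ^ m)"
  define v where "v = (\<lambda>m. (\<rho> / \<rho>') ^ m)"
  define B where "B = (\<lambda>n. K * (u (fst (prod_decode n)) * v (snd (prod_decode n)) + v (fst (prod_decode n)) * u (snd (prod_decode n))))"
  have der: "(f n has_derivative D n y) (at y)" for n y
  proof -
    have p: "((\<lambda>z::complex. z ^ k) has_derivative (\<lambda>h. h * (of_nat k * z ^ (k - 1)))) (at z)" for k z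
      by (rule has_derivative_eq_rhs[OF has_derivative_power[OF has_derivative_ident]]) (simp add: fun_eq_iff mult_ac)
    have p1: "((\<lambda>y::complex \<times> complex. fst y ^ k) has_derivative (\<lambda>h. fst h * (of_nat k * fst y ^ (k - 1)))) (at y)" for k
      by (rule has_derivative_compose[OF has_derivative_fst[OF has_derivative_ident] p])
    have p2: "((\<lambda>y::complex \<times> complex. snd y ^ k) has_derivative (\<lambda>h. snd h * (of_nat k * snd y ^ (k - 1)))) (at y)" for k
      by (rule has_derivative_compose[OF has_derivative_snd[OF has_derivative_ident] p])
    have "((\<lambda>y. fst y ^ m * snd y ^ j) has_derivative L m j y) (at y)" for m j
      by (rule has_derivative_eq_rhs[OF has_derivative_mult[OF p1 p2]]) (simp add: L_def fun_eq_iff)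
    from bounded_linear.has_derivative[OF bounded_linear_scaleC_left this]
    show ?thesis unfolding f_def D_def .
  qed
  have lin: "D n y (a *\<^sub>C h) = a *\<^sub>C D n y h" for n y a h
    by (simp add: D_def L_def scaleC_prod_def scaleC_complex_def scaleC_scaleC algebra_simps)
  have uv: "u m \<ge> 0" "v m \<ge> 0" for m using \<rho>0 \<rho>' by (auto simp: u_def v_def)
  have bd: "norm (D n y h) \<le> B n * norm h" if y: "y \<in> S" for n y h
  proof -
    define m j where "m = fst (prod_decode n)" and "j = snd (prod_decode n)"
    have y': "cmod (fst y) \<le> \<rho>" "cmod (snd y) \<le> \<rho>" using y by (auto simp: S_def)
    have h: "cmod (fst h) \<le> norm h" "cmod (snd h) \<le> norm h" using norm_fst_le[of "fst h" "snd h"] norm_snd_le[of "snd h" "fst h"] by simp_all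
    have "cmod (L m j y h) \<le> cmod (fst h) * (real m * cmod (fst y) ^ (m - 1)) * cmod (snd y) ^ j + cmod (fst y) ^ m * (cmod (snd h) * (real j * cmod (snd y) ^ (j - 1)))"
      unfolding L_def by (rule order_trans[OF norm_triangle_ineq]) (simp add: norm_mult norm_power)
    also have "\<dots> \<le> norm h * (real m * \<rho> ^ (m - 1)) * \<rho> ^ j + \<rho> ^ m * (norm h * (real j * \<rho> ^ (j - 1)))"
      using y' h \<rho>0 by (intro add_mono mult_mono power_mono) auto
    finally have 1: "cmod (L m j y h) \<le> norm h * (real m * \<rho> ^ (m - 1)) * \<rho> ^ j + \<rho> ^ m * (norm h * (real j * \<rho> ^ (j - 1)))" .
    have "norm (D n y h) = cmod (L m j y h) * norm (c m j)" by (simp add: D_def norm_scaleC m_def j_def)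
    also have "\<dots> \<le> (norm h * (real m * \<rho> ^ (m - 1)) * \<rho> ^ j + \<rho> ^ m * (norm h * (real j * \<rho> ^ (j - 1)))) * (K * (1 / \<rho>') ^ m * (1 / \<rho>') ^ j)"
      using K 1 \<rho>0 by (intro mult_mono) auto
    also have "\<dots> = K * (u m * v j + v m * u j) * norm h"
      by (simp add: u_def v_def power_divide algebra_simps)
    finally show ?thesis by (simp add: B_def m_def j_def)
  qed
  have sB: "summable B"
  proof -
    have su: "(u has_sum suminf u) UNIV" using summable_derivative_majorant[of \<rho> \<rho>'] \<rho>0 \<rho>' uv
      by (intro sums_nonneg_imp_has_sum summable_sums) (auto simp: u_def)
    have sv: "(v has_sum 1 / (1 - \<rho> / \<rho>')) UNIV" unfolding v_def using \<rho>0 \<rho>' by (intro has_sum_geometric_nat) auto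
    have "(\<lambda>x. (\<lambda>(m, j). u m * v j) x + (\<lambda>(m, j). v m * u j) x) summable_on UNIV"
      by (intro summable_on_add has_sum_imp_summable[OF product_has_sum[OF su sv]] has_sum_imp_summable[OF product_has_sum[OF sv su]] uv)
    then have "(\<lambda>x. K * ((\<lambda>(m, j). u m * v j) x + (\<lambda>(m, j). v m * u j) x)) summable_on UNIV"
      by (rule summable_on_cmult_right)
    then have "(\<lambda>n. K * ((\<lambda>(m, j). u m * v j) (prod_decode n) + (\<lambda>(m, j). v m * u j) (prod_decode n))) summable_on UNIV"
      by (subst summable_on_reindex_bij_betw[OF bij_prod_decode])
    then have "B summable_on UNIV" by (simp add: B_def case_prod_unfold)
    then show ?thesis by (auto simp: summable_on_def intro: sums_summable has_sum_imp_sums)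
  qed
  have sums: "(\<lambda>n. f n y) sums g y" if "y \<in> S" for y
  proof -
    have "double_sum c (fst y) (snd y) (g (fst y, snd y))" using that ex \<rho> by (auto simp: expands_2_iff S_def)
    then have "((\<lambda>x. (fst y ^ fst x * snd y ^ snd x) *\<^sub>C c (fst x) (snd x)) has_sum g y) UNIV"
      by (simp add: double_sum_alt)
    then have "((\<lambda>n. (fst y ^ fst (prod_decode n) * snd y ^ snd (prod_decode n)) *\<^sub>C c (fst (prod_decode n)) (snd (prod_decode n))) has_sum g y) UNIV"
      by (subst has_sum_reindex_bij_betw[OF bij_prod_decode])
    then show ?thesis unfolding f_def by (rule has_sum_imp_sums)
  qed
  have "holomorphic_map S g"
    by (rule holomorphic_map_series(3)[OF S der lin bd sB sums])
  moreover have "x \<in> S" using \<rho> by (simp add: xx S_def)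
  ultimately show "\<exists>D. (g has_derivative D) (at x) \<and> (\<forall>c h. D (c *\<^sub>C h) = c *\<^sub>C D h)"
    unfolding holomorphic_map_def by blast
qed

section \<open>Gevrey bounds on coefficients\<close>

lemma fact_power_le_fact_mult: "fact N ^ p \<le> (fact (p * N) :: real)"
proof (induction p)
  case (Suc p)
  have "fact N * fact (p * N) dvd (fact (N + p * N) :: nat)" by (rule fact_fact_dvd_fact)
  then have "fact N * fact (p * N) \<le> (fact (N + p * N) :: nat)" by (rule dvd_imp_le) simp
  then have "real (fact N * fact (p * N)) \<le> real (fact (N + p * N))" by (rule of_nat_mono)
  then have 1: "fact N * fact (p * N) \<le> (fact (N + p * N) :: real)" by simp
  have "fact N ^ Suc p \<le> fact N * (fact (p * N) :: real)" using Suc by (simp add: mult_left_mono)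
  then show ?case unfolding mult_Suc using 1 by linarith
qed simp

lemma fact_add_le: "fact (M + p) \<le> 2 ^ (M + p) * (fact M * fact p :: real)"
proof -
  have "real ((M + p) choose M) \<le> real (2 ^ (M + p))" by (rule of_nat_mono[OF binomial_le_pow2])
  moreover have "fact (M + p) = real ((M + p) choose M) * (fact M * fact p)"
    using binomial_fact[of M "M + p", where 'a = real] by (simp add: field_simps)
  ultimately show ?thesis by (simp add: mult_right_mono)
qed

text \<open>Converts a factorial of a monomial index N into one of an exponent M of the first
  variable. The summand p in the condition is the slack for rounding: N may be M/p rounded
  up.\<close>

lemma fact_powr_le_of_mult_le:
  assumes "p > 0" "s \<ge> 0"
  obtains K B where "K \<ge> 1" "B \<ge> 1" "\<And>N M. p * N \<le> M + p \<Longrightarrow> fact N powr s \<le> K * B ^ M * fact M powr (s / real p)"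
proof
  define K where "K = (2 ^ p * fact p :: real)"
  have K1: "1 \<le> K" unfolding K_def using mult_mono[of 1 "2 ^ p :: real" 1 "fact p"] by simp
  show "K powr (s / real p) \<ge> 1" "2 powr (s / real p) \<ge> (1::real)"
    using assms K1 by (auto intro!: ge_one_powr_ge_zero)
  fix N M assume le: "p * N \<le> M + p"
  have "fact N ^ p \<le> (fact (p * N) :: real)" by (rule fact_power_le_fact_mult)
  also have "\<dots> \<le> fact (M + p)" using le by (rule fact_mono)
  also have "\<dots> \<le> K * 2 ^ M * fact M" using fact_add_le[of M p] by (simp add: K_def power_add mult_ac)
  finally have "(fact N ^ p) powr (s / real p) \<le> (K * 2 ^ M * fact M) powr (s / real p)"
    using assms by (intro powr_mono2) auto
  moreover have "(fact N ^ p) powr (s / real p) = fact N powr s"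
    using assms by (simp add: powr_powr flip: powr_realpow)
  moreover have "(K * 2 ^ M * fact M) powr (s / real p) = K powr (s / real p) * (2 powr (s / real p)) ^ M * fact M powr (s / real p)"
    using K1 by (simp add: powr_mult powr_powr mult.commute flip: powr_realpow)
  ultimately show "fact N powr s \<le> K powr (s / real p) * (2 powr (s / real p)) ^ M * fact M powr (s / real p)" by simp
qed

text \<open>The opposite conversion: (p n)^(p n) is the p-th power of p^n n^n, so up to geometric
  factors the factorial of p n is the p-th power of that of n. Having N + 1 in place of N leaves
  room for incomplete blocks.\<close>

lemma fact_mult_powr_le:
  assumes "p > 0" "s \<ge> 0"
  obtains K B where "K \<ge> 1" "B \<ge> 1" "\<And>N. fact (p * (N + 1)) powr (s / real p) \<le> K * B ^ N * fact N powr s"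
proof
  define c where "c = real p * exp 1"
  have c: "c \<ge> 1"
    unfolding c_def using assms one_le_exp_iff[of "1::real"] mult_mono[of 1 "real p" 1 "exp 1"] by simp
  show "c powr s \<ge> 1" "(2 * c) powr s \<ge> 1" using assms c by (auto intro!: ge_one_powr_ge_zero)
  fix N :: nat
  have N1: "real (N + 1) > 0" by simp
  have "fact (p * (N + 1)) \<le> real (p * (N + 1)) ^ (p * (N + 1))" by (rule fact_le_power_self)
  also have "\<dots> = (real p ^ (N + 1) * real (N + 1) ^ (N + 1)) ^ p"
  proof -
    have "real (p * (N + 1)) ^ (p * (N + 1)) = ((real p * real (N + 1)) ^ (N + 1)) ^ p"
      by (simp only: of_nat_mult power_mult[symmetric] mult.commute[of p "N + 1"] mult.commute[of "real (N + 1)"])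
    then show ?thesis by (simp only: power_mult_distrib)
  qed
  also have "\<dots> \<le> (real p ^ (N + 1) * (exp (real (N + 1)) * fact (N + 1))) ^ p"
    by (intro power_mono mult_left_mono power_self_le_exp_fact) auto
  also have "real p ^ (N + 1) * (exp (real (N + 1)) * fact (N + 1)) = c ^ (N + 1) * fact (N + 1)"
    by (simp add: c_def power_mult_distrib exp_add distrib_right flip: exp_of_nat_mult)
  also have "(c ^ (N + 1) * fact (N + 1)) ^ p \<le> (c ^ (N + 1) * (2 ^ N * fact N)) ^ p"
  proof (intro power_mono mult_left_mono)
    have "real (N + 1) \<le> 2 ^ N" using less_exp[of N] by (metis Suc_eq_plus1 Suc_leI of_nat_mono of_nat_numeral of_nat_power)
    then show "fact (N + 1) \<le> 2 ^ N * (fact N :: real)" by (simp add: mult_right_mono)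
  qed (use c in auto)
  finally have "fact (p * (N + 1)) powr (s / real p) \<le> ((c ^ (N + 1) * (2 ^ N * fact N)) ^ p) powr (s / real p)"
    using assms by (intro powr_mono2) auto
  also have "\<dots> = (c ^ (N + 1) * (2 ^ N * fact N)) powr s"
    using assms c by (simp add: powr_powr flip: powr_realpow)
  also have "\<dots> = (c * (2 * c) ^ N * fact N) powr s" by (simp add: power_mult_distrib mult_ac)
  also have "\<dots> = c powr s * ((2 * c) powr s) ^ N * fact N powr s"
    using c by (simp add: powr_mult powr_powr mult.commute flip: powr_realpow)
  finally show "fact (p * (N + 1)) powr (s / real p) \<le> c powr s * ((2 * c) powr s) ^ N * fact N powr s" .
qed

text \<open>Only the first index carries a factorial; growth in the second index is imposed on the
  transposed array. Results are then proved for the first variable and transferred by swapping. The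
  exponent 0 describes convergence.\<close>

definition gevrey_coeffs :: "real \<Rightarrow> 'e::complex_banach series2 \<Rightarrow> bool" where
  "gevrey_coeffs \<sigma> a \<longleftrightarrow> (\<exists>C>0. \<exists>A>0. \<forall>n m. norm (a n m) \<le> C * A ^ (n + m) * fact n powr \<sigma>)"

lemma gevrey_coeffsI:
  assumes "C > 0" "A > 0" "\<And>n m. norm (a n m) \<le> C * A ^ (n + m) * fact n powr \<sigma>"
  shows "gevrey_coeffs \<sigma> a"
  using assms unfolding gevrey_coeffs_def by blast

lemma gevrey_coeffsE:
  assumes "gevrey_coeffs \<sigma> a" "gevrey_coeffs \<tau> (\<lambda>n m. b m n)"
  obtains C A where "C \<ge> 1" "A \<ge> 1" "\<And>n m. norm (a n m) \<le> C * A ^ n * A ^ m * fact n powr \<sigma>"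
    "\<And>n m. norm (b n m) \<le> C * A ^ n * A ^ m * fact m powr \<tau>"
proof -
  obtain C A where 1: "C > 0" "A > 0" "\<And>n m. norm (a n m) \<le> C * A ^ (n + m) * fact n powr \<sigma>"
    using assms(1) unfolding gevrey_coeffs_def by blast
  obtain C' A' where 2: "C' > 0" "A' > 0" "\<And>n m. norm (b m n) \<le> C' * A' ^ (n + m) * fact n powr \<tau>"
    using assms(2) unfolding gevrey_coeffs_def by blast
  define C'' where "C'' = max 1 (max C C')"
  define A'' where "A'' = max 1 (max A A')"
  have m: "1 \<le> C''" "C \<le> C''" "C' \<le> C''" "1 \<le> A''" "A \<le> A''" "A' \<le> A''" by (auto simp: C''_def A''_def)
  show thesis
  proof
    show "norm (a n m) \<le> C'' * A'' ^ n * A'' ^ m * fact n powr \<sigma>" for n m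
    proof -
      have "C * A ^ (n + m) * fact n powr \<sigma> \<le> C'' * A'' ^ (n + m) * fact n powr \<sigma>"
        using m 1 by (intro mult_mono power_mono) auto
      then have "norm (a n m) \<le> C'' * A'' ^ (n + m) * fact n powr \<sigma>" using 1(3)[of n m] by linarith
      then show ?thesis by (simp add: power_add mult_ac)
    qed
    show "norm (b n m) \<le> C'' * A'' ^ n * A'' ^ m * fact m powr \<tau>" for n m
    proof -
      have "C' * A' ^ (m + n) * fact m powr \<tau> \<le> C'' * A'' ^ (m + n) * fact m powr \<tau>"
        using m 2 by (intro mult_mono power_mono) auto
      then have "norm (b n m) \<le> C'' * A'' ^ (m + n) * fact m powr \<tau>" using 2(3)[where n = m and m = n] by linarith
      then show ?thesis by (simp add: power_add mult_ac)
    qed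
  qed (use m in auto)
qed

lemma gevrey_coeffs_mono:
  assumes "gevrey_coeffs \<sigma> a" "\<sigma> \<le> \<tau>"
  shows "gevrey_coeffs \<tau> a"
proof -
  obtain C A where 1: "C > 0" "A > 0" "\<And>n m. norm (a n m) \<le> C * A ^ (n + m) * fact n powr \<sigma>"
    using assms(1) unfolding gevrey_coeffs_def by blast
  have "norm (a n m) \<le> C * A ^ (n + m) * fact n powr \<tau>" for n m
  proof -
    have "C * A ^ (n + m) * fact n powr \<sigma> \<le> C * A ^ (n + m) * fact n powr \<tau>"
      using 1 assms(2) by (intro mult_left_mono powr_mono) auto
    then show ?thesis using 1(3)[of n m] by linarith
  qed
  then show ?thesis unfolding gevrey_coeffs_def using 1 by blast
qed

lemma gevrey_coeffs_0_swap: "gevrey_coeffs 0 (\<lambda>n m. a m n) \<longleftrightarrow> gevrey_coeffs 0 a"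
  unfolding gevrey_coeffs_def by (metis (no_types, opaque_lifting) add.commute powr_zero_eq_one fact_nonzero)

lemma convergent_series2_iff: "a \<in> convergent_series2 \<longleftrightarrow> gevrey_coeffs 0 a"
proof
  assume "a \<in> convergent_series2"
  then obtain r where r: "r > 0" "\<And>x1 x2. (x1, x2) \<in> polydisc r \<Longrightarrow> (\<lambda>(n, m). (x1 ^ n * x2 ^ m) *\<^sub>C a n m) summable_on UNIV"
    unfolding convergent_series2_def by blast
  have "(of_real (r / 2), of_real (r / 2)) \<in> polydisc r" using r(1) by (simp add: polydisc_def)
  from r(2)[OF this] obtain s where "double_sum a (of_real (r / 2)) (of_real (r / 2)) s"
    by (auto simp: double_sum_def summable_on_def)
  then obtain K where K: "K > 0" "\<And>m j. norm (a m j) \<le> K * (1 / (r / 2)) ^ m * (1 / (r / 2)) ^ j"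
    using double_sum_coeff_bound[of a "r / 2"] r(1) by (metis half_gt_zero)
  have "norm (a n m) \<le> K * (1 / (r / 2)) ^ (n + m) * fact n powr 0" for n m
    using K(2)[of n m] by (simp add: power_add)
  then show "gevrey_coeffs 0 a" by (rule gevrey_coeffsI[rotated 2]) (use K(1) r(1) in auto)
next
  assume "gevrey_coeffs 0 a"
  then obtain C A where 1: "C > 0" "A > 0" "\<And>n m. norm (a n m) \<le> C * A ^ (n + m) * fact n powr 0"
    unfolding gevrey_coeffs_def by blast
  have "\<exists>s. double_sum a x1 x2 s" if "(x1, x2) \<in> polydisc (1 / (2 * A))" for x1 x2
  proof -
    have "norm (a n m) \<le> C * A ^ n * A ^ m" for n m using 1(3)[of n m] by (simp add: power_add)
    moreover have "A * cmod x1 \<le> 1 / 2" "A * cmod x2 \<le> 1 / 2" using that 1(2) by (auto simp: polydisc_def field_simps)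
    ultimately obtain s where "double_sum a x1 x2 s"
      using 1(2) by (elim double_sum_bounded[of a C A x1 "1 / 2" x2]) auto
    then show ?thesis by blast
  qed
  then show "a \<in> convergent_series2" unfolding convergent_series2_def
    using 1(2) by (intro CollectI exI[of _ "1 / (2 * A)"]) (auto simp: double_sum_def summable_on_def)
qed

text \<open>A functional of norm at most one makes the coefficients scalar, and Cauchy's estimate is
  applied once in each variable, first in x2 with x1 fixed on its circle.\<close>

lemma expands_2_coeff_bound:
  fixes c :: "'e::complex_banach series2"
  assumes ex: "expands_2 r c g" and \<rho>: "0 < \<rho>" "\<rho> < r"
    and bd: "\<And>x1 x2. cmod x1 = \<rho> \<Longrightarrow> cmod x2 = \<rho> \<Longrightarrow> norm (g (x1, x2)) \<le> M"
  shows "norm (c m j) \<le> M / (\<rho> ^ m * \<rho> ^ j)"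
proof (rule norm_le_by_dual)
  fix \<phi> :: "'e \<Rightarrow> complex" assume \<phi>: "dual_unit \<phi>"
  have ex': "expands_2 r (\<lambda>m j. \<phi> (c m j)) (\<lambda>x. \<phi> (g x))"
    using ex \<phi> by (auto simp: expands_2_iff intro: double_sum_dual)
  have row: "cmod (infsum (\<lambda>m. x1 ^ m *\<^sub>C \<phi> (c m j)) UNIV) \<le> M / \<rho> ^ j" if x1: "cmod x1 = \<rho>" for x1
  proof (rule power_series_coeff_bound[where R' = r and f = "\<lambda>z. \<phi> (g (x1, z))", OF _ \<rho>])
    have "cmod x1 < r" using x1 \<rho> by simp
    from expands_2_fix_1[OF ex' this]
    show "(\<lambda>j. infsum (\<lambda>m. x1 ^ m *\<^sub>C \<phi> (c m j)) UNIV * z ^ j) sums \<phi> (g (x1, z))" if "z \<in> ball 0 r" for z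
      using that by (simp add: expands_1_def scaleC_complex_def mult.commute)
    show "cmod (\<phi> (g (x1, z))) \<le> M" if "cmod z = \<rho>" for z
      using bd[OF x1 that] \<phi> by (meson dual_unit_def order_trans)
  qed
  have "cmod (\<phi> (c m j)) \<le> M / \<rho> ^ j / \<rho> ^ m"
  proof (rule power_series_coeff_bound[where R' = r and f = "\<lambda>z. infsum (\<lambda>m. z ^ m *\<^sub>C \<phi> (c m j)) UNIV", OF _ \<rho> row])
    show "(\<lambda>m. \<phi> (c m j) * z ^ m) sums infsum (\<lambda>m. z ^ m *\<^sub>C \<phi> (c m j)) UNIV" if "z \<in> ball 0 r" for z
    proof -
      have "((\<lambda>m. z ^ m *\<^sub>C \<phi> (c m j)) has_sum infsum (\<lambda>m. z ^ m *\<^sub>C \<phi> (c m j)) UNIV) UNIV"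
        using that by (intro has_sum_infsum double_sum_row_summable[OF ex']) simp
      from has_sum_imp_sums[OF this] show ?thesis by (simp add: scaleC_complex_def mult.commute)
    qed
  qed
  then show "cmod (\<phi> (c m j)) \<le> M / (\<rho> ^ m * \<rho> ^ j)" by (simp add: mult.commute)
qed

lemma monomial_part_swap: "monomial_part q p (\<lambda>n m. a m n) N = (\<lambda>m j. monomial_part p q a N j m)"
  by (auto simp: monomial_part_def fun_eq_iff)

text \<open>Every coefficient of \<open>a\<close> occurs in exactly one f_N, namely for N = min (n1
  div p) (n2 div q), and Cauchy's estimate bounds it there. From p N \<le> n1 follows (N!)^s \<le>
  (n1!)^(s/p).\<close>

lemma gevrey_coeffs_of_expansion:
  fixes a :: "'e::complex_banach series2"
  assumes p: "p > 0" "q > 0" and s: "s \<ge> 0"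
    and ex: "\<And>N. expands_2 r (monomial_part p q a N) (F N)" and \<rho>: "0 < \<rho>" "\<rho> < r"
    and CA: "C > 0" "A > 0"
    and bd: "\<And>N x1 x2. cmod x1 = \<rho> \<Longrightarrow> cmod x2 = \<rho> \<Longrightarrow> norm (F N (x1, x2)) \<le> C * A ^ N * fact N powr s"
  shows "gevrey_coeffs (s / real p) a"
proof -
  define B where "B = max 1 A * max 1 (1 / \<rho>)"
  have B: "B \<ge> 1" "1 / \<rho> \<le> B" "A \<le> B" "0 < B"
  proof -
    show "B \<ge> 1" unfolding B_def using mult_mono[of 1 "max 1 A" 1 "max 1 (1 / \<rho>)"] by simp
    show "1 / \<rho> \<le> B" unfolding B_def using mult_mono[of 1 "max 1 A" "1 / \<rho>" "max 1 (1 / \<rho>)"] \<rho> by simp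
    show "A \<le> B" unfolding B_def using mult_mono[of A "max 1 A" 1 "max 1 (1 / \<rho>)"] CA by simp
    then show "0 < B" using CA by simp
  qed
  have "norm (a n1 n2) \<le> C * (B * B) ^ (n1 + n2) * fact n1 powr (s / real p)" for n1 n2
  proof -
    define N where "N = min (n1 div p) (n2 div q)"
    have Np: "N * p \<le> n1" "N * q \<le> n2" by (auto simp: N_def min_def div_times_less_eq_dividend le_trans[OF mult_le_mono1 div_times_less_eq_dividend])
    have "n1 - N * p < p \<or> n2 - N * q < q"
    proof (cases "n1 div p \<le> n2 div q")
      case True
      then have "n1 - N * p = n1 mod p" by (simp add: N_def minus_div_mult_eq_mod)
      then show ?thesis using p by simp
    next
      case False
      then have "n2 - N * q = n2 mod q" by (simp add: N_def minus_div_mult_eq_mod)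
      then show ?thesis using p by simp
    qed
    then have eq: "a n1 n2 = monomial_part p q a N (n1 - N * p) (n2 - N * q)"
      using Np by (simp add: monomial_part_def)
    have "norm (a n1 n2) \<le> (C * A ^ N * fact N powr s) / (\<rho> ^ (n1 - N * p) * \<rho> ^ (n2 - N * q))"
      unfolding eq by (rule expands_2_coeff_bound[OF ex \<rho> bd])
    also have "\<dots> = C * A ^ N * fact N powr s * ((1 / \<rho>) ^ (n1 - N * p + (n2 - N * q)))"
      by (simp add: power_add power_divide)
    also have "\<dots> \<le> C * B ^ (n1 + n2) * fact n1 powr (s / real p) * B ^ (n1 + n2)"
    proof (intro mult_mono)
      have "A ^ N \<le> B ^ N" using B CA by (intro power_mono) auto
      also have "N \<le> n1 + n2" using Np p by (metis div_le_dividend le_add1 le_trans min.cobounded1 N_def)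
      then have "B ^ N \<le> B ^ (n1 + n2)" using B by (intro power_increasing) auto
      finally show "A ^ N \<le> B ^ (n1 + n2)" .
      have "(1 / \<rho>) ^ (n1 - N * p + (n2 - N * q)) \<le> B ^ (n1 - N * p + (n2 - N * q))"
        using B \<rho> by (intro power_mono) auto
      also have "\<dots> \<le> B ^ (n1 + n2)" using B by (intro power_increasing) auto
      finally show "(1 / \<rho>) ^ (n1 - N * p + (n2 - N * q)) \<le> B ^ (n1 + n2)" .
      have "fact N ^ p \<le> (fact (p * N) :: real)" by (rule fact_power_le_fact_mult)
      also have "\<dots> \<le> fact n1" using Np by (intro fact_mono) (simp add: mult.commute)
      finally have "(fact N ^ p) powr (s / real p) \<le> fact n1 powr (s / real p)"
        using s by (intro powr_mono2) auto
      then show "fact N powr s \<le> fact n1 powr (s / real p)"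
        using p by (simp add: powr_powr flip: powr_realpow)
    qed (use CA B \<rho> in auto)
    finally show ?thesis by (simp add: power_mult_distrib mult_ac)
  qed
  then show ?thesis by (rule gevrey_coeffsI[rotated 2]) (use CA B in auto)
qed

section \<open>Sums in a direction\<close>

lemma holomorphic_map_subset: "holomorphic_map U f \<Longrightarrow> V \<subseteq> U \<Longrightarrow> holomorphic_map V f"
  unfolding holomorphic_map_def by blast

text \<open>Since r1 \<le> 1, the single radius r1^(p+q) for the powers |x1|^p and |x2|^q places
  both variables in the disc of radius r1.\<close>

lemma exp_small_in_polydisc:
  assumes "0 < r1" "r1 \<le> 1" "p > 0" "cmod (exp w) ^ p < r1 ^ (p + q)"
  shows "cmod (exp w) < r1"
proof (rule ccontr)
  assume "\<not> cmod (exp w) < r1"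
  then have "r1 ^ p \<le> cmod (exp w) ^ p" using assms by (intro power_mono) auto
  moreover have "r1 ^ (p + q) \<le> r1 ^ p" using assms by (intro power_decreasing) auto
  ultimately show False using assms by linarith
qed

text \<open>The estimates defining a sum in direction \<open>d\<close>, with the constants made explicit and with the
  radius bounding the logarithms instead of powers of the moduli.\<close>

definition direction_data ::
    "nat \<Rightarrow> nat \<Rightarrow> real \<Rightarrow> real \<Rightarrow> real \<Rightarrow> real \<Rightarrow> real \<Rightarrow> real \<Rightarrow> (complex \<times> complex \<Rightarrow> 'e::complex_banach)
      \<Rightarrow> (nat \<Rightarrow> complex \<times> complex \<Rightarrow> 'e) \<Rightarrow> 'e series2 \<Rightarrow> bool" where
  "direction_data p q s d \<eta> \<rho> C A f F a \<longleftrightarrow>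
     holomorphic_map {(w1, w2). Re w1 < ln \<rho> \<and> Re w2 < ln \<rho> \<and> \<bar>real p * Im w1 + real q * Im w2 - d\<bar> < \<eta>} f \<and>
     (\<forall>N. expands_2 \<rho> (monomial_part p q a N) (F N)) \<and>
     (\<forall>N w1 w2. Re w1 < ln \<rho> \<longrightarrow> Re w2 < ln \<rho> \<longrightarrow> \<bar>real p * Im w1 + real q * Im w2 - d\<bar> < \<eta> \<longrightarrow>
        norm (f (w1, w2) - (\<Sum>n<N. (exp w1 ^ p * exp w2 ^ q) ^ n *\<^sub>C F n (exp w1, exp w2)))
          \<le> C * A ^ N * fact N powr s * cmod (exp w1 ^ p * exp w2 ^ q) ^ N)"

lemma direction_data_mono:
  assumes D: "direction_data p q s d \<eta> \<rho> C A f F a"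
    and le: "\<eta>' \<le> \<eta>" "0 < \<rho>'" "\<rho>' \<le> \<rho>" "C \<le> C'" "0 \<le> C" "0 \<le> A" "A \<le> A'"
  shows "direction_data p q s d \<eta>' \<rho>' C' A' f F a"
proof -
  have ln: "ln \<rho>' \<le> ln \<rho>" using le by simp
  have "holomorphic_map {(w1, w2). Re w1 < ln \<rho>' \<and> Re w2 < ln \<rho>' \<and> \<bar>real p * Im w1 + real q * Im w2 - d\<bar> < \<eta>'} f"
  proof (rule holomorphic_map_subset)
    show "holomorphic_map {(w1, w2). Re w1 < ln \<rho> \<and> Re w2 < ln \<rho> \<and> \<bar>real p * Im w1 + real q * Im w2 - d\<bar> < \<eta>} f"
      using D unfolding direction_data_def by (elim conjE)
  qed (use le in \<open>auto intro: less_le_trans[OF _ ln]\<close>)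
  moreover have "expands_2 \<rho>' (monomial_part p q a N) (F N)" for N
    using D le unfolding direction_data_def expands_2_iff by auto
  moreover have "norm (f (w1, w2) - (\<Sum>n<N. (exp w1 ^ p * exp w2 ^ q) ^ n *\<^sub>C F n (exp w1, exp w2)))
          \<le> C' * A' ^ N * fact N powr s * cmod (exp w1 ^ p * exp w2 ^ q) ^ N"
    if "Re w1 < ln \<rho>'" "Re w2 < ln \<rho>'" "\<bar>real p * Im w1 + real q * Im w2 - d\<bar> < \<eta>'" for N w1 w2
  proof -
    have "norm (f (w1, w2) - (\<Sum>n<N. (exp w1 ^ p * exp w2 ^ q) ^ n *\<^sub>C F n (exp w1, exp w2)))
          \<le> C * A ^ N * fact N powr s * cmod (exp w1 ^ p * exp w2 ^ q) ^ N"
    proof -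
      have "Re w1 < ln \<rho>" "Re w2 < ln \<rho>" "\<bar>real p * Im w1 + real q * Im w2 - d\<bar> < \<eta>" using that le ln by linarith+
      then show ?thesis using D unfolding direction_data_def by blast
    qed
    also have "\<dots> \<le> C' * A' ^ N * fact N powr s * cmod (exp w1 ^ p * exp w2 ^ q) ^ N"
      using le by (intro mult_right_mono mult_mono power_mono) auto
    finally show ?thesis .
  qed
  ultimately show ?thesis unfolding direction_data_def by blast
qed

lemma direction_data_swap:
  assumes "direction_data p q s d \<eta> \<rho> C A f F a"
  shows "direction_data q p s d \<eta> \<rho> C A (\<lambda>(w1, w2). f (w2, w1)) (\<lambda>n (x1, x2). F n (x2, x1)) (\<lambda>n m. a m n)"
  unfolding direction_data_def
proof (intro conjI allI impI)
  let ?S = "{(w1, w2). Re w1 < ln \<rho> \<and> Re w2 < ln \<rho> \<and> \<bar>real p * Im w1 + real q * Im w2 - d\<bar> < \<eta>}"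
  have hol: "holomorphic_map ?S f" using assms unfolding direction_data_def by blast
  show "holomorphic_map {(w1, w2). Re w1 < ln \<rho> \<and> Re w2 < ln \<rho> \<and> \<bar>real q * Im w1 + real p * Im w2 - d\<bar> < \<eta>} (\<lambda>(w1, w2). f (w2, w1))"
    unfolding holomorphic_map_def
  proof
    fix x assume "x \<in> {(w1, w2). Re w1 < ln \<rho> \<and> Re w2 < ln \<rho> \<and> \<bar>real q * Im w1 + real p * Im w2 - d\<bar> < \<eta>}"
    then have "(snd x, fst x) \<in> ?S" by (auto simp: add.commute)
    then obtain D where D: "(f has_derivative D) (at (snd x, fst x))" "\<And>c h. D (c *\<^sub>C h) = c *\<^sub>C D h"
      using hol unfolding holomorphic_map_def by blast
    have "((\<lambda>x::complex \<times> complex. (snd x, fst x)) has_derivative (\<lambda>h. (snd h, fst h))) (at x)"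
      by (intro derivative_intros)
    then have "((\<lambda>x. f (snd x, fst x)) has_derivative (\<lambda>h. D (snd h, fst h))) (at x)"
      by (rule has_derivative_compose[of "\<lambda>x. (snd x, fst x)" "\<lambda>h. (snd h, fst h)" x UNIV f D, OF _ D(1)])
    moreover have "D (snd (c *\<^sub>C h), fst (c *\<^sub>C h)) = c *\<^sub>C D (snd h, fst h)" for c h
      using D(2)[of c "(snd h, fst h)"] by (simp add: scaleC_prod_def)
    ultimately show "\<exists>D. ((\<lambda>(w1, w2). f (w2, w1)) has_derivative D) (at x) \<and> (\<forall>c h. D (c *\<^sub>C h) = c *\<^sub>C D h)"
      unfolding case_prod_unfold by blast
  qed
  show "expands_2 \<rho> (monomial_part q p (\<lambda>n m. a m n) N) (\<lambda>(x1, x2). F N (x2, x1))" for N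
  proof -
    have "expands_2 \<rho> (monomial_part p q a N) (F N)" using assms unfolding direction_data_def by blast
    from expands_2_swap[OF this] show ?thesis by (subst monomial_part_swap)
  qed
  fix N w1 w2 assume "Re w1 < ln \<rho>" "Re w2 < ln \<rho>" "\<bar>real q * Im w1 + real p * Im w2 - d\<bar> < \<eta>"
  then have "norm (f (w2, w1) - (\<Sum>n<N. (exp w2 ^ p * exp w1 ^ q) ^ n *\<^sub>C F n (exp w2, exp w1)))
          \<le> C * A ^ N * fact N powr s * cmod (exp w2 ^ p * exp w1 ^ q) ^ N"
    using assms unfolding direction_data_def by (auto simp: add.commute)
  then show "norm ((case (w1, w2) of (w1, w2) \<Rightarrow> f (w2, w1)) - (\<Sum>n<N. (exp w1 ^ q * exp w2 ^ p) ^ n *\<^sub>C (case (exp w1, exp w2) of (x1, x2) \<Rightarrow> F n (x2, x1))))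
          \<le> C * A ^ N * fact N powr s * cmod (exp w1 ^ q * exp w2 ^ p) ^ N"
    by (simp add: mult.commute)
qed

text \<open>The inner condition of \<open>gevrey_asymptotic\<close>, separated so that it can be
  instantiated and established apart from the choice of the radius and of \<open>F\<close>.\<close>

definition sector_estimates ::
    "nat \<Rightarrow> nat \<Rightarrow> real \<Rightarrow> real \<Rightarrow> real \<Rightarrow> real \<Rightarrow> (complex \<times> complex \<Rightarrow> 'e::complex_banach)
      \<Rightarrow> (nat \<Rightarrow> complex \<times> complex \<Rightarrow> 'e) \<Rightarrow> bool" where
  "sector_estimates p q s \<alpha> \<beta> r' f F \<longleftrightarrow>
     (\<forall>\<alpha>' \<beta>' \<rho>. \<alpha> < \<alpha>' \<and> \<alpha>' < \<beta>' \<and> \<beta>' < \<beta> \<and> 0 < \<rho> \<and> \<rho> < r' \<and>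
        (\<forall>(w1, w2)\<in>monomial_sector p q \<alpha>' \<beta>' \<rho>. (exp w1, exp w2) \<in> polydisc r') \<longrightarrow>
        (\<exists>C>0. \<exists>A>0. \<forall>N. \<forall>(w1, w2)\<in>monomial_sector p q \<alpha>' \<beta>' \<rho>.
           norm (f (w1, w2) - (\<Sum>n<N. (exp w1 ^ p * exp w2 ^ q) ^ n *\<^sub>C F n (exp w1, exp w2)))
             \<le> C * A ^ N * fact N powr s * cmod (exp w1 ^ p * exp w2 ^ q) ^ N))"

lemma gevrey_asymptotic_iff:
  "gevrey_asymptotic p q s \<alpha> \<beta> r f a \<longleftrightarrow>
     (\<exists>r'. 0 < r' \<and> r' \<le> r \<and> (\<exists>F. monomial_expansion p q r' a F \<and> sector_estimates p q s \<alpha> \<beta> r' f F))"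
  unfolding gevrey_asymptotic_def sector_estimates_def by (rule refl)

lemma sector_estimatesD:
  assumes "sector_estimates p q s \<alpha> \<beta> r' f F" "\<alpha> < \<alpha>'" "\<alpha>' < \<beta>'" "\<beta>' < \<beta>" "0 < \<rho>" "\<rho> < r'"
    "\<And>w1 w2. (w1, w2) \<in> monomial_sector p q \<alpha>' \<beta>' \<rho> \<Longrightarrow> (exp w1, exp w2) \<in> polydisc r'"
  obtains C A where "C > 0" "A > 0" "\<And>N w1 w2. (w1, w2) \<in> monomial_sector p q \<alpha>' \<beta>' \<rho> \<Longrightarrow>
      norm (f (w1, w2) - (\<Sum>n<N. (exp w1 ^ p * exp w2 ^ q) ^ n *\<^sub>C F n (exp w1, exp w2)))
        \<le> C * A ^ N * fact N powr s * cmod (exp w1 ^ p * exp w2 ^ q) ^ N"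
proof -
  have "\<forall>(w1, w2)\<in>monomial_sector p q \<alpha>' \<beta>' \<rho>. (exp w1, exp w2) \<in> polydisc r'"
    using assms(7) by auto
  with assms(2-6) have "\<exists>C>0. \<exists>A>0. \<forall>N. \<forall>(w1, w2)\<in>monomial_sector p q \<alpha>' \<beta>' \<rho>.
           norm (f (w1, w2) - (\<Sum>n<N. (exp w1 ^ p * exp w2 ^ q) ^ n *\<^sub>C F n (exp w1, exp w2)))
             \<le> C * A ^ N * fact N powr s * cmod (exp w1 ^ p * exp w2 ^ q) ^ N"
    by (intro mp[OF spec[OF spec[OF spec[OF assms(1)[unfolded sector_estimates_def]]]]] conjI)
  then obtain C A where CA: "C > 0" "A > 0" "\<forall>N. \<forall>(w1, w2)\<in>monomial_sector p q \<alpha>' \<beta>' \<rho>.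
           norm (f (w1, w2) - (\<Sum>n<N. (exp w1 ^ p * exp w2 ^ q) ^ n *\<^sub>C F n (exp w1, exp w2)))
             \<le> C * A ^ N * fact N powr s * cmod (exp w1 ^ p * exp w2 ^ q) ^ N"
    by blast
  show thesis by (rule that[OF CA(1,2)]) (use CA(3) in fastforce)
qed

lemma direction_data_of_summable:
  assumes S: "summable_in_direction p q k d a" and p: "p > 0" "q > 0" and k: "k > 0"
  obtains \<eta> \<rho> C A f F where "\<eta> > pi / (2 * k)" "0 < \<rho>" "C > 0" "A > 0"
    "direction_data p q (1 / k) d \<eta> \<rho> C A f F a"
proof -
  obtain \<alpha> \<beta> r f where 1: "\<alpha> < \<beta>" "0 < r" "(\<alpha> + \<beta>) / 2 = d" "\<beta> - \<alpha> > pi / k"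
     "holomorphic_map (monomial_sector p q \<alpha> \<beta> r) f" "gevrey_asymptotic p q (1 / k) \<alpha> \<beta> r f a"
    using S unfolding summable_in_direction_def by blast
  obtain r' F where 2: "0 < r'" "r' \<le> r" "monomial_expansion p q r' a F"
    and est: "sector_estimates p q (1 / k) \<alpha> \<beta> r' f F"
    using 1(6) unfolding gevrey_asymptotic_iff by blast
  define H where "H = (\<beta> - \<alpha>) / 2"
  have H: "\<alpha> = d - H" "\<beta> = d + H" "pi / (2 * k) < H" using 1 by (auto simp: H_def field_simps)
  \<comment> \<open>The midpoint makes the subsector proper while its opening still exceeds
    pi/k.\<close>
  define \<eta> where "\<eta> = (H + pi / (2 * k)) / 2"
  have \<eta>: "pi / (2 * k) < \<eta>" "\<eta> < H" "0 < pi / (2 * k)" using H k by (auto simp: \<eta>_def)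
  define r1 where "r1 = min r' 1 / 2"
  define \<rho> where "\<rho> = r1 ^ (p + q)"
  have r1: "0 < r1" "r1 \<le> 1" "r1 < r'" using 2 by (auto simp: r1_def)
  have "r1 ^ (p + q) \<le> r1 ^ 1" using r1 p by (intro power_decreasing) auto
  then have \<rho>: "0 < \<rho>" "\<rho> < r'" "\<rho> \<le> 1" using r1 by (auto simp: \<rho>_def)
  have small: "cmod (exp w) < r1" if "cmod (exp w) ^ p < \<rho>" for w
    using exp_small_in_polydisc[of r1 p w q] that r1 p by (simp add: \<rho>_def)
  have small': "cmod (exp w) < r1" if "cmod (exp w) ^ q < \<rho>" for w
    using exp_small_in_polydisc[of r1 q w p] that r1 p by (simp add: \<rho>_def add.commute)
  obtain C A where CA: "C > 0" "A > 0" and bd: "\<And>N w1 w2. (w1, w2) \<in> monomial_sector p q (d - \<eta>) (d + \<eta>) \<rho> \<Longrightarrow>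
      norm (f (w1, w2) - (\<Sum>n<N. (exp w1 ^ p * exp w2 ^ q) ^ n *\<^sub>C F n (exp w1, exp w2)))
               \<le> C * A ^ N * fact N powr (1 / k) * cmod (exp w1 ^ p * exp w2 ^ q) ^ N"
  proof -
    have "(exp w1, exp w2) \<in> polydisc r'" if "(w1, w2) \<in> monomial_sector p q (d - \<eta>) (d + \<eta>) \<rho>" for w1 w2
    proof -
      have "cmod (exp w1) < r1" "cmod (exp w2) < r1"
        using that small small' unfolding monomial_sector_def by blast+
      then have "cmod (exp w1) < r'" "cmod (exp w2) < r'" using r1 by linarith+
      then show ?thesis by (simp add: polydisc_def del: norm_exp_eq_Re)
    qed
    note pd = this
    have ab: "\<alpha> < d - \<eta>" "d - \<eta> < d + \<eta>" "d + \<eta> < \<beta>" using H \<eta> by linarith+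
    show ?thesis
    proof (rule sector_estimatesD[OF est ab \<rho>(1,2)])
      show "(exp w1, exp w2) \<in> polydisc r'" if "(w1, w2) \<in> monomial_sector p q (d - \<eta>) (d + \<eta>) \<rho>" for w1 w2
        using that by (rule pd)
      fix C A assume "C > 0" "A > 0" and e: "\<And>N w1 w2. (w1, w2) \<in> monomial_sector p q (d - \<eta>) (d + \<eta>) \<rho> \<Longrightarrow>
        norm (f (w1, w2) - (\<Sum>n<N. (exp w1 ^ p * exp w2 ^ q) ^ n *\<^sub>C F n (exp w1, exp w2)))
          \<le> C * A ^ N * fact N powr (1 / k) * cmod (exp w1 ^ p * exp w2 ^ q) ^ N"
      show thesis by (rule that[OF \<open>C > 0\<close> \<open>A > 0\<close> e])
    qed
  qed
  have sec: "(w1, w2) \<in> monomial_sector p q (d - \<eta>) (d + \<eta>) \<rho>"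
    if "Re w1 < ln \<rho>" "Re w2 < ln \<rho>" "\<bar>real p * Im w1 + real q * Im w2 - d\<bar> < \<eta>" for w1 w2
  proof -
    \<comment> \<open>Since \<rho> \<le> 1, bounding |x| by \<rho> bounds its powers as well; this
      is how a radius for the logarithms replaces the one for the powers.\<close>
    have e: "cmod (exp w) ^ n < \<rho>" if "Re w < ln \<rho>" "n > 0" for w n
    proof -
      have "exp (Re w) < \<rho>" using that(1) \<rho> by (metis exp_less_mono exp_ln)
      moreover have "exp (Re w) ^ n \<le> exp (Re w) ^ 1"
        using that(2) calculation \<rho>(3) by (intro power_decreasing) (linarith | simp)+
      ultimately show ?thesis by simp
    qed
    show ?thesis unfolding monomial_sector_def using e[OF that(1) p(1)] e[OF that(2) p(2)] that(3)
      by (auto simp: abs_less_iff)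
  qed
  have sub: "monomial_sector p q (d - \<eta>) (d + \<eta>) \<rho> \<subseteq> monomial_sector p q \<alpha> \<beta> r"
    unfolding monomial_sector_def using H \<eta> \<rho> 2(2) by auto
  show thesis
  proof (rule that[OF \<eta>(1) \<rho>(1) CA])
    show "direction_data p q (1 / k) d \<eta> \<rho> C A f F a"
      unfolding direction_data_def
    proof (intro conjI allI impI)
      show "holomorphic_map {(w1, w2). Re w1 < ln \<rho> \<and> Re w2 < ln \<rho> \<and> \<bar>real p * Im w1 + real q * Im w2 - d\<bar> < \<eta>} f"
        by (rule holomorphic_map_subset[OF 1(5)]) (use sec sub in auto)
      show "expands_2 \<rho> (monomial_part p q a N) (F N)" for N
        using 2(3) \<rho> unfolding monomial_expansion_def expands_2_iff by auto
    qed (use bd sec in auto)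
  qed
qed

section \<open>Finitely many good directions with common constants\<close>

text \<open>The excluded values form a countable set, so every cell of the grid of mesh \<gamma>/3
  contains an admissible point. The points in the two cells next to that of u enclose u within three
  cells; the grid starts with cell -1 so that u = 0 is enclosed too.\<close>

lemma dense_finite_avoiding:
  fixes D :: "real set"
  assumes D: "finite D" and \<gamma>: "\<gamma> > 0" and T: "T \<ge> 0"
  obtains E where "finite E" "\<And>d. d \<in> E \<Longrightarrow> \<forall>e\<in>D. \<forall>j::int. d \<noteq> e + 2 * pi * of_int j"
    "\<And>u. 0 \<le> u \<Longrightarrow> u \<le> T \<Longrightarrow> \<exists>d1\<in>E. \<exists>d2\<in>E. d1 \<le> u \<and> u \<le> d2 \<and> d2 - d1 \<le> \<gamma>"
proof -
  define B where "B = (\<Union>e\<in>D. range (\<lambda>j::int. e + 2 * pi * of_int j))"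
  have B: "countable B" unfolding B_def using D by (intro countable_UN) (auto intro: countable_finite)
  define \<delta> where "\<delta> = \<gamma> / 3"
  have \<delta>: "\<delta> > 0" using \<gamma> by (simp add: \<delta>_def)
  have "\<exists>c. c \<in> {of_int i * \<delta><..<(of_int i + 1) * \<delta>} - B" for i :: int
  proof -
    have "of_int i * \<delta> < (of_int i + 1) * \<delta>" using \<delta> by simp
    then have "uncountable {of_int i * \<delta><..<(of_int i + 1) * \<delta>}" by (simp add: uncountable_open_interval)
    then have "uncountable ({of_int i * \<delta><..<(of_int i + 1) * \<delta>} - B)" using B by (rule uncountable_minus_countable)
    then show ?thesis by (metis countable_empty equals0I)
  qed
  then obtain c where c: "\<And>i :: int. c i \<in> {of_int i * \<delta><..<(of_int i + 1) * \<delta>} - B" by metis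
  define M where "M = \<lceil>T / \<delta>\<rceil> + 1"
  show thesis
  proof
    show "finite (c ` {-1..M})" by simp
    show "\<forall>e\<in>D. \<forall>j::int. d \<noteq> e + 2 * pi * of_int j" if "d \<in> c ` {-1..M}" for d
      using that c by (auto simp: B_def)
    fix u assume u: "0 \<le> u" "u \<le> T"
    define i where "i = \<lfloor>u / \<delta>\<rfloor>"
    have i: "of_int i * \<delta> \<le> u" "u \<le> (of_int i + 1) * \<delta>"
    proof -
      have "of_int i \<le> u / \<delta>" "u / \<delta> \<le> of_int i + 1" unfolding i_def by linarith+
      then show "of_int i * \<delta> \<le> u" "u \<le> (of_int i + 1) * \<delta>" using \<delta> by (simp_all add: pos_le_divide_eq pos_divide_le_eq)
    qed
    have "0 \<le> i" using u \<delta> by (simp add: i_def)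
    moreover have "i + 1 \<le> M"
    proof -
      have "u / \<delta> \<le> T / \<delta>" using u \<delta> by (simp add: divide_right_mono)
      then show ?thesis unfolding i_def M_def by linarith
    qed
    ultimately have mem: "c (i - 1) \<in> c ` {-1..M}" "c (i + 1) \<in> c ` {-1..M}" by auto
    have 1: "of_int (i - 1) * \<delta> < c (i - 1)" "c (i - 1) < (of_int (i - 1) + 1) * \<delta>" using c[of "i - 1"] by auto
    have 2: "of_int (i + 1) * \<delta> < c (i + 1)" "c (i + 1) < (of_int (i + 1) + 1) * \<delta>" using c[of "i + 1"] by auto
    show "\<exists>d1\<in>c ` {-1..M}. \<exists>d2\<in>c ` {-1..M}. d1 \<le> u \<and> u \<le> d2 \<and> d2 - d1 \<le> \<gamma>"
    proof (rule bexI[OF bexI[OF _ mem(2)] mem(1)])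
      have "\<gamma> = 3 * \<delta>" by (simp add: \<delta>_def)
      then show "c (i - 1) \<le> u \<and> u \<le> c (i + 1) \<and> c (i + 1) - c (i - 1) \<le> \<gamma>"
        using 1 2 i by (auto simp: algebra_simps)
    qed
  qed
qed

text \<open>The interval up to 2 pi (p + q) contains p arg x1 + q arg x2 for all arguments between 0
  and 2 pi, and pi s/2 is half of the critical opening. The constants are shared by all directions
  in \<open>E\<close>.\<close>

definition covering_data ::
    "nat \<Rightarrow> nat \<Rightarrow> real \<Rightarrow> 'e::complex_banach series2 \<Rightarrow> real \<Rightarrow> real set \<Rightarrow> real \<Rightarrow> real \<Rightarrow> real \<Rightarrow> real \<Rightarrow> bool" where
  "covering_data p q s a \<gamma> E \<eta> \<rho> C A \<longleftrightarrow> finite E \<and> \<eta> > pi * s / 2 \<and> 0 < \<rho> \<and> 0 < C \<and> 0 < A \<and>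
     (\<forall>d\<in>E. \<exists>f F. direction_data p q s d \<eta> \<rho> C A f F a) \<and>
     (\<forall>u. 0 \<le> u \<longrightarrow> u \<le> 2 * pi * (real p + real q) \<longrightarrow> (\<exists>d1\<in>E. \<exists>d2\<in>E. d1 \<le> u \<and> u \<le> d2 \<and> d2 - d1 \<le> \<gamma>))"

definition multi_direction_data :: "nat \<Rightarrow> nat \<Rightarrow> real \<Rightarrow> 'e::complex_banach series2 \<Rightarrow> bool" where
  "multi_direction_data p q s a \<longleftrightarrow> (\<forall>\<gamma>>0. \<exists>E \<eta> \<rho> C A. covering_data p q s a \<gamma> E \<eta> \<rho> C A)"

lemma multi_direction_data_swap:
  assumes "multi_direction_data p q s a"
  shows "multi_direction_data q p s (\<lambda>n m. a m n)"
proof -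
  have "covering_data q p s (\<lambda>n m. a m n) \<gamma> E \<eta> \<rho> C A" if D: "covering_data p q s a \<gamma> E \<eta> \<rho> C A" for \<gamma> E \<eta> \<rho> C A
  proof -
    have "\<exists>f F. direction_data q p s d \<eta> \<rho> C A f F (\<lambda>n m. a m n)" if "d \<in> E" for d
    proof -
      have "\<forall>d\<in>E. \<exists>f F. direction_data p q s d \<eta> \<rho> C A f F a" using D by (simp add: covering_data_def)
      from bspec[OF this that] obtain f F where "direction_data p q s d \<eta> \<rho> C A f F a" by blast
      from direction_data_swap[OF this] show ?thesis by (intro exI)
    qed
    then show ?thesis using D by (simp add: covering_data_def add.commute)
  qed
  then show ?thesis using assms unfolding multi_direction_data_def by fast
qed

text \<open>Minima and maxima over the directions; the strict inequality for \<eta> survives because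
  there are finitely many.\<close>

lemma uniform_direction_data:
  assumes "finite E" "\<And>d. d \<in> E \<Longrightarrow> \<exists>\<eta> \<rho> C A f F. \<eta> > \<eta>0 \<and> 0 < \<rho> \<and> 0 < C \<and> 0 < A \<and> direction_data p q s d \<eta> \<rho> C A f F a"
  shows "\<exists>\<eta> \<rho> C A. \<eta> > \<eta>0 \<and> 0 < \<rho> \<and> 0 < C \<and> 0 < A \<and> (\<forall>d\<in>E. \<exists>f F. direction_data p q s d \<eta> \<rho> C A f F a)"
  using assms
proof (induction E)
  case empty
  show ?case by (rule exI[of _ "\<eta>0 + 1"], rule exI[of _ 1], rule exI[of _ 1], rule exI[of _ 1]) simp
next
  case (insert d E)
  have "\<exists>\<eta> \<rho> C A. \<eta> > \<eta>0 \<and> 0 < \<rho> \<and> 0 < C \<and> 0 < A \<and> (\<forall>d\<in>E. \<exists>f F. direction_data p q s d \<eta> \<rho> C A f F a)"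
    by (rule insert.IH) (rule insert.prems, simp)
  then obtain \<eta> \<rho> C A where 1: "\<eta> > \<eta>0" "0 < \<rho>" "0 < C" "0 < A" "\<forall>d\<in>E. \<exists>f F. direction_data p q s d \<eta> \<rho> C A f F a"
    by (elim exE conjE) (rule that)
  have "\<exists>\<eta> \<rho> C A f F. \<eta> > \<eta>0 \<and> 0 < \<rho> \<and> 0 < C \<and> 0 < A \<and> direction_data p q s d \<eta> \<rho> C A f F a"
    by (rule insert.prems) simp
  then obtain \<eta>' \<rho>' C' A' f F where 2: "\<eta>' > \<eta>0" "0 < \<rho>'" "0 < C'" "0 < A'" "direction_data p q s d \<eta>' \<rho>' C' A' f F a"
    by (elim exE conjE) (rule that)
  have "direction_data p q s d (min \<eta> \<eta>') (min \<rho> \<rho>') (max C C') (max A A') f F a"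
    by (rule direction_data_mono[OF 2(5)]) (use 1 2 in auto)
  moreover have "\<exists>f F. direction_data p q s d' (min \<eta> \<eta>') (min \<rho> \<rho>') (max C C') (max A A') f F a" if d': "d' \<in> E" for d'
  proof -
    obtain f F where "direction_data p q s d' \<eta> \<rho> C A f F a" using bspec[OF 1(5) d'] by blast
    then have "direction_data p q s d' (min \<eta> \<eta>') (min \<rho> \<rho>') (max C C') (max A A') f F a"
      by (rule direction_data_mono) (use 1 2 in auto)
    then show ?thesis by blast
  qed
  ultimately have all: "\<forall>d'\<in>insert d E. \<exists>f F. direction_data p q s d' (min \<eta> \<eta>') (min \<rho> \<rho>') (max C C') (max A A') f F a"
    by blast
  have pos: "\<eta>0 < min \<eta> \<eta>'" "0 < min \<rho> \<rho>'" "0 < max C C'" "0 < max A A'" using 1(1-4) 2(1-4) by auto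
  show ?case
    by (rule exI[of _ "min \<eta> \<eta>'"], rule exI[of _ "min \<rho> \<rho>'"], rule exI[of _ "max C C'"], rule exI[of _ "max A A'"])
       (intro conjI pos all)
qed

lemma multi_direction_data_of_summable:
  assumes "a \<in> summable_series2 p q k" "p > 0" "q > 0" "k > 0"
  shows "multi_direction_data p q (1 / k) a"
  unfolding multi_direction_data_def
proof (intro allI impI)
  fix \<gamma> :: real assume \<gamma>: "\<gamma> > 0"
  obtain D where D: "finite D" "\<And>d. (\<forall>e\<in>D. \<forall>j::int. d \<noteq> e + 2 * pi * of_int j) \<Longrightarrow> summable_in_direction p q k d a"
    using assms(1) unfolding summable_series2_def by blast
  have T: "0 \<le> 2 * pi * (real p + real q)" by simp
  obtain E where E: "finite E" "\<And>d. d \<in> E \<Longrightarrow> \<forall>e\<in>D. \<forall>j::int. d \<noteq> e + 2 * pi * of_int j"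
    "\<And>u. 0 \<le> u \<Longrightarrow> u \<le> 2 * pi * (real p + real q) \<Longrightarrow> \<exists>d1\<in>E. \<exists>d2\<in>E. d1 \<le> u \<and> u \<le> d2 \<and> d2 - d1 \<le> \<gamma>"
    using dense_finite_avoiding[OF D(1) \<gamma> T] by blast
  have "\<exists>\<eta> \<rho> C A f F. \<eta> > pi * (1 / k) / 2 \<and> 0 < \<rho> \<and> 0 < C \<and> 0 < A \<and> direction_data p q (1 / k) d \<eta> \<rho> C A f F a"
    if d: "d \<in> E" for d
  proof -
    have "summable_in_direction p q k d a" by (rule D(2)[OF E(2)[OF d]])
    then obtain \<eta> \<rho> C A f F where "\<eta> > pi / (2 * k)" "0 < \<rho>" "C > 0" "A > 0"
      "direction_data p q (1 / k) d \<eta> \<rho> C A f F a"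
      by (rule direction_data_of_summable[OF _ assms(2-4)]) (rule that)
    moreover have "pi / (2 * k) = pi * (1 / k) / 2" by simp
    ultimately show ?thesis by metis
  qed
  from uniform_direction_data[OF E(1) this] obtain \<eta> \<rho> C A where
    "\<eta> > pi * (1 / k) / 2" "0 < \<rho>" "0 < C" "0 < A" "\<forall>d\<in>E. \<exists>f F. direction_data p q (1 / k) d \<eta> \<rho> C A f F a"
    by blast
  then have "covering_data p q (1 / k) a \<gamma> E \<eta> \<rho> C A"
    unfolding covering_data_def using E(1,3) by simp
  then show "\<exists>E \<eta> \<rho> C A. covering_data p q (1 / k) a \<gamma> E \<eta> \<rho> C A" by blast
qed

lemma expands_2_unique:
  assumes "expands_2 r c g" "expands_2 r c h" "cmod x1 < r" "cmod x2 < r"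
  shows "g (x1, x2) = h (x1, x2)"
  using assms double_sum_unique unfolding expands_2_iff by blast

lemma Suc_powr_le: "s \<ge> 0 \<Longrightarrow> fact (Suc N) powr s \<le> (2 powr s) ^ N * (fact N powr s :: real)"
proof -
  assume s: "s \<ge> 0"
  have "real (Suc N) \<le> 2 ^ N" using less_exp[of N] by (metis Suc_leI of_nat_mono of_nat_numeral of_nat_power)
  then have "fact (Suc N) \<le> 2 ^ N * (fact N :: real)" by (simp add: mult_right_mono del: of_nat_Suc)
  then have "fact (Suc N) powr s \<le> (2 ^ N * (fact N :: real)) powr s" using s by (intro powr_mono2) auto
  also have "\<dots> = (2 powr s) ^ N * fact N powr s"
    by (simp add: powr_mult powr_powr mult.commute flip: powr_realpow)
  finally show ?thesis .
qed

text \<open>Subtracting consecutive remainders isolates a single term of the decomposition.\<close>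

lemma direction_data_term_bound:
  assumes D: "direction_data p q s d \<eta> \<rho> C A f F a" and s: "s \<ge> 0" and CA: "C > 0" "A > 0" and \<rho>: "\<rho> \<le> 1" "0 < \<rho>"
    and w: "Re w1 < ln \<rho>" "Re w2 < ln \<rho>" "\<bar>real p * Im w1 + real q * Im w2 - d\<bar> < \<eta>"
  shows "norm (F N (exp w1, exp w2)) \<le> (C * (1 + A)) * (A * 2 powr s) ^ N * fact N powr s"
proof -
  define t where "t = exp w1 ^ p * exp w2 ^ q"
  define S where "S N = (\<Sum>n<N. t ^ n *\<^sub>C F n (exp w1, exp w2))" for N
  have e: "norm (f (w1, w2) - S N) \<le> C * A ^ N * fact N powr s * cmod t ^ N" for N
    using D w unfolding direction_data_def S_def t_def by blast
  have le1: "cmod (exp w) \<le> 1" if "Re w < ln \<rho>" for w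
  proof -
    have "exp (Re w) < \<rho>" using that \<rho> by (metis exp_less_mono exp_ln)
    then have "exp (Re w) \<le> 1" using \<rho> by linarith
    then show ?thesis by (simp only: norm_exp_eq_Re)
  qed
  have t: "cmod t \<le> 1" "cmod t > 0"
    using le1[OF w(1)] le1[OF w(2)] by (auto simp: t_def norm_mult norm_power intro!: mult_le_one power_le_one)
  have two: "(2::real) powr s \<ge> 1" using s by (intro ge_one_powr_ge_zero) auto
  have "t ^ N *\<^sub>C F N (exp w1, exp w2) = S (Suc N) - S N" by (simp add: S_def)
  also have "\<dots> = (f (w1, w2) - S N) - (f (w1, w2) - S (Suc N))" by simp
  also have "norm \<dots> \<le> norm (f (w1, w2) - S N) + norm (f (w1, w2) - S (Suc N))" by (rule norm_triangle_ineq4)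
  also have "\<dots> \<le> C * A ^ N * fact N powr s * cmod t ^ N + C * A ^ Suc N * fact (Suc N) powr s * cmod t ^ Suc N"
    by (intro add_mono e)
  also have "\<dots> \<le> C * A ^ N * ((2 powr s) ^ N * fact N powr s) * cmod t ^ N + C * A ^ Suc N * ((2 powr s) ^ N * fact N powr s) * cmod t ^ N"
  proof (intro add_mono mult_mono)
    show "fact N powr s \<le> (2 powr s) ^ N * (fact N powr s :: real)"
      using mult_right_mono[OF one_le_power[OF two, of N], of "fact N powr s"] by simp
    show "fact (Suc N) powr s \<le> (2 powr s) ^ N * (fact N powr s :: real)" by (rule Suc_powr_le[OF s])
    show "cmod t ^ Suc N \<le> cmod t ^ N" using t by (intro power_decreasing) auto
  qed (use CA in auto)
  also have "\<dots> = cmod t ^ N * ((C * (1 + A)) * (A * 2 powr s) ^ N * fact N powr s)"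
    by (simp add: algebra_simps power_mult_distrib)
  finally have "cmod t ^ N * norm (F N (exp w1, exp w2)) \<le> cmod t ^ N * ((C * (1 + A)) * (A * 2 powr s) ^ N * fact N powr s)"
    by (simp add: norm_scaleC norm_power)
  then show ?thesis using t by (subst (asm) mult_le_cancel_left_pos) auto
qed

text \<open>With mesh pi s/2 < \<eta> the sectors around the directions in \<open>E\<close> cover
  every argument, so the terms f_N are bounded on a whole torus and not just on a sector. The
  functions obtained for different directions expand the same arrays and hence agree there.\<close>

lemma gevrey_coeffs_of_multi_direction_data:
  fixes a :: "'e::complex_banach series2"
  assumes M: "multi_direction_data p q s a" and p: "p > 0" "q > 0" and s: "s > 0"
  shows "gevrey_coeffs (s / real p) a"
proof -
  have "pi * s / 2 > 0" using s by simp
  then obtain E \<eta> \<rho>0 C A where cov: "covering_data p q s a (pi * s / 2) E \<eta> \<rho>0 C A"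
    using M unfolding multi_direction_data_def by meson
  define \<rho> where "\<rho> = min \<rho>0 1"
  have \<eta>: "\<eta> > pi * s / 2" and \<rho>0: "0 < \<rho>0" and CA: "0 < C" "0 < A" using cov by (auto simp: covering_data_def)
  have \<rho>: "0 < \<rho>" "\<rho> \<le> 1" "\<rho> \<le> \<rho>0" using \<rho>0 by (auto simp: \<rho>_def)
  have "\<exists>f F. direction_data p q s d \<eta> \<rho> C A f F a" if "d \<in> E" for d
  proof -
    have "\<forall>d\<in>E. \<exists>f F. direction_data p q s d \<eta> \<rho>0 C A f F a" using cov by (simp add: covering_data_def)
    from bspec[OF this that] obtain f F where "direction_data p q s d \<eta> \<rho>0 C A f F a" by blast
    then have "direction_data p q s d \<eta> \<rho> C A f F a" by (rule direction_data_mono) (use \<rho> CA in auto)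
    then show ?thesis by blast
  qed
  then obtain f F where D: "\<And>d. d \<in> E \<Longrightarrow> direction_data p q s d \<eta> \<rho> C A (f d) (F d) a" by metis
  have cover: "\<exists>d1\<in>E. \<exists>d2\<in>E. d1 \<le> u \<and> u \<le> d2 \<and> d2 - d1 \<le> pi * s / 2" if "0 \<le> u" "u \<le> 2 * pi * (real p + real q)" for u
    using cov that by (simp add: covering_data_def)
  from cover[of 0] obtain d0 where d0: "d0 \<in> E" by auto
  have ex: "expands_2 \<rho> (monomial_part p q a N) (F d N)" if "d \<in> E" for d N
    using D[OF that] unfolding direction_data_def by blast
  have two: "(2::real) powr s > 0" by simp
  show ?thesis
  proof (rule gevrey_coeffs_of_expansion[OF p _ ex[OF d0], of s "\<rho> / 2" "C * (1 + A)" "A * 2 powr s"])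
    fix N x1 x2 assume x: "cmod x1 = \<rho> / 2" "cmod x2 = \<rho> / 2"
    define w where "w x = Complex (ln (\<rho> / 2)) (Arg2pi x)" for x
    have ew: "exp (w x) = x" if "cmod x = \<rho> / 2" for x
    proof -
      have "w x = of_real (ln (\<rho> / 2)) + \<i> * of_real (Arg2pi x)" by (simp add: w_def complex_eq_iff)
      then have "exp (w x) = of_real (\<rho> / 2) * exp (\<i> * of_real (Arg2pi x))"
        using \<rho> by (simp only: exp_add exp_of_real exp_ln half_gt_zero)
      also have "\<dots> = of_real (cmod x) * exp (\<i> * of_real (Arg2pi x))" by (simp only: that)
      also have "\<dots> = x" by (rule Arg2pi_eq[symmetric])
      finally show ?thesis .
    qed
    define u where "u = real p * Arg2pi x1 + real q * Arg2pi x2"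
    have "0 \<le> u" unfolding u_def using Arg2pi_ge_0 by (intro add_nonneg_nonneg mult_nonneg_nonneg) auto
    moreover have "u \<le> real p * (2 * pi) + real q * (2 * pi)"
      unfolding u_def by (intro add_mono mult_left_mono less_imp_le[OF Arg2pi_lt_2pi]) auto
    ultimately obtain d1 d2 where d: "d1 \<in> E" "d1 \<le> u" "u \<le> d2" "d2 - d1 \<le> pi * s / 2"
      using cover[of u] by (auto simp: algebra_simps)
    have "\<bar>real p * Im (w x1) + real q * Im (w x2) - d1\<bar> < \<eta>"
      using d \<eta> by (simp add: w_def u_def[symmetric])
    moreover have "Re (w x) < ln \<rho>" for x using \<rho> by (simp add: w_def)
    ultimately have "norm (F d1 N (exp (w x1), exp (w x2))) \<le> (C * (1 + A)) * (A * 2 powr s) ^ N * fact N powr s"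
      using s CA \<rho> by (intro direction_data_term_bound[OF D[OF d(1)]]) auto
    moreover have "F d0 N (x1, x2) = F d1 N (x1, x2)"
      using x \<rho> by (intro expands_2_unique[OF ex[OF d0] ex[OF d(1)]]) auto
    ultimately show "norm (F d0 N (x1, x2)) \<le> C * (1 + A) * (A * 2 powr s) ^ N * fact N powr s"
      by (simp add: ew x)
  qed (use \<rho> CA s in auto)
qed

text \<open>Compares the partial sums of the decomposition with the partial sums in powers of the first
  variable alone; this reduces the two-variable situation to one variable.\<close>

lemma truncation_vs_first_variable:
  fixes a :: "'e::complex_banach series2"
  assumes p: "p > 0" "q > 0" and s: "s \<ge> 0"
    and a1: "\<And>n m. norm (a n m) \<le> C * A ^ n * A ^ m * fact n powr (s / real p)"
    and a2: "\<And>n m. norm (a n m) \<le> C * A ^ n * A ^ m * fact m powr (s / real q)"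
    and C: "C \<ge> 1" and A: "A \<ge> 1"
  obtains K B where "K \<ge> 1" "B \<ge> 1"
    "\<And>M N m j. p * N \<le> M + p \<Longrightarrow> m + M < N * p \<or> j < N * q \<Longrightarrow>
       norm (a (m + M) j) \<le> K * B ^ M * fact M powr (s / real p) * A ^ m * A ^ j"
proof -
  obtain K1 B1 where 1: "K1 \<ge> 1" "B1 \<ge> 1" "\<And>N M. p * N \<le> M + p \<Longrightarrow> fact N powr s \<le> K1 * B1 ^ M * fact M powr (s / real p)"
    using fact_powr_le_of_mult_le[OF p(1) s] by blast
  obtain K2 B2 where 2: "K2 \<ge> 1" "B2 \<ge> 1" "\<And>N. fact (p * (N + 1)) powr (s / real p) \<le> K2 * B2 ^ N * fact N powr s"
    using fact_mult_powr_le[OF p(1) s] by blast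
  obtain K3 B3 where 3: "K3 \<ge> 1" "B3 \<ge> 1" "\<And>N. fact (q * (N + 1)) powr (s / real q) \<le> K3 * B3 ^ N * fact N powr s"
    using fact_mult_powr_le[OF p(2) s] by blast
  define B4 where "B4 = max B2 B3"
  define K4 where "K4 = max K2 K3"
  have m4: "K2 \<le> K4" "K3 \<le> K4" "B2 \<le> B4" "B3 \<le> B4" "1 \<le> K4" "1 \<le> B4" using 2 3 by (auto simp: K4_def B4_def)
  define K where "K = C * (K4 * B4 * K1)"
  define B where "B = A * (B4 * B1)"
  have KB: "K \<ge> 1" "B \<ge> 1"
  proof -
    have "1 * (1 * 1 * 1) \<le> K" unfolding K_def using m4 1 C by (intro mult_mono) auto
    then show "K \<ge> 1" by simp
    have "1 * (1 * 1) \<le> B" unfolding B_def using m4 1 A by (intro mult_mono) auto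
    then show "B \<ge> 1" by simp
  qed
  show thesis
  proof (rule that[OF KB])
    fix M N m j assume pN: "p * N \<le> M + p" and cond: "m + M < N * p \<or> j < N * q"
    have N: "N \<le> M + 1"
    proof -
      have "M \<le> p * M" using p(1) by simp
      then have "p * N \<le> p * (M + 1)" using pN unfolding distrib_left by linarith
      then show ?thesis using p(1) mult_le_cancel1[of p N "M + 1"] by simp
    qed
    \<comment> \<open>Either alternative bounds one of the two indices by a multiple of N, and the
      growth condition for that index yields (N!)^s. The inequality p N \<le> M + p then converts
      this into (M!)^(s/p).\<close>
    have f: "\<exists>X. norm (a (m + M) j) \<le> C * A ^ (m + M) * A ^ j * X \<and> X \<le> K4 * B4 ^ N * fact N powr s"
      using cond
    proof
      assume "m + M < N * p"
      then have "fact (m + M) powr (s / real p) \<le> (fact (p * (N + 1)) powr (s / real p) :: real)"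
        using s by (intro powr_mono2 fact_mono) (auto simp: algebra_simps)
      also have "\<dots> \<le> K2 * B2 ^ N * fact N powr s" by (rule 2)
      also have "\<dots> \<le> K4 * B4 ^ N * fact N powr s" using m4 2 by (intro mult_mono power_mono) auto
      finally show ?thesis using a1[of "m + M" j] by blast
    next
      assume "j < N * q"
      then have "fact j powr (s / real q) \<le> (fact (q * (N + 1)) powr (s / real q) :: real)"
        using s by (intro powr_mono2 fact_mono) (auto simp: algebra_simps)
      also have "\<dots> \<le> K3 * B3 ^ N * fact N powr s" by (rule 3)
      also have "\<dots> \<le> K4 * B4 ^ N * fact N powr s" using m4 3 by (intro mult_mono power_mono) auto
      finally show ?thesis using a2[of "m + M" j] by blast
    qed
    then obtain X where X: "norm (a (m + M) j) \<le> C * A ^ (m + M) * A ^ j * X" "X \<le> K4 * B4 ^ N * fact N powr s" by blast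
    note X(1)
    also have "C * A ^ (m + M) * A ^ j * X \<le> C * A ^ (m + M) * A ^ j * (K4 * B4 ^ (M + 1) * (K1 * B1 ^ M * fact M powr (s / real p)))"
    proof (rule mult_left_mono)
      have "K4 * B4 ^ N * fact N powr s \<le> K4 * B4 ^ (M + 1) * (K1 * B1 ^ M * fact M powr (s / real p))"
        using m4 N 1(3)[OF pN] by (intro mult_mono power_increasing) auto
      with X(2) show "X \<le> K4 * B4 ^ (M + 1) * (K1 * B1 ^ M * fact M powr (s / real p))" by linarith
    qed (use C A in auto)
    also have "\<dots> = K * B ^ M * fact M powr (s / real p) * A ^ m * A ^ j"
      by (simp add: K_def B_def power_add power_mult_distrib mult_ac)
    finally show "norm (a (m + M) j) \<le> K * B ^ M * fact M powr (s / real p) * A ^ m * A ^ j" .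
  qed
qed

lemma double_sum_first_variable:
  fixes a :: "'e::complex_banach series2"
  assumes b: "\<And>n. ((\<lambda>m. x2 ^ m *\<^sub>C a n m) has_sum b n) UNIV"
  shows "double_sum (\<lambda>m j. if m < M then a m j else 0) x1 x2 (\<Sum>n<M. x1 ^ n *\<^sub>C b n)"
proof (induction M)
  case 0
  then show ?case by (simp add: double_sum_alt)
next
  case (Suc M)
  have "double_sum (\<lambda>m j. if m = M then a m j else 0) x1 x2 (x1 ^ M *\<^sub>C b M)"
  proof -
    have inj: "inj_on (\<lambda>j. (M, j)) (UNIV :: nat set)" by (auto simp: inj_on_def)
    let ?f = "\<lambda>x. (x1 ^ fst x * x2 ^ snd x) *\<^sub>C (if fst x = M then a (fst x) (snd x) else 0)"
    have "((\<lambda>j. x1 ^ M *\<^sub>C x2 ^ j *\<^sub>C a M j) has_sum x1 ^ M *\<^sub>C b M) UNIV"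
      by (rule has_sum_bounded_linear[OF bounded_linear_scaleC b])
    then have "(?f \<circ> (\<lambda>j. (M, j)) has_sum x1 ^ M *\<^sub>C b M) UNIV"
      by (simp add: o_def scaleC_scaleC)
    then have "(?f has_sum x1 ^ M *\<^sub>C b M) ((\<lambda>j. (M, j)) ` UNIV)"
      by (subst has_sum_reindex[OF inj])
    then have "(?f has_sum x1 ^ M *\<^sub>C b M) UNIV"
      by (rule has_sum_cong_neutral[THEN iffD1, rotated -1]) (auto simp: image_iff)
    then show ?thesis unfolding double_sum_alt .
  qed
  from double_sum_add[OF Suc this]
  have "double_sum (\<lambda>m j. (if m < M then a m j else 0) + (if m = M then a m j else 0)) x1 x2 ((\<Sum>n<M. x1 ^ n *\<^sub>C b n) + x1 ^ M *\<^sub>C b M)" .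
  also have "(\<lambda>m j. (if m < M then a m j else 0) + (if m = M then a m j else 0)) = (\<lambda>m j. if m < Suc M then a m j else 0)"
    by (auto simp: fun_eq_iff less_Suc_eq)
  finally show ?case by simp
qed

section \<open>Reduction to one variable\<close>

lemma geometric_has_sum_banach:
  fixes c :: "nat \<Rightarrow> 'e::banach"
  assumes "\<And>m. norm (c m) \<le> M * q ^ m" "0 \<le> q" "q < 1"
  obtains s where "(c has_sum s) UNIV" "norm s \<le> M / (1 - q)"
proof -
  have g: "((\<lambda>m. M * q ^ m) has_sum M * (1 / (1 - q))) UNIV"
    by (rule has_sum_cmult_right[OF has_sum_geometric_nat[OF assms(2,3)]])
  have abs: "c abs_summable_on UNIV"
    by (rule summable_on_comparison_test[OF has_sum_imp_summable[OF g]]) (use assms(1) in auto)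
  have "norm (infsum c UNIV) \<le> infsum (\<lambda>m. norm (c m)) UNIV" by (rule norm_infsum_bound[OF abs])
  also have "\<dots> \<le> M * (1 / (1 - q))"
    by (rule has_sum_mono[OF has_sum_infsum[OF abs] g]) (use assms(1) in auto)
  finally show thesis using has_sum_infsum[OF abs_summable_summable[OF abs]] by (intro that) auto
qed

text \<open>With x2 fixed and x1 = exp(i \<delta> + \<mu> w), this \<delta> is the one for which p
  Im w1 + q Im w2 - d = s Im w. The error splits at the partial sum SN of the decomposition: f - SN
  is the given asymptotics and accounts for C A K2, while the distance from SN to the partial sum in
  powers of x1 is controlled by the truncation bound and accounts for 4 K.\<close>

lemma slice_sum_in_strip:
  fixes a :: "'e::complex_banach series2"
  assumes D: "direction_data p q s d \<eta> \<rho> C A f F a" and p: "p > 0" and s: "s > 0" and CA: "C > 0" "A \<ge> 1" and \<rho>: "\<rho> \<le> 1"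
    and trunc: "\<And>M N m j. p * N \<le> M + p \<Longrightarrow> m + M < N * p \<or> j < N * q \<Longrightarrow>
       norm (a (m + M) j) \<le> K * B ^ M * fact M powr (s / real p) * A0 ^ m * A0 ^ j"
    and KB: "K \<ge> 1" "B \<ge> 1" "A0 \<ge> 1"
    and fct: "\<And>N M. p * N \<le> M + p \<Longrightarrow> fact N powr s \<le> K2 * B2 ^ M * fact M powr (s / real p)" and K2: "K2 \<ge> 1" "B2 \<ge> 1"
    and r: "0 < r" "r < \<rho>" "A0 * r \<le> 1 / 2"
    and w2: "Re w2 = ln r" and b: "\<And>n. ((\<lambda>m. exp w2 ^ m *\<^sub>C a n m) has_sum b n) UNIV"
    and l: "\<And>x. x < - l \<Longrightarrow> exp (s / real p * x) < r"
    and \<theta>: "\<theta> * s \<le> \<eta>" and \<phi>: "dual_unit \<phi>"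
    and Cs: "C * A * K2 + 4 * K \<le> C'" and As: "A * B2 \<le> A'" "B \<le> A'"
  defines "\<delta> \<equiv> (d - real q * Im w2) / real p"
  shows "sum_in_strip (s / real p) \<theta> l A' C' (\<lambda>w. \<phi> (f (\<i> * of_real \<delta> + of_real (s / real p) * w, w2)))
           (\<lambda>n. \<phi> (b n) * exp (\<i> * of_real (real n * \<delta>)))"
  unfolding sum_in_strip_def
proof (intro conjI allI impI)
  define \<mu> where "\<mu> = s / real p"
  have \<mu>: "\<mu> > 0" "real p * \<mu> = s" using s p by (auto simp: \<mu>_def)
  define g where "g = (\<lambda>w. (\<i> * of_real \<delta> + of_real \<mu> * w, w2))"
  define S where "S = {(w1, w2). Re w1 < ln \<rho> \<and> Re w2 < ln \<rho> \<and> \<bar>real p * Im w1 + real q * Im w2 - d\<bar> < \<eta>}"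
  have lnr: "ln r < ln \<rho>" using r by simp
  have dom: "Re (\<i> * of_real \<delta> + of_real \<mu> * w) < ln \<rho>" "Re w2 < ln \<rho>"
      "\<bar>real p * Im (\<i> * of_real \<delta> + of_real \<mu> * w) + real q * Im w2 - d\<bar> < \<eta>"
      "cmod (exp (\<i> * of_real \<delta> + of_real \<mu> * w)) < r"
      if w: "Re w < - l" "\<bar>Im w\<bar> < \<theta>" for w
  proof -
    have e: "exp (\<mu> * Re w) < r" using l[OF w(1)] by (simp add: \<mu>_def)
    then have "ln (exp (\<mu> * Re w)) < ln r" using r by (subst ln_less_cancel_iff) auto
    then show "Re (\<i> * of_real \<delta> + of_real \<mu> * w) < ln \<rho>" using lnr by simp
    show "Re w2 < ln \<rho>" using w2 lnr by simp
    show "cmod (exp (\<i> * of_real \<delta> + of_real \<mu> * w)) < r" using e by simp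
    have "real p * Im (\<i> * of_real \<delta> + of_real \<mu> * w) + real q * Im w2 - d = (real p * \<mu>) * Im w"
      using p by (simp add: \<delta>_def field_simps)
    also have "\<bar>(real p * \<mu>) * Im w\<bar> = \<bar>Im w\<bar> * s" using \<mu> s by (simp add: abs_mult)
    also have "\<dots> < \<theta> * s" using w s by (intro mult_strict_right_mono) auto
    finally show "\<bar>real p * Im (\<i> * of_real \<delta> + of_real \<mu> * w) + real q * Im w2 - d\<bar> < \<eta>" using \<theta> by linarith
  qed
  have hol: "holomorphic_map S f" using D unfolding direction_data_def S_def by blast
  have fd: "(\<lambda>w. \<phi> (f (g w))) field_differentiable (at w)" if w: "Re w < - l" "\<bar>Im w\<bar> < \<theta>" for w
  proof -
    have "g w \<in> S" unfolding S_def g_def using dom[OF w] by simp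
    then obtain Df where Df: "(f has_derivative Df) (at (g w))" "\<And>c h. Df (c *\<^sub>C h) = c *\<^sub>C Df h"
      using hol unfolding holomorphic_map_def by blast
    have "(g has_derivative (\<lambda>h. (of_real \<mu> * h, 0))) (at w)"
      unfolding g_def by (auto intro!: derivative_eq_intros)
    from has_derivative_compose[of g "\<lambda>h. (of_real \<mu> * h, 0)" w UNIV f Df, OF this Df(1)]
    have "((\<lambda>w. f (g w)) has_derivative (\<lambda>h. Df (of_real \<mu> * h, 0))) (at w)" .
    from bounded_linear.has_derivative[OF dual_unit_bounded_linear[OF \<phi>] this]
    have "((\<lambda>w. \<phi> (f (g w))) has_derivative (\<lambda>h. \<phi> (Df (of_real \<mu> * h, 0)))) (at w)" .
    moreover have "\<phi> (Df (of_real \<mu> * h, 0)) = \<phi> (Df (of_real \<mu>, 0)) * h" for h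
    proof -
      have "(of_real \<mu> * h, 0) = h *\<^sub>C (of_real \<mu> :: complex, 0 :: complex)"
        by (simp add: scaleC_prod_def scaleC_complex_def)
      then show ?thesis using Df(2)[of h "(of_real \<mu>, 0)"] \<phi> by (simp add: dual_unit_def mult.commute)
    qed
    ultimately have "((\<lambda>w. \<phi> (f (g w))) has_field_derivative \<phi> (Df (of_real \<mu>, 0))) (at w)"
      by (simp add: has_field_derivative_def)
    then show ?thesis by (auto simp: field_differentiable_def)
  qed
  have geq: "(\<lambda>w. \<phi> (f (\<i> * of_real \<delta> + of_real (s / real p) * w, w2))) = (\<lambda>w. \<phi> (f (g w)))"
    by (simp only: g_def \<mu>_def)
  show "(\<lambda>w. \<phi> (f (\<i> * of_real \<delta> + of_real (s / real p) * w, w2))) holomorphic_on {w. Re w < - l \<and> \<bar>Im w\<bar> < \<theta>}"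
    unfolding geq holomorphic_on_def using fd field_differentiable_at_within by blast
  fix M w assume w: "Re w < - l" "\<bar>Im w\<bar> < \<theta>"
  define x1 where "x1 = exp (\<i> * of_real \<delta> + of_real \<mu> * w)"
  define x2 where "x2 = exp w2"
  have n1: "cmod x1 = exp (\<mu> * Re w)" by (simp add: x1_def)
  have n2: "cmod x2 = r" using w2 r by (simp add: x2_def)
  have x: "cmod x1 < r" "cmod x1 \<le> 1" "cmod x2 \<le> 1" "cmod x1 < \<rho>" "cmod x2 < \<rho>"
    using dom(4)[OF w] r \<rho> n2 unfolding x1_def[symmetric] by auto
  \<comment> \<open>The least N with M < N p: the index set of SN then contains that of the partial
    sum in x1, and still p N \<le> M + p.\<close>
  define N where "N = M div p + 1"
  have N: "p * N \<le> M + p" "M < N * p" "N \<le> M + 1"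
    using p by (auto simp: N_def algebra_simps dividend_less_times_div div_le_dividend mult.commute)
  define SN where "SN = (\<Sum>n<N. (x1 ^ p * x2 ^ q) ^ n *\<^sub>C F n (x1, x2))"
  define QM where "QM = (\<Sum>n<M. x1 ^ n *\<^sub>C b n)"
  have 1: "norm (f (g w) - SN) \<le> C * A * K2 * A' ^ M * fact M powr \<mu> * cmod x1 ^ M"
  proof -
    have "norm (f (g w) - SN) \<le> C * A ^ N * fact N powr s * cmod (x1 ^ p * x2 ^ q) ^ N"
      using D dom[OF w] unfolding direction_data_def g_def SN_def x1_def x2_def by blast
    also have "\<dots> \<le> C * A ^ (M + 1) * (K2 * B2 ^ M * fact M powr \<mu>) * cmod x1 ^ M"
    proof (intro mult_mono)
      show "A ^ N \<le> A ^ (M + 1)" using CA N by (intro power_increasing) auto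
      show "fact N powr s \<le> K2 * B2 ^ M * fact M powr \<mu>" unfolding \<mu>_def by (rule fct[OF N(1)])
      have "cmod (x1 ^ p * x2 ^ q) ^ N = cmod x1 ^ (N * p) * cmod x2 ^ (N * q)"
        by (simp add: norm_mult norm_power power_mult_distrib power_mult[symmetric] mult.commute)
      also have "\<dots> \<le> cmod x1 ^ M * 1"
        using x N by (intro mult_mono power_decreasing power_le_one) auto
      finally show "cmod (x1 ^ p * x2 ^ q) ^ N \<le> cmod x1 ^ M" by simp
    qed (use CA K2 in auto)
    also have "\<dots> = C * A * K2 * (A * B2) ^ M * fact M powr \<mu> * cmod x1 ^ M"
      by (simp add: power_mult_distrib)
    also have "\<dots> \<le> C * A * K2 * A' ^ M * fact M powr \<mu> * cmod x1 ^ M"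
      using CA K2 As by (intro mult_right_mono mult_left_mono power_mono) auto
    finally show ?thesis .
  qed
  have 2: "norm (SN - QM) \<le> 4 * K * A' ^ M * fact M powr \<mu> * cmod x1 ^ M"
  proof -
    \<comment> \<open>The coefficients of (SN - QM) / x1^M.\<close>
    define dd where "dd = (\<lambda>m j. if m + M < N * p \<or> j < N * q then a (m + M) j else 0)"
    have bdd: "norm (dd m j) \<le> (K * B ^ M * fact M powr \<mu>) * A0 ^ m * A0 ^ j" for m j
      using trunc[OF N(1), of m j] KB unfolding dd_def \<mu>_def by auto
    have small: "A0 * cmod x1 \<le> 1 / 2" "A0 * cmod x2 \<le> 1 / 2"
    proof -
      have "A0 * cmod x1 \<le> A0 * r" using x KB by (intro mult_left_mono) auto
      then show "A0 * cmod x1 \<le> 1 / 2" using r by linarith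
      show "A0 * cmod x2 \<le> 1 / 2" using n2 r by simp
    qed
    have A00: "A0 \<ge> 0" "(1::real) / 2 < 1" using KB by auto
    obtain s' where s': "double_sum dd x1 x2 s'" "norm s' \<le> (K * B ^ M * fact M powr \<mu>) / (1 - 1 / 2)\<^sup>2"
      by (rule double_sum_bounded[OF bdd A00(1) small A00(2)])
    have "double_sum (\<lambda>m j. if m < N * p \<or> j < N * q then a m j else 0) x1 x2 SN"
      unfolding SN_def using D x unfolding direction_data_def expands_2_iff by (intro double_sum_truncation) blast
    moreover have "double_sum (\<lambda>m j. if m < M then a m j else 0) x1 x2 QM"
      unfolding QM_def x2_def by (rule double_sum_first_variable[OF b])
    ultimately have "double_sum (\<lambda>m j. (if m < N * p \<or> j < N * q then a m j else 0) - (if m < M then a m j else 0)) x1 x2 (SN - QM)"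
      by (rule double_sum_diff)
    also have "(\<lambda>m j. (if m < N * p \<or> j < N * q then a m j else 0) - (if m < M then a m j else 0))
        = (\<lambda>m j. if M \<le> m \<and> 0 \<le> j then dd (m - M) (j - 0) else 0)"
      using N(2) by (auto simp: dd_def fun_eq_iff)
    finally have "SN - QM = (x1 ^ M * x2 ^ 0) *\<^sub>C s'"
      using double_sum_shift[OF s'(1), of M 0] by (rule double_sum_unique)
    then have "norm (SN - QM) = cmod x1 ^ M * norm s'" by (simp add: norm_scaleC norm_power)
    also have "\<dots> \<le> cmod x1 ^ M * ((K * B ^ M * fact M powr \<mu>) / (1 - 1 / 2)\<^sup>2)" using s' by (intro mult_left_mono) auto
    also have "\<dots> = 4 * K * B ^ M * fact M powr \<mu> * cmod x1 ^ M" by (simp add: power2_eq_square)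
    also have "\<dots> \<le> 4 * K * A' ^ M * fact M powr \<mu> * cmod x1 ^ M"
      using KB As by (intro mult_right_mono mult_left_mono power_mono) auto
    finally show ?thesis .
  qed
  have "norm (f (g w) - QM) \<le> norm (f (g w) - SN) + norm (SN - QM)"
    using norm_triangle_ineq[of "f (g w) - SN" "SN - QM"] by simp
  also have "\<dots> \<le> (C * A * K2 + 4 * K) * A' ^ M * fact M powr \<mu> * cmod x1 ^ M"
    using 1 2 by (simp add: distrib_right)
  also have "\<dots> \<le> C' * A' ^ M * fact M powr \<mu> * cmod x1 ^ M"
    using Cs As KB by (intro mult_right_mono) auto
  finally have 3: "norm (f (g w) - QM) \<le> C' * A' ^ M * fact M powr \<mu> * cmod x1 ^ M" .
  interpret \<phi>: bounded_linear \<phi> by (rule dual_unit_bounded_linear[OF \<phi>])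
  have "\<phi> QM = (\<Sum>n<M. \<phi> (b n) * exp (\<i> * of_real (real n * \<delta>)) * exp (of_real (real n * \<mu>) * w))"
  proof -
    have "\<phi> (x1 ^ n *\<^sub>C b n) = \<phi> (b n) * exp (\<i> * of_real (real n * \<delta>)) * exp (of_real (real n * \<mu>) * w)" for n
    proof -
      have "x1 ^ n = exp (\<i> * of_real (real n * \<delta>)) * exp (of_real (real n * \<mu>) * w)"
        unfolding x1_def exp_of_nat_mult[symmetric] exp_add[symmetric] by (simp add: algebra_simps)
      then show ?thesis using \<phi> by (simp add: dual_unit_def)
    qed
    then show ?thesis unfolding QM_def \<phi>.sum by simp
  qed
  then have "cmod (\<phi> (f (g w)) - (\<Sum>n<M. \<phi> (b n) * exp (\<i> * of_real (real n * \<delta>)) * exp (of_real (real n * \<mu>) * w)))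
     = cmod (\<phi> (f (g w) - QM))" by (simp add: \<phi>.diff)
  also have "\<dots> \<le> norm (f (g w) - QM)" using \<phi> by (simp add: dual_unit_def)
  also note 3
  also have "cmod x1 ^ M = exp (\<mu> * real M * Re w)" by (simp add: n1 mult_ac flip: exp_of_nat_mult)
  finally show "cmod (\<phi> (f (\<i> * of_real \<delta> + of_real (s / real p) * w, w2))
        - (\<Sum>n<M. \<phi> (b n) * exp (\<i> * of_real (real n * \<delta>)) * exp (of_real (real n * (s / real p)) * w)))
     \<le> C' * A' ^ M * fact M powr (s / real p) * exp (s / real p * real M * Re w)"
    unfolding g_def \<mu>_def .
qed

text \<open>For x2 on a fixed circle the coefficients b n of x1^n form a one-variable series, which
  the one-variable result bounds geometrically, uniformly in x2 and in the functional. Cauchy's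
  estimate in x2 then returns to a n m. Growth in the second index enters through the truncation
  bound, and it is supplied by summability itself.\<close>

lemma tauberian_two_variables:
  fixes a :: "'e::complex_banach series2"
  assumes M: "multi_direction_data p q s a" and p: "p > 0" "q > 0" and s: "s > 0"
    and g: "gevrey_coeffs \<sigma> a" and \<sigma>: "0 < \<sigma>" "\<sigma> < s / real p"
  shows "gevrey_coeffs 0 a"
proof -
  define \<mu> where "\<mu> = s / real p"
  have \<mu>: "\<mu> > 0" using s p by (simp add: \<mu>_def)
  have s0: "s \<ge> 0" using s by simp
  have g2: "gevrey_coeffs (s / real q) (\<lambda>n m. a m n)"
    by (rule gevrey_coeffs_of_multi_direction_data[OF multi_direction_data_swap[OF M] p(2,1) s])
  obtain C0 A0 where CA0: "C0 \<ge> 1" "A0 \<ge> 1" and a0: "\<And>n m. norm (a n m) \<le> C0 * A0 ^ n * A0 ^ m * fact n powr \<sigma>"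
    and a2: "\<And>n m. norm (a n m) \<le> C0 * A0 ^ n * A0 ^ m * fact m powr (s / real q)"
    using gevrey_coeffsE[OF g g2] by metis
  have a1: "norm (a n m) \<le> C0 * A0 ^ n * A0 ^ m * fact n powr (s / real p)" for n m
  proof -
    have "C0 * A0 ^ n * A0 ^ m * fact n powr \<sigma> \<le> C0 * A0 ^ n * A0 ^ m * fact n powr (s / real p)"
      using CA0 \<sigma> by (intro mult_left_mono powr_mono) auto
    with a0[of n m] show ?thesis by linarith
  qed
  obtain K B where KB: "K \<ge> 1" "B \<ge> 1" and trunc:
    "\<And>M N m j. p * N \<le> M + p \<Longrightarrow> m + M < N * p \<or> j < N * q \<Longrightarrow>
       norm (a (m + M) j) \<le> K * B ^ M * fact M powr (s / real p) * A0 ^ m * A0 ^ j"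
    using truncation_vs_first_variable[OF p s0 a1 a2 CA0] by blast
  obtain K2 B2 where K2: "K2 \<ge> 1" "B2 \<ge> 1" and fct: "\<And>N M. p * N \<le> M + p \<Longrightarrow> fact N powr s \<le> K2 * B2 ^ M * fact M powr (s / real p)"
    using fact_powr_le_of_mult_le[OF p(1) s0] by blast
  \<comment> \<open>Half of the angle that \<open>tauberian_one_variable\<close> must stay below.
    Directions d are values of p arg x1 + q arg x2, so mesh p \<gamma> in d is mesh \<gamma> in the
    argument of x1.\<close>
  define \<gamma> where "\<gamma> = pi * (\<mu> - \<sigma>) / 2"
  have ms: "\<mu> - \<sigma> > 0" using \<sigma> by (simp add: \<mu>_def)
  have "0 < pi * (\<mu> - \<sigma>)" using ms by simp
  then have \<gamma>: "0 < \<gamma>" "\<gamma> < pi * (\<mu> - \<sigma>)" unfolding \<gamma>_def by linarith+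
  have "real p * \<gamma> > 0" using \<gamma> p by simp
  then obtain E \<eta> \<rho>0 C A1 where cov: "covering_data p q s a (real p * \<gamma>) E \<eta> \<rho>0 C A1"
    using M unfolding multi_direction_data_def by meson
  have \<eta>: "\<eta> > pi * s / 2" and \<rho>0: "0 < \<rho>0" and CA: "0 < C" "0 < A1" using cov by (auto simp: covering_data_def)
  define \<rho> where "\<rho> = min \<rho>0 1"
  define A where "A = max A1 1"
  have \<rho>: "0 < \<rho>" "\<rho> \<le> 1" "\<rho> \<le> \<rho>0" using \<rho>0 by (auto simp: \<rho>_def)
  have A: "A \<ge> 1" "A1 \<le> A" by (auto simp: A_def)
  have data: "\<exists>f F. direction_data p q s d \<eta> \<rho> C A f F a" if "d \<in> E" for d
  proof -
    have "\<forall>d\<in>E. \<exists>f F. direction_data p q s d \<eta> \<rho>0 C A1 f F a" using cov by (simp add: covering_data_def)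
    from bspec[OF this that] obtain f F where "direction_data p q s d \<eta> \<rho>0 C A1 f F a" by blast
    then have "direction_data p q s d \<eta> \<rho> C A f F a" by (rule direction_data_mono) (use \<rho> CA A in auto)
    then show ?thesis by blast
  qed
  have cover: "\<exists>d1\<in>E. \<exists>d2\<in>E. d1 \<le> u \<and> u \<le> d2 \<and> d2 - d1 \<le> real p * \<gamma>" if "0 \<le> u" "u \<le> 2 * pi * (real p + real q)" for u
    using cov that by (simp add: covering_data_def)
  define r where "r = min (\<rho> / 2) (1 / (2 * A0))"
  have r: "0 < r" "r < \<rho>" "A0 * r \<le> 1 / 2"
  proof -
    show "0 < r" "r < \<rho>" using \<rho> CA0 by (auto simp: r_def)
    have "A0 * r \<le> A0 * (1 / (2 * A0))" unfolding r_def using CA0 by (intro mult_left_mono) auto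
    then show "A0 * r \<le> 1 / 2" using CA0 by simp
  qed
  \<comment> \<open>Re w < -l has to imply |x1| = exp(\<mu> Re w) < r.\<close>
  define l where "l = max 0 (- ln r / \<mu>)"
  have l: "l \<ge> 0" "exp (s / real p * x) < r" if "x < - l" for x
  proof -
    have "x < ln r / \<mu>" using that by (simp add: l_def)
    then have "\<mu> * x < ln r" using \<mu> by (simp add: pos_less_divide_eq mult.commute)
    then have "exp (\<mu> * x) < exp (ln r)" by simp
    then show "exp (s / real p * x) < r" using r by (simp add: \<mu>_def)
  qed (simp add: l_def)
  have l0: "l \<ge> 0" by (simp add: l_def)
  \<comment> \<open>After the scaling the half-height is \<eta>/s; the cap pi keeps the strip within
    the range of the principal logarithm.\<close>
  define \<theta> where "\<theta> = min (\<eta> / s) pi"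
  have "pi / 2 < \<eta> / s" using \<eta> s by (simp add: field_simps)
  then have \<theta>: "pi / 2 < \<theta>" "\<theta> \<le> pi" by (auto simp: \<theta>_def)
  have \<theta>s: "\<theta> * s \<le> \<eta>"
  proof -
    have "\<theta> * s \<le> \<eta> / s * s" unfolding \<theta>_def using s by (intro mult_right_mono) auto
    then show ?thesis using s by simp
  qed
  \<comment> \<open>The entries A0 and 2 C0 cover the slices b n themselves, whose geometric series
    in x2 has ratio at most 1/2.\<close>
  define A' where "A' = max (max (A * B2) B) A0"
  define C' where "C' = max (C * A * K2 + 4 * K) (2 * C0)"
  have A': "A * B2 \<le> A'" "B \<le> A'" "A0 \<le> A'" "A' > 0" using CA0 by (auto simp: A'_def)
  have C': "C * A * K2 + 4 * K \<le> C'" "2 * C0 \<le> C'" "C' \<ge> 0" using CA0 by (auto simp: C'_def)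
  from tauberian_one_variable[OF \<mu> \<theta> l0 A'(4) \<sigma>(1) \<sigma>(2)[folded \<mu>_def] \<gamma>]
  obtain KK where KKr: "KK > 0 \<and> (\<forall>C\<ge>0. \<forall>a. (\<forall>n. cmod (a n) \<le> C * A' ^ n * fact n powr \<sigma>) \<longrightarrow>
     (\<forall>\<alpha>\<in>{0..2*pi}. \<exists>\<delta>1 \<delta>2. \<delta>1 \<le> \<alpha> \<and> \<alpha> \<le> \<delta>2 \<and> \<delta>2 - \<delta>1 \<le> \<gamma> \<and>
        (\<forall>\<delta>\<in>{\<delta>1, \<delta>2}. \<exists>H. sum_in_strip \<mu> \<theta> l A' C H (\<lambda>n. a n * exp (\<i> * of_real (real n * \<delta>))))) \<longrightarrow>
     (\<forall>n. cmod (a n) \<le> KK * C * KK ^ n))" ..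
  note KK = conjunct1[OF KKr] and taub = mp[OF spec[OF conjunct2[OF KKr]] C'(3)]
  have bound: "cmod (\<phi> (a n m)) \<le> KK * C' * KK ^ n / r ^ m" if \<phi>: "dual_unit \<phi>" for \<phi> n m
  proof (rule power_series_coeff_bound[where R' = "1 / A0" and f = "\<lambda>z. infsum (\<lambda>m. \<phi> (z ^ m *\<^sub>C a n m)) UNIV"])
    have rA: "r * A0 < 1" using r CA0 by (simp add: mult.commute)
    show "0 < r" "r < 1 / A0" using r rA CA0 by (auto simp: pos_less_divide_eq)
    interpret \<phi>: bounded_linear \<phi> by (rule dual_unit_bounded_linear[OF \<phi>])
    have row: "\<exists>b. ((\<lambda>m. z ^ m *\<^sub>C a n m) has_sum b) UNIV \<and> norm b \<le> C0 * A0 ^ n * fact n powr \<sigma> / (1 - A0 * cmod z)"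
      if z: "A0 * cmod z < 1" for z n
    proof -
      have le: "norm (z ^ m *\<^sub>C a n m) \<le> C0 * A0 ^ n * fact n powr \<sigma> * (A0 * cmod z) ^ m" for m
      proof -
        have "norm (z ^ m *\<^sub>C a n m) \<le> cmod z ^ m * (C0 * A0 ^ n * A0 ^ m * fact n powr \<sigma>)"
          unfolding norm_scaleC norm_power by (intro mult_left_mono a0) auto
        then show ?thesis by (simp add: power_mult_distrib mult_ac)
      qed
      have "0 \<le> A0 * cmod z" using CA0 by simp
      from geometric_has_sum_banach[OF le this z] show ?thesis by metis
    qed
    show "(\<lambda>m. \<phi> (a n m) * z ^ m) sums infsum (\<lambda>m. \<phi> (z ^ m *\<^sub>C a n m)) UNIV" if z: "z \<in> ball 0 (1 / A0)" for z
    proof -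
      have "A0 * cmod z < 1" using z CA0 by (simp add: field_simps)
      then obtain b where "((\<lambda>m. z ^ m *\<^sub>C a n m) has_sum b) UNIV" using row by blast
      then have "((\<lambda>m. \<phi> (z ^ m *\<^sub>C a n m)) has_sum \<phi> b) UNIV" by (rule has_sum_bounded_linear[OF \<phi>.bounded_linear])
      from has_sum_imp_sums[OF has_sum_infsum[OF has_sum_imp_summable[OF this]]]
      show ?thesis using \<phi> by (simp add: dual_unit_def mult.commute)
    qed
    fix z assume z: "cmod z = r"
    define w2 where "w2 = Complex (ln r) (Arg2pi z)"
    have ew2: "exp w2 = z"
    proof -
      have "w2 = of_real (ln r) + \<i> * of_real (Arg2pi z)" by (simp add: w2_def complex_eq_iff)
      then have "exp w2 = of_real r * exp (\<i> * of_real (Arg2pi z))"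
        using r by (simp only: exp_add exp_of_real exp_ln)
      also have "\<dots> = of_real (cmod z) * exp (\<i> * of_real (Arg2pi z))" by (simp only: z)
      also have "\<dots> = z" by (rule Arg2pi_eq[symmetric])
      finally show ?thesis .
    qed
    have zA: "A0 * cmod z < 1" using rA z by (simp add: mult.commute)
    obtain b where b: "\<And>n. ((\<lambda>m. z ^ m *\<^sub>C a n m) has_sum b n) UNIV"
      and bn: "\<And>n. norm (b n) \<le> C0 * A0 ^ n * fact n powr \<sigma> / (1 - A0 * cmod z)"
      using row[OF zA] by metis
    have bd: "cmod (\<phi> (b n)) \<le> C' * A' ^ n * fact n powr \<sigma>" for n
    proof -
      have "cmod (\<phi> (b n)) \<le> norm (b n)" using \<phi> by (simp add: dual_unit_def)
      also note bn
      also have "C0 * A0 ^ n * fact n powr \<sigma> / (1 - A0 * cmod z) \<le> C0 * A0 ^ n * fact n powr \<sigma> / (1 / 2)"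
        using r z CA0 by (intro divide_left_mono) auto
      also have "\<dots> = 2 * C0 * A0 ^ n * fact n powr \<sigma>" by simp
      also have "\<dots> \<le> C' * A' ^ n * fact n powr \<sigma>"
        using C' A' CA0 by (intro mult_right_mono mult_mono power_mono) auto
      finally show ?thesis .
    qed
    have strip: "\<exists>H. sum_in_strip \<mu> \<theta> l A' C' H (\<lambda>n. \<phi> (b n) * exp (\<i> * of_real (real n * ((d - real q * Arg2pi z) / real p))))"
      if d: "d \<in> E" for d
    proof -
      obtain f F where fF: "direction_data p q s d \<eta> \<rho> C A f F a" using data[OF d] by blast
      have w2r: "Re w2 = ln r" "Im w2 = Arg2pi z" by (simp_all add: w2_def)
      have b': "((\<lambda>m. exp w2 ^ m *\<^sub>C a n m) has_sum b n) UNIV" for n using b by (simp add: ew2)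
      show ?thesis unfolding \<mu>_def w2r(2)[symmetric]
        by (rule exI, rule slice_sum_in_strip[OF fF p(1) s CA(1) A(1) \<rho>(2) _ KB CA0(2) _ K2 r w2r(1) b' _ \<theta>s \<phi> C'(1) A'(1,2)])
           (erule (1) trunc | erule fct | erule l(2))+
    qed
    have dirs: "\<forall>\<alpha>\<in>{0..2*pi}. \<exists>\<delta>1 \<delta>2. \<delta>1 \<le> \<alpha> \<and> \<alpha> \<le> \<delta>2 \<and> \<delta>2 - \<delta>1 \<le> \<gamma> \<and>
        (\<forall>\<delta>\<in>{\<delta>1, \<delta>2}. \<exists>H. sum_in_strip \<mu> \<theta> l A' C' H (\<lambda>n. \<phi> (b n) * exp (\<i> * of_real (real n * \<delta>))))"
    proof
      fix \<alpha> :: real assume \<alpha>: "\<alpha> \<in> {0..2*pi}"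
      define u where "u = real p * \<alpha> + real q * Arg2pi z"
      have "0 \<le> u" unfolding u_def using \<alpha> Arg2pi_ge_0 by (intro add_nonneg_nonneg mult_nonneg_nonneg) auto
      moreover have "u \<le> real p * (2 * pi) + real q * (2 * pi)"
        unfolding u_def using \<alpha> by (intro add_mono mult_left_mono less_imp_le[OF Arg2pi_lt_2pi]) auto
      ultimately obtain d1 d2 where d: "d1 \<in> E" "d2 \<in> E" "d1 \<le> u" "u \<le> d2" "d2 - d1 \<le> real p * \<gamma>"
        using cover[of u] by (auto simp: algebra_simps)
      define \<delta>1 where "\<delta>1 = (d1 - real q * Arg2pi z) / real p"
      define \<delta>2 where "\<delta>2 = (d2 - real q * Arg2pi z) / real p"
      have "\<delta>1 \<le> \<alpha>" "\<alpha> \<le> \<delta>2" using d(3,4) p by (auto simp: \<delta>1_def \<delta>2_def u_def field_simps)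
      moreover have "\<delta>2 - \<delta>1 \<le> \<gamma>"
      proof -
        have "\<delta>2 - \<delta>1 = (d2 - d1) / real p" by (simp add: \<delta>1_def \<delta>2_def diff_divide_distrib)
        also have "\<dots> \<le> real p * \<gamma> / real p" using d(5) by (intro divide_right_mono) auto
        finally show ?thesis using p by simp
      qed
      moreover have "\<forall>\<delta>\<in>{\<delta>1, \<delta>2}. \<exists>H. sum_in_strip \<mu> \<theta> l A' C' H (\<lambda>n. \<phi> (b n) * exp (\<i> * of_real (real n * \<delta>)))"
        using strip[OF d(1)] strip[OF d(2)] by (simp only: \<delta>1_def[symmetric] \<delta>2_def[symmetric] ball_simps)
      ultimately show "\<exists>\<delta>1 \<delta>2. \<delta>1 \<le> \<alpha> \<and> \<alpha> \<le> \<delta>2 \<and> \<delta>2 - \<delta>1 \<le> \<gamma> \<and>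
        (\<forall>\<delta>\<in>{\<delta>1, \<delta>2}. \<exists>H. sum_in_strip \<mu> \<theta> l A' C' H (\<lambda>n. \<phi> (b n) * exp (\<i> * of_real (real n * \<delta>))))"
        by (intro exI conjI)
    qed
    have "\<forall>n. cmod (\<phi> (b n)) \<le> KK * C' * KK ^ n"
      using mp[OF mp[OF spec[OF taub, of "\<lambda>n. \<phi> (b n)"] allI[OF bd]] dirs] .
    moreover have "infsum (\<lambda>m. \<phi> (z ^ m *\<^sub>C a n m)) UNIV = \<phi> (b n)"
      by (intro infsumI has_sum_bounded_linear[OF \<phi>.bounded_linear b])
    ultimately show "cmod (infsum (\<lambda>m. \<phi> (z ^ m *\<^sub>C a n m)) UNIV) \<le> KK * C' * KK ^ n" by simp
  qed
  define Af where "Af = max KK (1 / r)"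
  have Af: "KK \<le> Af" "1 / r \<le> Af" "0 < Af" using KK by (auto simp: Af_def)
  have KC: "KK * C' > 0" using KK C'(2) CA0 by simp
  show ?thesis
  proof (rule gevrey_coeffsI[OF KC Af(3)])
    fix n m
    have "norm (a n m) \<le> KK * C' * KK ^ n / r ^ m" by (rule norm_le_by_dual[OF bound])
    also have "\<dots> = KK * C' * KK ^ n * (1 / r) ^ m" by (simp add: power_divide)
    also have "\<dots> \<le> KK * C' * Af ^ n * Af ^ m"
    proof (intro mult_mono mult_left_mono power_mono)
      show "KK \<le> Af" "1 / r \<le> Af" by (rule Af)+
    qed (use less_imp_le[OF KC] less_imp_le[OF Af(3)] KK r C'(3) in simp_all)
    finally show "norm (a n m) \<le> KK * C' * Af ^ (n + m) * fact n powr 0" by (simp add: power_add mult.assoc)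
  qed
qed

section \<open>Gevrey series in a monomial\<close>

text \<open>For bounded m the factorial of m + N p is (N!)^p up to geometric factors. The bound P on
  m is separate from p because the shift and the width of the index strip may come from different
  monomials.\<close>

lemma shifted_coeff_bound_1:
  fixes a :: "'e::complex_banach series2"
  assumes p: "p > 0" and s: "s \<ge> 0" and CA: "C \<ge> 1" "A \<ge> 1"
    and a1: "\<And>n m. norm (a n m) \<le> C * A ^ n * A ^ m * fact n powr (s / real p)"
  obtains K B where "K \<ge> 1" "B \<ge> 1"
    "\<And>N m j. m \<le> P \<Longrightarrow> norm (a (m + N * p) (j + N * q)) \<le> K * B ^ N * fact N powr s * A ^ m * A ^ j"
proof -
  define \<sigma> where "\<sigma> = s / real p"
  have \<sigma>: "\<sigma> \<ge> 0" using p s by (simp add: \<sigma>_def)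
  obtain K0 B0 where K0: "K0 \<ge> 1" "B0 \<ge> 1" and f0: "\<And>N. fact (p * (N + 1)) powr \<sigma> \<le> K0 * B0 ^ N * fact N powr s"
    unfolding \<sigma>_def using fact_mult_powr_le[OF p s] by blast
  define K1 where "K1 = (2 ^ (p + P) * fact P :: real) powr \<sigma>"
  define B1 where "B1 = (2 ^ p :: real) powr \<sigma>"
  have "1 \<le> (2 ^ (p + P) * fact P :: real)" using mult_mono[of 1 "2 ^ (p + P) :: real" 1 "fact P"] by simp
  then have K1: "K1 \<ge> 1" unfolding K1_def using \<sigma> by (rule ge_one_powr_ge_zero)
  have B1: "B1 \<ge> 1" unfolding B1_def using \<sigma> by (intro ge_one_powr_ge_zero) auto
  have ge1: "1 \<le> x * y" if "1 \<le> x" "1 \<le> y" for x y :: real using mult_mono[of 1 x 1 y] that by simp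
  show thesis
  proof
    show "C * K1 * K0 \<ge> 1" using CA K1 K0 by (intro ge1) auto
    show "A ^ (p + q) * (B1 * B0) \<ge> 1" using CA B1 K0 by (intro ge1) auto
    fix N m j :: nat assume m: "m \<le> P"
    have "fact (m + N * p) \<le> (fact (p * (N + 1) + P) :: real)"
      using m by (intro fact_mono) (simp add: algebra_simps)
    also have "\<dots> \<le> 2 ^ (p * (N + 1) + P) * (fact (p * (N + 1)) * fact P)" by (rule fact_add_le)
    also have "\<dots> = (2 ^ (p + P) * fact P) * (2 ^ p) ^ N * fact (p * (N + 1))"
      by (simp add: power_add power_mult[symmetric] algebra_simps)
    finally have "fact (m + N * p) powr \<sigma> \<le> ((2 ^ (p + P) * fact P) * (2 ^ p) ^ N * fact (p * (N + 1)) :: real) powr \<sigma>"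
      using \<sigma> by (intro powr_mono2) auto
    also have "\<dots> = K1 * ((2 ^ p) ^ N) powr \<sigma> * fact (p * (N + 1)) powr \<sigma>" by (simp only: K1_def powr_mult)
    also have "((2 ^ p) ^ N) powr \<sigma> = B1 ^ N"
      unfolding B1_def by (simp add: powr_powr mult_ac flip: powr_realpow)
    also have "K1 * B1 ^ N * fact (p * (N + 1)) powr \<sigma> \<le> K1 * B1 ^ N * (K0 * B0 ^ N * fact N powr s)"
      using K1 B1 f0 by (intro mult_left_mono) auto
    finally have f: "fact (m + N * p) powr \<sigma> \<le> K1 * B1 ^ N * (K0 * B0 ^ N * fact N powr s)" .
    have "norm (a (m + N * p) (j + N * q)) \<le> C * A ^ (m + N * p) * A ^ (j + N * q) * fact (m + N * p) powr \<sigma>"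
      unfolding \<sigma>_def by (rule a1)
    also have "\<dots> \<le> C * A ^ (m + N * p) * A ^ (j + N * q) * (K1 * B1 ^ N * (K0 * B0 ^ N * fact N powr s))"
      using CA by (intro mult_left_mono f) auto
    also have "\<dots> = C * K1 * K0 * (A ^ (p + q) * (B1 * B0)) ^ N * fact N powr s * A ^ m * A ^ j"
    proof -
      have "A ^ (m + N * p) = A ^ m * (A ^ p) ^ N" "A ^ (j + N * q) = A ^ j * (A ^ q) ^ N"
        by (simp_all add: power_add power_mult mult.commute[of N])
      then show ?thesis by (simp only: power_mult_distrib power_add mult_ac)
    qed
    finally show "norm (a (m + N * p) (j + N * q)) \<le> C * K1 * K0 * (A ^ (p + q) * (B1 * B0)) ^ N * fact N powr s * A ^ m * A ^ j" .
  qed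
qed

text \<open>The indices with m \<le> P or j \<le> Q form an L of bounded width at the corner (N p, N
  q); each arm is handled by the bound in its own variable.\<close>

lemma shifted_coeff_bound:
  fixes a :: "'e::complex_banach series2"
  assumes p: "p > 0" "q > 0" and s: "s \<ge> 0" and CA: "C \<ge> 1" "A \<ge> 1"
    and a1: "\<And>n m. norm (a n m) \<le> C * A ^ n * A ^ m * fact n powr (s / real p)"
    and a2: "\<And>n m. norm (a n m) \<le> C * A ^ n * A ^ m * fact m powr (s / real q)"
  obtains K B where "K \<ge> 1" "B \<ge> 1"
    "\<And>N m j. m \<le> P \<or> j \<le> Q \<Longrightarrow> norm (a (m + N * p) (j + N * q)) \<le> K * B ^ N * fact N powr s * A ^ m * A ^ j"
proof -
  obtain K1 B1 where 1: "K1 \<ge> 1" "B1 \<ge> 1" and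
    b1: "\<And>N m j. m \<le> P \<Longrightarrow> norm (a (m + N * p) (j + N * q)) \<le> K1 * B1 ^ N * fact N powr s * A ^ m * A ^ j"
    using shifted_coeff_bound_1[where a = a and q = q, OF p(1) s CA a1] by blast
  have a2': "norm (a m n) \<le> C * A ^ n * A ^ m * fact n powr (s / real q)" for n m using a2[of m n] by (simp add: mult_ac)
  obtain K2 B2 where 2: "K2 \<ge> 1" "B2 \<ge> 1" and
    b2: "\<And>N m j. m \<le> Q \<Longrightarrow> norm (a (j + N * p) (m + N * q)) \<le> K2 * B2 ^ N * fact N powr s * A ^ m * A ^ j"
    using shifted_coeff_bound_1[where a = "\<lambda>n m. a m n" and p = q and q = p and P = Q, OF p(2) s CA a2'] by blast
  show thesis
  proof
    show "max K1 K2 \<ge> 1" "max B1 B2 \<ge> 1" using 1 2 by auto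
    fix N m j assume mj: "m \<le> P \<or> j \<le> Q"
    have mono: "X * Y ^ N * fact N powr s * A ^ m * A ^ j \<le> max K1 K2 * max B1 B2 ^ N * fact N powr s * A ^ m * A ^ j"
      if "0 \<le> X" "X \<le> max K1 K2" "0 \<le> Y" "Y \<le> max B1 B2" for X Y
      using that CA by (intro mult_right_mono mult_mono power_mono) auto
    show "norm (a (m + N * p) (j + N * q)) \<le> max K1 K2 * max B1 B2 ^ N * fact N powr s * A ^ m * A ^ j"
    proof (cases "m \<le> P")
      case True
      show ?thesis by (rule order_trans[OF b1[OF True] mono]) (use 1 in auto)
    next
      case False
      then have "j \<le> Q" using mj by simp
      from b2[OF this, of m N]
      have "norm (a (m + N * p) (j + N * q)) \<le> K2 * B2 ^ N * fact N powr s * A ^ m * A ^ j" by (simp only: mult_ac)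
      then show ?thesis by (rule order_trans[OF _ mono]) (use 2 in auto)
    qed
  qed
qed

lemma monomial_part_bound:
  assumes "\<And>N m j. m \<le> p \<or> j \<le> q \<Longrightarrow> norm (a (m + N * p) (j + N * q)) \<le> K * B ^ N * fact N powr s * A ^ m * A ^ j"
    and "K \<ge> 1" "B \<ge> 1" "A \<ge> 1"
  shows "norm (monomial_part p q a N m j) \<le> K * B ^ N * fact N powr s * A ^ m * A ^ j"
proof (cases "m < p \<or> j < q")
  case True
  then have "m \<le> p \<or> j \<le> q" by auto
  from assms(1)[OF this, of N] show ?thesis using True by (simp add: monomial_part_def add.commute)
next
  case False
  then show ?thesis using assms(2-4) by (simp add: monomial_part_def)
qed

lemma expands_1_of_geometric_bound:
  fixes c :: "nat \<Rightarrow> 'e::complex_banach"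
  assumes c: "\<And>m. norm (c m) \<le> M * A ^ m" and A: "A > 0"
  shows "\<exists>g\<in>bounded_holomorphic (ball 0 (1 / (2 * A))). expands_1 (1 / (2 * A)) c g"
proof -
  have "\<exists>b. ((\<lambda>m. z ^ m *\<^sub>C c m) has_sum b) UNIV \<and> norm b \<le> M / (1 - 1 / 2)" if "z \<in> ball 0 (1 / (2 * A))" for z
  proof -
    have Az: "A * cmod z \<le> 1 / 2" using that A by (simp add: field_simps)
    have M: "0 \<le> M" using c[of 0] norm_ge_zero[of "c 0"] by (simp del: norm_ge_zero)
    have "norm (z ^ m *\<^sub>C c m) \<le> M * (1 / 2) ^ m" for m
    proof -
      have "norm (z ^ m *\<^sub>C c m) \<le> cmod z ^ m * (M * A ^ m)"
        unfolding norm_scaleC norm_power by (intro mult_left_mono c) auto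
      also have "\<dots> = M * (A * cmod z) ^ m" by (simp add: power_mult_distrib mult_ac)
      also have "\<dots> \<le> M * (1 / 2) ^ m" using Az A M by (intro mult_left_mono power_mono) auto
      finally show ?thesis .
    qed
    from geometric_has_sum_banach[OF this] show ?thesis by auto
  qed
  then obtain g where g: "\<And>z. z \<in> ball 0 (1 / (2 * A)) \<Longrightarrow> ((\<lambda>m. z ^ m *\<^sub>C c m) has_sum g z) UNIV \<and> norm (g z) \<le> M / (1 - 1 / 2)"
    by metis
  have ex: "expands_1 (1 / (2 * A)) c g" using g by (auto simp: expands_1_def intro!: has_sum_imp_sums)
  have "bounded (g ` ball 0 (1 / (2 * A)))" using g by (intro boundedI[of _ "M / (1 - 1 / 2)"]) blast
  then show ?thesis using expands_1_deriv(1)[OF ex] ex unfolding bounded_holomorphic_def by blast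
qed

lemma double_sum_half:
  fixes c :: "'e::complex_banach series2"
  assumes "\<And>m j. norm (c m j) \<le> M * A ^ m * A ^ j" and "A > 0"
    and "(x1, x2) \<in> polydisc (1 / (2 * A))"
  shows "\<exists>v. double_sum c x1 x2 v \<and> norm v \<le> 4 * M"
proof -
  have q: "A * cmod x1 \<le> 1 / 2" "A * cmod x2 \<le> 1 / 2" using assms(2,3) by (auto simp: polydisc_def field_simps)
  obtain v where "double_sum c x1 x2 v" "norm v \<le> M / (1 - 1 / 2)\<^sup>2"
    by (rule double_sum_bounded[OF assms(1) less_imp_le[OF assms(2)] q]) auto
  then show ?thesis by (auto simp: power2_eq_square)
qed

lemma polydisc_mono: "r \<le> r' \<Longrightarrow> polydisc r \<subseteq> polydisc r'"
  by (auto simp: polydisc_def)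

text \<open>The converse of \<open>gevrey_coeffs_of_expansion\<close>. One family \<open>F\<close>
  serves all radii up to r0, so that the radius can still be shrunk to fit a sector.\<close>

lemma gevrey_expansion:
  fixes a :: "'e::complex_banach series2"
  assumes p: "p > 0" "q > 0" and s: "s \<ge> 0"
    and g: "gevrey_coeffs (s / real p) a" "gevrey_coeffs (s / real q) (\<lambda>n m. a m n)"
  obtains r0 C A F where "r0 > 0" "C > 0" "A > 0" "a \<in> series_C"
    "\<And>r. 0 < r \<Longrightarrow> r \<le> r0 \<Longrightarrow> monomial_expansion p q r a F"
    "\<And>n x. x \<in> polydisc r0 \<Longrightarrow> norm (F n x) \<le> C * A ^ n * fact n powr s"
proof -
  obtain C A where CA: "C \<ge> 1" "A \<ge> 1" and a1: "\<And>n m. norm (a n m) \<le> C * A ^ n * A ^ m * fact n powr (s / real p)"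
    and a2: "\<And>n m. norm (a n m) \<le> C * A ^ n * A ^ m * fact m powr (s / real q)"
    using gevrey_coeffsE[OF g] by metis
  obtain K B where KB: "K \<ge> 1" "B \<ge> 1" and
    b: "\<And>N m j. m \<le> p \<or> j \<le> q \<Longrightarrow> norm (a (m + N * p) (j + N * q)) \<le> K * B ^ N * fact N powr s * A ^ m * A ^ j"
    using shifted_coeff_bound[OF p s CA a1 a2, of p q] by blast
  have mp: "norm (monomial_part p q a N m j) \<le> K * B ^ N * fact N powr s * A ^ m * A ^ j" for N m j
    by (rule monomial_part_bound[OF b KB CA(2)])
  define r0 where "r0 = 1 / (2 * A)"
  have r0: "r0 > 0" using CA by (simp add: r0_def)
  have ex: "\<exists>v. double_sum (monomial_part p q a n) (fst x) (snd x) v \<and> norm v \<le> 4 * (K * B ^ n * fact n powr s)"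
    if "x \<in> polydisc r0" for n x
    using that CA by (intro double_sum_half[OF mp]) (auto simp: r0_def)
  define F where "F n x = (SOME v. double_sum (monomial_part p q a n) (fst x) (snd x) v \<and>
      norm v \<le> 4 * (K * B ^ n * fact n powr s))" for n x
  have F: "double_sum (monomial_part p q a n) (fst x) (snd x) (F n x)"
    and Fb: "norm (F n x) \<le> 4 * K * B ^ n * fact n powr s" if "x \<in> polydisc r0" for n x
    using someI_ex[OF ex[OF that, of n], folded F_def] by (simp_all only: mult.assoc)
  show thesis
  proof
    show "r0 > 0" "4 * K > 0" "B > 0" using r0 KB by auto
    show "norm (F n x) \<le> 4 * K * B ^ n * fact n powr s" if "x \<in> polydisc r0" for n x using Fb[OF that] .
    show "monomial_expansion p q r a F" if r: "0 < r" "r \<le> r0" for r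
      unfolding monomial_expansion_def
    proof
      fix n
      have ex: "expands_2 r (monomial_part p q a n) (F n)"
        unfolding expands_2_iff using F[of "(x1, x2)" for x1 x2] r by (auto simp: polydisc_def)
      have "bounded (F n ` polydisc r)"
        using Fb polydisc_mono[OF r(2)] by (intro boundedI[of _ "4 * K * B ^ n * fact n powr s"]) blast
      then have "F n \<in> bounded_holomorphic (polydisc r)"
        using expands_2_holomorphic[OF ex] by (simp add: bounded_holomorphic_def)
      moreover have "(partial_1 ^^ i) ((partial_2 ^^ j) (F n)) (0, 0) = 0" if "i \<ge> p" "j \<ge> q" for i j
        unfolding partials_at_0[OF ex r(1)] using that by (simp add: monomial_part_def)
      ultimately show "F n \<in> space_E p q r \<and> expands_2 r (monomial_part p q a n) (F n)"
        using ex by (simp add: space_E_def)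
    qed
    have "\<exists>g\<in>bounded_holomorphic (ball 0 r0). expands_1 r0 (\<lambda>m. a n m) g" for n
      unfolding r0_def
      by (rule expands_1_of_geometric_bound[of _ "C * A ^ n * fact n powr (s / real p)"])
         (use a1[of n] CA in \<open>auto simp: mult_ac\<close>)
    moreover have "\<exists>g\<in>bounded_holomorphic (ball 0 r0). expands_1 r0 (\<lambda>n. a n m) g" for m
      unfolding r0_def
      by (rule expands_1_of_geometric_bound[of _ "C * A ^ m * fact m powr (s / real q)"])
         (use a2[of _ m] CA in \<open>auto simp: mult_ac\<close>)
    ultimately show "a \<in> series_C" unfolding series_C_def series_C_at_def using r0 by blast
  qed
qed

lemma gevrey_series2_iff:
  fixes a :: "'e::complex_banach series2"
  assumes p: "p > 0" "q > 0" and s: "s \<ge> 0"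
  shows "a \<in> gevrey_series2 p q s \<longleftrightarrow> gevrey_coeffs (s / real p) a \<and> gevrey_coeffs (s / real q) (\<lambda>n m. a m n)"
proof
  assume "a \<in> gevrey_series2 p q s"
  then obtain r F where r: "r > 0" and F: "monomial_expansion p q r a F" and "gevrey (sup_norm r) s F"
    unfolding gevrey_series2_def by blast
  then obtain C A where CA: "C > 0" "A > 0" and sn: "\<And>n. sup_norm r (F n) \<le> C * A ^ n * fact n powr s"
    unfolding gevrey_def by blast
  have bd: "norm (F n (x1, x2)) \<le> C * A ^ n * fact n powr s" if "cmod x1 = r / 2" "cmod x2 = r / 2" for n x1 x2
  proof -
    have x: "(x1, x2) \<in> polydisc r" using that r by (simp add: polydisc_def)
    have "bounded (F n ` polydisc r)"
      using F unfolding monomial_expansion_def space_E_def bounded_holomorphic_def by blast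
    then have "bdd_above ((\<lambda>x. norm (F n x)) ` polydisc r)" unfolding bounded_iff bdd_above_def by auto
    from cSUP_upper[OF x this] have "norm (F n (x1, x2)) \<le> sup_norm r (F n)" by (simp add: sup_norm_def)
    then show ?thesis using sn[of n] by linarith
  qed
  have ex: "expands_2 r (monomial_part p q a n) (F n)" for n using F by (simp add: monomial_expansion_def)
  have ex': "expands_2 r (monomial_part q p (\<lambda>n m. a m n) n) (\<lambda>(x1, x2). F n (x2, x1))" for n
    by (subst monomial_part_swap) (rule expands_2_swap[OF ex])
  have \<rho>: "0 < r / 2" "r / 2 < r" using r by auto
  show "gevrey_coeffs (s / real p) a \<and> gevrey_coeffs (s / real q) (\<lambda>n m. a m n)"
  proof
    show "gevrey_coeffs (s / real p) a" by (rule gevrey_coeffs_of_expansion[OF p s ex \<rho> CA bd])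
    show "gevrey_coeffs (s / real q) (\<lambda>n m. a m n)"
      by (rule gevrey_coeffs_of_expansion[OF p(2,1) s ex' \<rho> CA]) (use bd in simp)
  qed
next
  assume "gevrey_coeffs (s / real p) a \<and> gevrey_coeffs (s / real q) (\<lambda>n m. a m n)"
  then obtain r0 C A F where 1: "r0 > 0" "C > 0" "A > 0" "a \<in> series_C"
    "\<And>r. 0 < r \<Longrightarrow> r \<le> r0 \<Longrightarrow> monomial_expansion p q r a F"
    "\<And>n x. x \<in> polydisc r0 \<Longrightarrow> norm (F n x) \<le> C * A ^ n * fact n powr s"
    using gevrey_expansion[OF p s] by metis
  have "(0, 0) \<in> polydisc r0" using 1(1) by (simp add: polydisc_def)
  then have "sup_norm r0 (F n) \<le> C * A ^ n * fact n powr s" for n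
    unfolding sup_norm_def by (intro cSUP_least 1(6)) auto
  then have "gevrey (sup_norm r0) s F" unfolding gevrey_def using 1(2,3) by blast
  then show "a \<in> gevrey_series2 p q s" unfolding gevrey_series2_def using 1(1,4,5) by blast
qed

section \<open>Summability in a monomial\<close>

text \<open>The difference is the monomial x1^P x2^Q times a power series that its geometric
  majorant bounds on the polydisc.\<close>

lemma double_sum_tail:
  fixes c :: "'e::complex_banach series2"
  assumes u: "double_sum c x1 x2 u" and v: "double_sum (\<lambda>m j. if m < P \<or> j < Q then c m j else 0) x1 x2 v"
    and b: "\<And>m j. norm (c (m + P) (j + Q)) \<le> M * A ^ m * A ^ j" and A: "A > 0"
    and x: "(x1, x2) \<in> polydisc (1 / (2 * A))"
  shows "norm (u - v) \<le> 4 * M * cmod (x1 ^ P * x2 ^ Q)"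
proof -
  obtain t where t: "double_sum (\<lambda>m j. c (m + P) (j + Q)) x1 x2 t" "norm t \<le> 4 * M"
    using double_sum_half[of "\<lambda>m j. c (m + P) (j + Q)", OF b A x] by blast
  have "double_sum (\<lambda>m j. (if m < P \<or> j < Q then c m j else 0) +
      (if P \<le> m \<and> Q \<le> j then c (m - P + P) (j - Q + Q) else 0)) x1 x2 (v + (x1 ^ P * x2 ^ Q) *\<^sub>C t)"
    by (rule double_sum_add[OF v double_sum_shift[OF t(1)]])
  also have "(\<lambda>m j. (if m < P \<or> j < Q then c m j else 0) +
      (if P \<le> m \<and> Q \<le> j then c (m - P + P) (j - Q + Q) else 0)) = c"
    by (auto simp: fun_eq_iff)
  finally have "u = v + (x1 ^ P * x2 ^ Q) *\<^sub>C t" by (rule double_sum_unique[OF u])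
  then have "norm (u - v) = cmod (x1 ^ P * x2 ^ Q) * norm t" by (simp add: norm_scaleC)
  also have "\<dots> \<le> cmod (x1 ^ P * x2 ^ Q) * (4 * M)" using t(2) by (intro mult_left_mono) auto
  finally show ?thesis by (simp add: mult.commute)
qed

text \<open>The estimate is stated for the value v of the truncated double series instead of the
  functions f_n; \<open>double_sum_truncation\<close> links the two, and this form can be verified
  without reference to the decomposition. It holds on the full sector with fixed constants, hence on
  all proper subsectors.\<close>

lemma summable_in_directionI:
  fixes a :: "'e::complex_banach series2"
  assumes p: "p > 0" "q > 0" and k: "k > 0"
    and g: "gevrey_coeffs (1 / k / real p) a" "gevrey_coeffs (1 / k / real q) (\<lambda>n m. a m n)"
    and d: "(\<alpha> + \<beta>) / 2 = d" "\<beta> - \<alpha> > pi / k" "0 < r"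
    and hol: "holomorphic_map (monomial_sector p q \<alpha> \<beta> r) f" and CA: "C > 0" "A > 0"
    and est: "\<And>N w1 w2 v. (w1, w2) \<in> monomial_sector p q \<alpha> \<beta> r \<Longrightarrow>
        double_sum (\<lambda>m j. if m < N * p \<or> j < N * q then a m j else 0) (exp w1) (exp w2) v \<Longrightarrow>
        norm (f (w1, w2) - v) \<le> C * A ^ N * fact N powr (1 / k) * cmod (exp w1 ^ p * exp w2 ^ q) ^ N"
  shows "summable_in_direction p q k d a"
proof -
  have k': "1 / k \<ge> 0" using k by simp
  obtain r0 F where r0: "r0 > 0" and F: "\<And>r. 0 < r \<Longrightarrow> r \<le> r0 \<Longrightarrow> monomial_expansion p q r a F"
    using gevrey_expansion[OF p k' g] by metis
  define r' where "r' = min r r0"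
  have r': "0 < r'" "r' \<le> r" "r' \<le> r0" using d r0 by (auto simp: r'_def)
  have ex: "expands_2 r' (monomial_part p q a n) (F n)" for n
    using F[OF r'(1,3)] by (simp add: monomial_expansion_def)
  have "gevrey_asymptotic p q (1 / k) \<alpha> \<beta> r f a"
    unfolding gevrey_asymptotic_iff
  proof (rule exI[of _ r'], intro conjI r'(1,2), rule exI[of _ F], intro conjI F[OF r'(1,3)])
    have "norm (f (w1, w2) - (\<Sum>n<N. (exp w1 ^ p * exp w2 ^ q) ^ n *\<^sub>C F n (exp w1, exp w2)))
               \<le> C * A ^ N * fact N powr (1 / k) * cmod (exp w1 ^ p * exp w2 ^ q) ^ N"
      if w: "(w1, w2) \<in> monomial_sector p q \<alpha>' \<beta>' \<rho>" and "\<alpha> < \<alpha>'" "\<beta>' < \<beta>" "\<rho> < r'"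
        and pd: "(exp w1, exp w2) \<in> polydisc r'" for \<alpha>' \<beta>' \<rho> w1 w2 N
    proof (rule est)
      show "(w1, w2) \<in> monomial_sector p q \<alpha> \<beta> r"
        using that r' by (auto simp: monomial_sector_def)
      show "double_sum (\<lambda>m j. if m < N * p \<or> j < N * q then a m j else 0) (exp w1) (exp w2)
          (\<Sum>n<N. (exp w1 ^ p * exp w2 ^ q) ^ n *\<^sub>C F n (exp w1, exp w2))"
        by (rule double_sum_truncation) (use ex pd in \<open>auto simp: expands_2_iff polydisc_def\<close>)
    qed
    note bd = this
    show "sector_estimates p q (1 / k) \<alpha> \<beta> r' f F"
      unfolding sector_estimates_def
    proof (intro allI impI, elim conjE)
      fix \<alpha>' \<beta>' \<rho>
      assume 1: "\<alpha> < \<alpha>'" "\<beta>' < \<beta>" "\<rho> < r'"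
        and pd: "\<forall>(w1, w2)\<in>monomial_sector p q \<alpha>' \<beta>' \<rho>. (exp w1, exp w2) \<in> polydisc r'"
      have "\<forall>N. \<forall>(w1, w2)\<in>monomial_sector p q \<alpha>' \<beta>' \<rho>.
          norm (f (w1, w2) - (\<Sum>n<N. (exp w1 ^ p * exp w2 ^ q) ^ n *\<^sub>C F n (exp w1, exp w2)))
            \<le> C * A ^ N * fact N powr (1 / k) * cmod (exp w1 ^ p * exp w2 ^ q) ^ N"
        using bd[OF _ 1] pd by auto
      then show "\<exists>C>0. \<exists>A>0. \<forall>N. \<forall>(w1, w2)\<in>monomial_sector p q \<alpha>' \<beta>' \<rho>.
          norm (f (w1, w2) - (\<Sum>n<N. (exp w1 ^ p * exp w2 ^ q) ^ n *\<^sub>C F n (exp w1, exp w2)))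
            \<le> C * A ^ N * fact N powr (1 / k) * cmod (exp w1 ^ p * exp w2 ^ q) ^ N"
        using CA by blast
    qed
  qed
  moreover have "\<alpha> < \<beta>" using d(2) k pi_gt_zero by (smt (verit) divide_pos_pos)
  ultimately show ?thesis unfolding summable_in_direction_def using d hol by blast
qed

lemma holomorphic_map_exp:
  assumes "holomorphic_map (polydisc r) g"
  shows "holomorphic_map {(w1, w2). cmod (exp w1) < r \<and> cmod (exp w2) < r} (\<lambda>(w1, w2). g (exp w1, exp w2))"
  unfolding holomorphic_map_def
proof
  fix x :: "complex \<times> complex" assume "x \<in> {(w1, w2). cmod (exp w1) < r \<and> cmod (exp w2) < r}"
  then obtain w1 w2 where x: "x = (w1, w2)" and w: "(exp w1, exp w2) \<in> polydisc r"
    by (auto simp: polydisc_def)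
  define E where "E = (\<lambda>x::complex \<times> complex. (exp (fst x), exp (snd x)))"
  define L where "L = (\<lambda>h::complex \<times> complex. (exp w1 * fst h, exp w2 * snd h))"
  have E1: "((\<lambda>x::complex \<times> complex. exp (fst x)) has_derivative (\<lambda>h. exp w1 * fst h)) (at (w1, w2))"
    using has_derivative_compose[OF has_derivative_fst[OF has_derivative_ident] has_field_derivative_imp_has_derivative[OF DERIV_exp], of "(w1, w2)" UNIV] by simp
  have E2: "((\<lambda>x::complex \<times> complex. exp (snd x)) has_derivative (\<lambda>h. exp w2 * snd h)) (at (w1, w2))"
    using has_derivative_compose[OF has_derivative_snd[OF has_derivative_ident] has_field_derivative_imp_has_derivative[OF DERIV_exp], of "(w1, w2)" UNIV] by simp
  have E: "(E has_derivative L) (at (w1, w2))" unfolding E_def L_def by (rule has_derivative_Pair[OF E1 E2])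
  obtain D where D: "(g has_derivative D) (at (exp w1, exp w2))" "\<forall>c h. D (c *\<^sub>C h) = c *\<^sub>C D h"
    using assms w unfolding holomorphic_map_def by blast
  have "(g has_derivative D) (at (E (w1, w2)))" using D(1) by (simp add: E_def)
  from diff_chain_at[OF E this] have "(g \<circ> E has_derivative D \<circ> L) (at x)" by (simp add: x)
  moreover have "g \<circ> E = (\<lambda>(w1, w2). g (exp w1, exp w2))" by (auto simp: E_def)
  moreover have "(D \<circ> L) (c *\<^sub>C h) = c *\<^sub>C (D \<circ> L) h" for c h
  proof -
    have "L (c *\<^sub>C h) = c *\<^sub>C L h" by (simp add: L_def scaleC_prod_def scaleC_complex_def mult_ac)
    then show ?thesis unfolding o_def using D(2)[rule_format, of c "L h"] by (simp only:)
  qed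
  ultimately show "\<exists>D. ((\<lambda>(w1, w2). g (exp w1, exp w2)) has_derivative D) (at x) \<and> (\<forall>c h. D (c *\<^sub>C h) = c *\<^sub>C D h)"
    by metis
qed

lemma monomial_sector_in_polydisc:
  assumes "(w1, w2) \<in> monomial_sector p q \<alpha> \<beta> (r ^ (p + q))" "0 < r" "r \<le> 1" "p > 0" "q > 0"
  shows "cmod (exp w1) < r" "cmod (exp w2) < r"
proof -
  have "cmod (exp w1) ^ p < r ^ (p + q)" "cmod (exp w2) ^ q < r ^ (q + p)"
    using assms(1) unfolding monomial_sector_def by (auto simp: add.commute)
  then show "cmod (exp w1) < r" "cmod (exp w2) < r"
    using exp_small_in_polydisc assms(2-5) by blast+
qed

text \<open>The holomorphic function defined by the series serves as its sum in every direction,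
  without exceptions. The factor (N!)^(1/k) may be inserted because it is at least 1, and the sector
  from d - pi/k to d + pi/k has twice the critical opening.\<close>

lemma gevrey_coeffs_0_imp_summable:
  fixes a :: "'e::complex_banach series2"
  assumes p: "p > 0" "q > 0" and k: "k > 0" and a: "gevrey_coeffs 0 a"
  shows "a \<in> summable_series2 p q k"
proof -
  have a': "gevrey_coeffs 0 (\<lambda>n m. a m n)" by (rule iffD2[OF gevrey_coeffs_0_swap a])
  have g: "gevrey_coeffs (1 / k / real p) a" "gevrey_coeffs (1 / k / real q) (\<lambda>n m. a m n)"
    by (rule gevrey_coeffs_mono[OF a], use k in simp, rule gevrey_coeffs_mono[OF a'], use k in simp)
  have k': "1 / k \<ge> 0" using k by simp
  have aC: "a \<in> series_C" using gevrey_expansion[OF p k' g] by metis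
  obtain C A where CA: "C \<ge> 1" "A \<ge> 1" and b: "\<And>n m. norm (a n m) \<le> C * A ^ n * A ^ m * fact n powr 0"
    using gevrey_coeffsE[OF a a'] by metis
  have b: "norm (a n m) \<le> C * A ^ n * A ^ m" for n m using b[of n m] by simp
  define r where "r = 1 / (2 * A)"
  have r: "0 < r" "r \<le> 1" using CA by (auto simp: r_def)
  have "\<exists>v. double_sum a (fst x) (snd x) v \<and> norm v \<le> 4 * C" if "x \<in> polydisc r" for x
    by (rule double_sum_half[OF b]) (use that CA in \<open>auto simp: r_def\<close>)
  then obtain h where h: "\<And>x. x \<in> polydisc r \<Longrightarrow> double_sum a (fst x) (snd x) (h x)" by metis
  have ex: "expands_2 r a h" using h by (force simp: expands_2_iff polydisc_def)
  define f where "f = (\<lambda>(w1, w2). h (exp w1, exp w2))"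
  have in_pd: "(exp w1, exp w2) \<in> polydisc r" if "(w1, w2) \<in> monomial_sector p q \<alpha> \<beta> (r ^ (p + q))" for w1 w2 \<alpha> \<beta>
    using monomial_sector_in_polydisc[OF that r p] by (simp add: polydisc_def del: norm_exp_eq_Re)
  have "summable_in_direction p q k d a" for d
  proof (rule summable_in_directionI[OF p k g])
    have "pi / k > 0" using k by simp
    then show "pi / k < d + pi / k - (d - pi / k)" by linarith
    show "(d - pi / k + (d + pi / k)) / 2 = d" by simp
    show "0 < r ^ (p + q)" "4 * C > 0" "A ^ (p + q) > 0" using r CA by auto
    show "holomorphic_map (monomial_sector p q (d - pi / k) (d + pi / k) (r ^ (p + q))) f"
      unfolding f_def
    proof (rule holomorphic_map_subset[OF holomorphic_map_exp[OF expands_2_holomorphic[OF ex]]])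
      show "monomial_sector p q (d - pi / k) (d + pi / k) (r ^ (p + q)) \<subseteq> {(w1, w2). cmod (exp w1) < r \<and> cmod (exp w2) < r}"
        using monomial_sector_in_polydisc[OF _ r p] by blast
    qed
    fix N w1 w2 v
    assume w: "(w1, w2) \<in> monomial_sector p q (d - pi / k) (d + pi / k) (r ^ (p + q))"
      and v: "double_sum (\<lambda>m j. if m < N * p \<or> j < N * q then a m j else 0) (exp w1) (exp w2) v"
    have u: "double_sum a (exp w1) (exp w2) (f (w1, w2))" using h[OF in_pd[OF w]] by (simp add: f_def)
    have "norm (f (w1, w2) - v) \<le> 4 * (C * A ^ (N * (p + q))) * cmod (exp w1 ^ (N * p) * exp w2 ^ (N * q))"
    proof (rule double_sum_tail[OF u v])
      show "norm (a (m + N * p) (j + N * q)) \<le> C * A ^ (N * (p + q)) * A ^ m * A ^ j" for m j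
        using b[of "m + N * p" "j + N * q"] by (simp add: power_add distrib_left mult_ac)
    qed (use in_pd[OF w] CA in \<open>auto simp: r_def\<close>)
    also have "\<dots> = 4 * C * (A ^ (p + q)) ^ N * 1 * cmod (exp w1 ^ p * exp w2 ^ q) ^ N"
      by (simp only: mult.commute[of N] power_mult norm_mult norm_power power_mult_distrib mult_1_right mult.assoc)
    also have "\<dots> \<le> 4 * C * (A ^ (p + q)) ^ N * fact N powr (1 / k) * cmod (exp w1 ^ p * exp w2 ^ q) ^ N"
      using CA k by (intro mult_right_mono mult_left_mono ge_one_powr_ge_zero fact_ge_1) auto
    finally show "norm (f (w1, w2) - v) \<le> 4 * C * (A ^ (p + q)) ^ N * fact N powr (1 / k) * cmod (exp w1 ^ p * exp w2 ^ q) ^ N" .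
  qed
  then show ?thesis using aC unfolding summable_series2_def by (intro CollectI conjI exI[of _ "{}"]) auto
qed

section \<open>Proportional monomials\<close>

text \<open>The partial sum of order N for (p', q') is compared with that of order M for (p, q),
  where M is p' N / p rounded up. Proportionality makes the corner (M p, M q) exceed (N p', N q') by
  less than (p, q), so the two truncations differ on an L of bounded width, where the coefficients
  are of the order of the remainder. Because s/p = s'/p', the factor (M!)^s is bounded by (N!)^s' up
  to geometric factors.\<close>

lemma scaled_sums_agree:
  fixes a :: "'e::complex_banach series2"
  assumes p: "p > 0" "q > 0" "p' > 0" "q' > 0" and s: "s > 0" "s' > 0"
    and ratio: "q * p' = p * q'" "s / real p = s' / real p'"
    and g: "gevrey_coeffs (s / real p) a" "gevrey_coeffs (s / real q) (\<lambda>n m. a m n)"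
    and D: "direction_data p q s d \<eta> \<rho> C A f F a" and C: "C > 0" and A: "A > 0" and \<rho>: "\<rho> > 0"
  obtains r C' A' where "0 < r" "r \<le> 1" "r \<le> \<rho>" "C' > 0" "A' > 0"
    "\<And>N w1 w2 v. cmod (exp w1) < r \<Longrightarrow> cmod (exp w2) < r \<Longrightarrow> \<bar>real p * Im w1 + real q * Im w2 - d\<bar> < \<eta> \<Longrightarrow>
        double_sum (\<lambda>m j. if m < N * p' \<or> j < N * q' then a m j else 0) (exp w1) (exp w2) v \<Longrightarrow>
        norm (f (w1, w2) - v) \<le> C' * A' ^ N * fact N powr s' * cmod (exp w1 ^ p' * exp w2 ^ q') ^ N"
proof -
  have s0: "s \<ge> 0" "s' \<ge> 0" using s by auto
  have ratio': "s / real q = s' / real q'"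
  proof -
    have "real q * real p' = real p * real q'" by (simp only: ratio(1) flip: of_nat_mult)
    then have "real q = real p * real q' / real p'" using p by (simp add: field_simps)
    then have "s / real q = s / real p * (real p' / real q')" by simp
    then show ?thesis unfolding ratio(2) using p by simp
  qed
  obtain C0 A0 where CA0: "C0 \<ge> 1" "A0 \<ge> 1" and a1: "\<And>n m. norm (a n m) \<le> C0 * A0 ^ n * A0 ^ m * fact n powr (s' / real p')"
    and a2: "\<And>n m. norm (a n m) \<le> C0 * A0 ^ n * A0 ^ m * fact m powr (s' / real q')"
    using gevrey_coeffsE[OF g] unfolding ratio(2) ratio' by metis
  obtain K B where KB: "K \<ge> 1" "B \<ge> 1" and
    b: "\<And>N m j. m \<le> p \<or> j \<le> q \<Longrightarrow> norm (a (m + N * p') (j + N * q')) \<le> K * B ^ N * fact N powr s' * A0 ^ m * A0 ^ j"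
    using shifted_coeff_bound[OF p(3,4) s0(2) CA0 a1 a2, of p q] by blast
  obtain K2 B2 where K2: "K2 \<ge> 1" "B2 \<ge> 1" and f2: "\<And>N M. p * N \<le> M + p \<Longrightarrow> fact N powr s \<le> K2 * B2 ^ M * fact M powr (s / real p)"
    using fact_powr_le_of_mult_le[OF p(1) s0(1)] by blast
  obtain K3 B3 where K3: "K3 \<ge> 1" "B3 \<ge> 1" and f3: "\<And>N. fact (p' * (N + 1)) powr (s' / real p') \<le> K3 * B3 ^ N * fact N powr s'"
    using fact_mult_powr_le[OF p(3) s0(2)] by blast
  define A1 where "A1 = max A 1"
  have A1: "A1 \<ge> 1" "A \<le> A1" by (auto simp: A1_def)
  define r where "r = min (min \<rho> 1) (1 / (2 * A0))"
  have r: "0 < r" "r \<le> 1" "r \<le> \<rho>" "r \<le> 1 / (2 * A0)" using \<rho> CA0 by (auto simp: r_def)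
  define C' where "C' = C * A1 * (K2 * K3) + 4 * K"
  define A' where "A' = max ((A1 * B2) ^ p' * B3) B"
  have C': "C' > 0" unfolding C'_def using C A1 K2 K3 KB by (intro add_pos_pos mult_pos_pos) auto
  have A': "A' > 0" "B \<le> A'" "(A1 * B2) ^ p' * B3 \<le> A'" using KB by (auto simp: A'_def)
  show thesis
  proof (rule that[OF r(1-3) C' A'(1)])
    fix N w1 w2 v
    assume w: "cmod (exp w1) < r" "cmod (exp w2) < r" "\<bar>real p * Im w1 + real q * Im w2 - d\<bar> < \<eta>"
      and v: "double_sum (\<lambda>m j. if m < N * p' \<or> j < N * q' then a m j else 0) (exp w1) (exp w2) v"
    \<comment> \<open>Adding p - 1 before dividing rounds up.\<close>
    define M where "M = (p' * N + (p - 1)) div p"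
    have Mp: "N * p' \<le> M * p" "M * p < N * p' + p"
    proof -
      have "M * p + (p' * N + (p - 1)) mod p = p' * N + (p - 1)" unfolding M_def by (rule div_mult_mod_eq)
      moreover have "(p' * N + (p - 1)) mod p < p" using p by simp
      moreover have "p' * N = N * p'" by simp
      ultimately show "N * p' \<le> M * p" "M * p < N * p' + p" using p(1) by linarith+
    qed
    \<comment> \<open>Multiplied by p, these inequalities are q times those for the first
      variable.\<close>
    have Mq: "N * q' \<le> M * q" "M * q < N * q' + q"
    proof -
      have e: "p * (N * q') = q * (N * p')" "p * (M * q) = q * (M * p)" "p * (N * q' + q) = q * (N * p' + p)"
        using ratio(1) by (simp_all add: algebra_simps)
      have "p * (N * q') \<le> p * (M * q)" unfolding e using Mp(1) by simp
      then show "N * q' \<le> M * q" using p by simp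
      have "p * (M * q) < p * (N * q' + q)" unfolding e using Mp(2) p by simp
      then show "M * q < N * q' + q" using p by simp
    qed
    have pd: "(exp w1, exp w2) \<in> polydisc (1 / (2 * A0))"
      using w r(4) by (simp add: polydisc_def del: norm_exp_eq_Re)
    have lnw: "Re w < ln \<rho>" if "cmod (exp w) < r" for w
    proof -
      have "exp (Re w) < exp (ln \<rho>)" using that r(3) \<rho> by simp
      then show ?thesis by (simp only: exp_less_cancel_iff)
    qed
    define u where "u = (\<Sum>n<M. (exp w1 ^ p * exp w2 ^ q) ^ n *\<^sub>C F n (exp w1, exp w2))"
    have u: "double_sum (\<lambda>m j. if m < M * p \<or> j < M * q then a m j else 0) (exp w1) (exp w2) u"
      unfolding u_def
    proof (rule double_sum_truncation)
      have "cmod (exp w1) < \<rho>" "cmod (exp w2) < \<rho>" using w r(3) by linarith+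
      then show "double_sum (monomial_part p q a n) (exp w1) (exp w2) (F n (exp w1, exp w2))" for n
        using D unfolding direction_data_def expands_2_iff by blast
    qed
    have "norm (f (w1, w2) - u) \<le> C * A ^ M * fact M powr s * cmod (exp w1 ^ p * exp w2 ^ q) ^ M"
      unfolding u_def using D lnw[OF w(1)] lnw[OF w(2)] w(3) unfolding direction_data_def by blast
    also have "cmod (exp w1 ^ p * exp w2 ^ q) ^ M = cmod (exp w1) ^ (M * p) * cmod (exp w2) ^ (M * q)"
      by (simp only: mult.commute[of M] norm_mult norm_power power_mult_distrib power_mult)
    also have "C * A ^ M * fact M powr s * (cmod (exp w1) ^ (M * p) * cmod (exp w2) ^ (M * q))
      \<le> C * (A1 * (A1 ^ p') ^ N) * (K2 * (B2 ^ p') ^ N * (K3 * B3 ^ N * fact N powr s')) *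
        (cmod (exp w1) ^ (N * p') * cmod (exp w2) ^ (N * q'))"
    proof (intro mult_mono)
      have "p * M \<le> p' * N + p" using Mp(2) by (simp add: mult.commute)
      from f2[OF this] have "fact M powr s \<le> K2 * B2 ^ (p' * N) * fact (p' * N) powr (s' / real p')" unfolding ratio(2) .
      also have "\<dots> \<le> K2 * B2 ^ (p' * N) * fact (p' * (N + 1)) powr (s' / real p')"
        using K2 s p by (intro mult_left_mono powr_mono2 fact_mono) auto
      also have "\<dots> \<le> K2 * B2 ^ (p' * N) * (K3 * B3 ^ N * fact N powr s')"
        using K2 f3[of N] by (intro mult_left_mono) auto
      finally show "fact M powr s \<le> K2 * (B2 ^ p') ^ N * (K3 * B3 ^ N * fact N powr s')" by (simp only: power_mult)
      \<comment> \<open>A crude bound, but linear in N, which is all that the geometric factor A1^M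
        requires.\<close>
      have "M \<le> p' * N + 1"
      proof (rule ccontr)
        assume "\<not> M \<le> p' * N + 1"
        then have "p * (p' * N + 2) \<le> p * M" by (intro mult_le_mono2) simp
        then have "p * (p' * N) + p * 2 \<le> M * p" by (simp only: distrib_left mult.commute[of M])
        moreover have "N * p' \<le> p * (p' * N)" using p by (simp add: mult.commute)
        ultimately show False using Mp(2) by linarith
      qed
      then have "A1 ^ M \<le> A1 ^ (p' * N + 1)" using A1 by (intro power_increasing) auto
      moreover have "A ^ M \<le> A1 ^ M" using A A1 by (intro power_mono) auto
      moreover have "A1 ^ (p' * N + 1) = A1 * (A1 ^ p') ^ N" by (simp add: power_mult)
      ultimately show "A ^ M \<le> A1 * (A1 ^ p') ^ N" by linarith
      have "cmod (exp w1) \<le> 1" "cmod (exp w2) \<le> 1" using w r(2) by linarith+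
      then show "cmod (exp w1) ^ (M * p) \<le> cmod (exp w1) ^ (N * p')" "cmod (exp w2) ^ (M * q) \<le> cmod (exp w2) ^ (N * q')"
        using Mp(1) Mq(1) by (intro power_decreasing; simp)+
    qed (use C A A1 K2 K3 in auto)
    also have "\<dots> = C * A1 * (K2 * K3) * ((A1 * B2) ^ p' * B3) ^ N * fact N powr s' *
        (cmod (exp w1) ^ (N * p') * cmod (exp w2) ^ (N * q'))"
      by (simp only: power_mult_distrib mult_ac)
    also have "\<dots> \<le> C * A1 * (K2 * K3) * A' ^ N * fact N powr s' *
        (cmod (exp w1) ^ (N * p') * cmod (exp w2) ^ (N * q'))"
      using C A1 K2 K3 A' by (intro mult_right_mono mult_left_mono power_mono) auto
    finally have 1: "norm (f (w1, w2) - u) \<le> C * A1 * (K2 * K3) * A' ^ N * fact N powr s' *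
        (cmod (exp w1) ^ (N * p') * cmod (exp w2) ^ (N * q'))" .
    have "norm (u - v) \<le> 4 * (K * B ^ N * fact N powr s') * cmod (exp w1 ^ (N * p') * exp w2 ^ (N * q'))"
    proof (rule double_sum_tail[OF u _ _ _ pd])
      have "(\<lambda>m j. if m < N * p' \<or> j < N * q' then if m < M * p \<or> j < M * q then a m j else 0 else 0) =
          (\<lambda>m j. if m < N * p' \<or> j < N * q' then a m j else 0)"
        using Mp(1) Mq(1) by (auto simp: fun_eq_iff)
      then show "double_sum (\<lambda>m j. if m < N * p' \<or> j < N * q' then if m < M * p \<or> j < M * q then a m j else 0 else 0)
          (exp w1) (exp w2) v" using v by simp
      fix m j
      show "norm (if m + N * p' < M * p \<or> j + N * q' < M * q then a (m + N * p') (j + N * q') else 0)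
          \<le> K * B ^ N * fact N powr s' * A0 ^ m * A0 ^ j"
      proof (cases "m + N * p' < M * p \<or> j + N * q' < M * q")
        case True
        then have "m \<le> p \<or> j \<le> q" using Mp(2) Mq(2) by auto
        from b[OF this, of N] show ?thesis using True by simp
      next
        case False
        then show ?thesis using KB CA0 by simp
      qed
    qed (use CA0 in auto)
    also have "\<dots> = 4 * K * B ^ N * fact N powr s' * (cmod (exp w1) ^ (N * p') * cmod (exp w2) ^ (N * q'))"
      by (simp only: norm_mult norm_power mult.assoc)
    also have "\<dots> \<le> 4 * K * A' ^ N * fact N powr s' * (cmod (exp w1) ^ (N * p') * cmod (exp w2) ^ (N * q'))"
      using KB A' by (intro mult_right_mono mult_left_mono power_mono) auto
    finally have 2: "norm (u - v) \<le> 4 * K * A' ^ N * fact N powr s' * (cmod (exp w1) ^ (N * p') * cmod (exp w2) ^ (N * q'))" .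
    have "norm (f (w1, w2) - v) \<le> norm (f (w1, w2) - u) + norm (u - v)"
      using norm_triangle_ineq[of "f (w1, w2) - u" "u - v"] by simp
    also have "\<dots> \<le> C' * A' ^ N * fact N powr s' * (cmod (exp w1) ^ (N * p') * cmod (exp w2) ^ (N * q'))"
      using add_mono[OF 1 2] by (simp only: C'_def distrib_right)
    also have "cmod (exp w1) ^ (N * p') * cmod (exp w2) ^ (N * q') = cmod (exp w1 ^ p' * exp w2 ^ q') ^ N"
      by (simp only: mult.commute[of N] norm_mult norm_power power_mult_distrib power_mult)
    finally show "norm (f (w1, w2) - v) \<le> C' * A' ^ N * fact N powr s' * cmod (exp w1 ^ p' * exp w2 ^ q') ^ N" .
  qed
qed

text \<open>On logarithms p w1 + q w2 = c (p' w1 + q' w2) with c = p/p'. So a direction d' of the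
  second monomial is the direction c d' of the first, and openings scale in the same way: pi/l =
  pi/(k c).\<close>

lemma summable_series2_proportional:
  fixes a :: "'e::complex_banach series2"
  assumes p: "p > 0" "q > 0" "p' > 0" "q' > 0" and k: "k > 0" "l > 0"
    and ratio: "q * p' = p * q'" "k * real p = l * real p'"
    and a: "a \<in> summable_series2 p q k"
  shows "a \<in> summable_series2 p' q' l"
proof -
  have M: "multi_direction_data p q (1 / k) a" by (rule multi_direction_data_of_summable[OF a p(1,2) k(1)])
  have s: "1 / k > 0" "1 / l > 0" using k by auto
  have g: "gevrey_coeffs (1 / k / real p) a" "gevrey_coeffs (1 / k / real q) (\<lambda>n m. a m n)"
    by (rule gevrey_coeffs_of_multi_direction_data[OF M p(1,2) s(1)],
        rule gevrey_coeffs_of_multi_direction_data[OF multi_direction_data_swap[OF M] p(2,1) s(1)])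
  have ratio2: "1 / k / real p = 1 / l / real p'" using ratio(2) by simp
  have "real q * real p' = real p * real q'" by (simp only: ratio(1) flip: of_nat_mult)
  then have qp: "real q = real p / real p' * real q'" using p by (simp add: field_simps)
  then have "k * real q = k * real p / real p' * real q'" by simp
  also have "\<dots> = l * real q'" unfolding ratio(2) using p by simp
  finally have ratio3: "1 / k / real q = 1 / l / real q'" by simp
  obtain D where D: "finite D" "\<And>d. (\<forall>e\<in>D. \<forall>j::int. d \<noteq> e + 2 * pi * of_int j) \<Longrightarrow> summable_in_direction p q k d a"
    using a unfolding summable_series2_def by blast
  define c where "c = real p / real p'"
  have c: "c > 0" "k * c = l" using p ratio(2) by (auto simp: c_def field_simps)
  have pc: "real p = c * real p'" "real q = c * real q'" using p qp by (auto simp: c_def)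
  \<comment> \<open>Dividing e + 2 pi j by c can split one class modulo 2 pi into several. Writing j
    = p i + j0, the part p i contributes 2 pi p' i, a multiple of 2 pi; so the p residues j0
    represent all classes.\<close>
  define D' where "D' = (\<lambda>(e, j). (e + 2 * pi * real j) / c) ` (D \<times> {..<p})"
  have "finite D'" using D(1) by (simp add: D'_def)
  moreover have "summable_in_direction p' q' l d' a" if d': "\<forall>e\<in>D'. \<forall>j::int. d' \<noteq> e + 2 * pi * of_int j" for d'
  proof -
    define d where "d = c * d'"
    have d: "d' = d / c" using c by (simp add: d_def)
    have "d \<noteq> e + 2 * pi * of_int j" if e: "e \<in> D" for e and j :: int
    proof
      assume eq: "d = e + 2 * pi * of_int j"
      define j0 where "j0 = nat (j mod int p)"
      define i where "i = j div int p"
      have j0: "j0 < p" "int j0 = j mod int p" using p by (auto simp: j0_def nat_less_iff)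
      have "j = int p * i + int j0" unfolding i_def j0(2) by simp
      then have "(of_int j :: real) = real p * of_int i + real j0" by simp
      then have "d' = (e + 2 * pi * real j0) / c + 2 * pi * (real p / c * of_int i)"
        unfolding d eq using c by (simp add: field_simps)
      also have "real p / c * of_int i = of_int (int p' * i)" using p by (simp add: c_def)
      finally have "d' = (e + 2 * pi * real j0) / c + 2 * pi * of_int (int p' * i)" .
      moreover have "(e + 2 * pi * real j0) / c \<in> D'" unfolding D'_def using e j0(1) by force
      ultimately show False using d' by blast
    qed
    then have "summable_in_direction p q k d a" using D(2) by blast
    then obtain \<eta> \<rho> C A f F where \<eta>: "\<eta> > pi / (2 * k)" and \<rho>: "0 < \<rho>" and CA: "C > 0" "A > 0"
      and DD: "direction_data p q (1 / k) d \<eta> \<rho> C A f F a"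
      using direction_data_of_summable[OF _ p(1,2) k(1)] by metis
    obtain r C' A' where r: "0 < r" "r \<le> 1" "r \<le> \<rho>" and CA': "C' > 0" "A' > 0" and
      est: "\<And>N w1 w2 v. cmod (exp w1) < r \<Longrightarrow> cmod (exp w2) < r \<Longrightarrow> \<bar>real p * Im w1 + real q * Im w2 - d\<bar> < \<eta> \<Longrightarrow>
        double_sum (\<lambda>m j. if m < N * p' \<or> j < N * q' then a m j else 0) (exp w1) (exp w2) v \<Longrightarrow>
        norm (f (w1, w2) - v) \<le> C' * A' ^ N * fact N powr (1 / l) * cmod (exp w1 ^ p' * exp w2 ^ q') ^ N"
      by (rule scaled_sums_agree[OF p s ratio(1) ratio2 g DD CA \<rho>]) (rule that; blast)
    define \<alpha> where "\<alpha> = (d - \<eta>) / c"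
    define \<beta> where "\<beta> = (d + \<eta>) / c"
    have sec: "cmod (exp w1) < r" "cmod (exp w2) < r" "\<bar>real p * Im w1 + real q * Im w2 - d\<bar> < \<eta>"
      if w: "(w1, w2) \<in> monomial_sector p' q' \<alpha> \<beta> (r ^ (p' + q'))" for w1 w2
    proof -
      show "cmod (exp w1) < r" "cmod (exp w2) < r" by (rule monomial_sector_in_polydisc[OF w r(1,2) p(3,4)])+
      define X where "X = real p' * Im w1 + real q' * Im w2"
      have "\<alpha> < X" "X < \<beta>" using w by (auto simp: monomial_sector_def X_def)
      then have "d - \<eta> < c * X" "c * X < d + \<eta>" using c by (auto simp: \<alpha>_def \<beta>_def field_simps)
      moreover have "c * X = real p * Im w1 + real q * Im w2" unfolding pc X_def by (simp add: algebra_simps)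
      ultimately show "\<bar>real p * Im w1 + real q * Im w2 - d\<bar> < \<eta>" by (simp add: abs_less_iff)
    qed
    show ?thesis
    proof (rule summable_in_directionI[OF p(3,4) k(2) g[unfolded ratio2 ratio3] _ _ _ _ CA'])
      show "(\<alpha> + \<beta>) / 2 = d'" by (simp add: \<alpha>_def \<beta>_def d add_divide_distrib[symmetric])
      have "\<beta> - \<alpha> = 2 * \<eta> / c" by (simp add: \<alpha>_def \<beta>_def diff_divide_distrib[symmetric])
      moreover have "pi / l = 2 * (pi / (2 * k)) / c" using c k by (simp add: field_simps)
      moreover have "2 * (pi / (2 * k)) / c < 2 * \<eta> / c" using \<eta> c(1) by (intro divide_strict_right_mono mult_strict_left_mono) auto
      ultimately show "pi / l < \<beta> - \<alpha>" by (simp only:)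
      show "0 < r ^ (p' + q')" using r by simp
      show "holomorphic_map (monomial_sector p' q' \<alpha> \<beta> (r ^ (p' + q'))) f"
      proof (rule holomorphic_map_subset)
        show "holomorphic_map {(w1, w2). Re w1 < ln \<rho> \<and> Re w2 < ln \<rho> \<and> \<bar>real p * Im w1 + real q * Im w2 - d\<bar> < \<eta>} f"
          using DD unfolding direction_data_def by blast
        have lnw: "Re w < ln \<rho>" if "cmod (exp w) < r" for w
        proof -
          have "exp (Re w) < exp (ln \<rho>)" using that r(3) \<rho> by simp
          then show ?thesis by (simp only: exp_less_cancel_iff)
        qed
        show "monomial_sector p' q' \<alpha> \<beta> (r ^ (p' + q')) \<subseteq>
            {(w1, w2). Re w1 < ln \<rho> \<and> Re w2 < ln \<rho> \<and> \<bar>real p * Im w1 + real q * Im w2 - d\<bar> < \<eta>}"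
          using sec lnw by blast
      qed
      show "norm (f (w1, w2) - v) \<le> C' * A' ^ N * fact N powr (1 / l) * cmod (exp w1 ^ p' * exp w2 ^ q') ^ N"
        if "(w1, w2) \<in> monomial_sector p' q' \<alpha> \<beta> (r ^ (p' + q'))"
          "double_sum (\<lambda>m j. if m < N * p' \<or> j < N * q' then a m j else 0) (exp w1) (exp w2) v" for N w1 w2 v
        by (rule est[OF sec[OF that(1)] that(2)])
    qed
  qed
  moreover have "a \<in> series_C" using a by (simp add: summable_series2_def)
  ultimately show ?thesis unfolding summable_series2_def by blast
qed

section \<open>Combination of the two conditions\<close>

lemma summable_gevrey_imp_convergent:
  fixes a :: "'e::complex_banach series2"
  assumes M: "multi_direction_data p q s a" and p: "p > 0" "q > 0" "s > 0"
    and g: "gevrey_coeffs \<sigma> a" "gevrey_coeffs \<tau> (\<lambda>n m. a m n)" and pos: "\<sigma> > 0" "\<tau> > 0"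
    and small: "\<sigma> < s / real p \<or> \<tau> < s / real q"
  shows "gevrey_coeffs 0 a"
  using small
proof
  assume "\<sigma> < s / real p"
  then show ?thesis using tauberian_two_variables[OF M p g(1) pos(1)] by blast
next
  assume "\<tau> < s / real q"
  then have "gevrey_coeffs 0 (\<lambda>n m. a m n)"
    using tauberian_two_variables[OF multi_direction_data_swap[OF M] p(2,1,3) g(2) pos(2)] by blast
  then show ?thesis by (rule iffD1[OF gevrey_coeffs_0_swap])
qed

theorem theorem3p8:
  fixes p q p' q' :: nat and k l :: real
  assumes "p > 0" and "q > 0" and "p' > 0" and "q' > 0" and "k > 0" and "l > 0"
  shows "(max (real p / real p') (real q / real q') < l / k \<longrightarrow>
            (summable_series2 p q k :: 'e::complex_banach series2 set)
               \<inter> gevrey_series2 p' q' (1 / l) = convergent_series2)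
       \<and> (\<not> (real p / real p' = real q / real q' \<and> real q / real q' = l / k) \<longrightarrow>
            (summable_series2 p q k :: 'e series2 set)
               \<inter> summable_series2 p' q' l = convergent_series2)
       \<and> (real p / real p' = real q / real q' \<and> real q / real q' = l / k \<longrightarrow>
            (summable_series2 p q k :: 'e series2 set) = summable_series2 p' q' l)"
proof -
  note p = assms(1,2) and p' = assms(3,4) and k = assms(5) and l = assms(6)
  have s: "1 / k > 0" "1 / l > 0" using k l by auto
  have M: "multi_direction_data p q (1 / k) a" if "a \<in> summable_series2 p q k" for a :: "'e series2"
    by (rule multi_direction_data_of_summable[OF that p k])
  have M': "multi_direction_data p' q' (1 / l) a" if "a \<in> summable_series2 p' q' l" for a :: "'e series2"
    by (rule multi_direction_data_of_summable[OF that p' l])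
  have pos: "1 / k / real p > 0" "1 / k / real q > 0" "1 / l / real p' > 0" "1 / l / real q' > 0"
    using assms by auto
  have ser: "a \<in> gevrey_series2 p' q' (1 / l) \<longleftrightarrow>
      gevrey_coeffs (1 / l / real p') a \<and> gevrey_coeffs (1 / l / real q') (\<lambda>n m. a m n)" for a :: "'e series2"
    by (rule gevrey_series2_iff[OF p' less_imp_le[OF s(2)]])
  show ?thesis
  proof (intro conjI impI)
    assume "max (real p / real p') (real q / real q') < l / k"
    then have lt: "1 / l / real p' < 1 / k / real p" using assms by (simp add: field_simps)
    show "(summable_series2 p q k :: 'e series2 set) \<inter> gevrey_series2 p' q' (1 / l) = convergent_series2"
    proof (intro equalityI subsetI)
      fix a :: "'e series2" assume a: "a \<in> summable_series2 p q k \<inter> gevrey_series2 p' q' (1 / l)"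
      then have "gevrey_coeffs (1 / l / real p') a" unfolding Int_iff ser by blast
      then have "gevrey_coeffs 0 a" using tauberian_two_variables[OF M p s(1) _ pos(3) lt] a by blast
      then show "a \<in> convergent_series2" by (simp add: convergent_series2_iff)
    next
      fix a :: "'e series2" assume "a \<in> convergent_series2"
      then have g: "gevrey_coeffs 0 a" by (simp add: convergent_series2_iff)
      have "gevrey_coeffs (1 / l / real p') a" "gevrey_coeffs (1 / l / real q') (\<lambda>n m. a m n)"
        by (rule gevrey_coeffs_mono[OF g less_imp_le[OF pos(3)]],
            rule gevrey_coeffs_mono[OF iffD2[OF gevrey_coeffs_0_swap g] less_imp_le[OF pos(4)]])
      then show "a \<in> summable_series2 p q k \<inter> gevrey_series2 p' q' (1 / l)"
        unfolding Int_iff ser using gevrey_coeffs_0_imp_summable[OF p k g] by blast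
    qed
  next
    assume ne: "\<not> (real p / real p' = real q / real q' \<and> real q / real q' = l / k)"
    show "(summable_series2 p q k :: 'e series2 set) \<inter> summable_series2 p' q' l = convergent_series2"
    proof (intro equalityI subsetI)
      fix a :: "'e series2" assume a: "a \<in> summable_series2 p q k \<inter> summable_series2 p' q' l"
      then have D: "multi_direction_data p q (1 / k) a" "multi_direction_data p' q' (1 / l) a" using M M' by auto
      note g = gevrey_coeffs_of_multi_direction_data[OF D(1) p s(1)]
        gevrey_coeffs_of_multi_direction_data[OF multi_direction_data_swap[OF D(1)] p(2,1) s(1)]
      note g' = gevrey_coeffs_of_multi_direction_data[OF D(2) p' s(2)]
        gevrey_coeffs_of_multi_direction_data[OF multi_direction_data_swap[OF D(2)] p'(2,1) s(2)]
      have "1 / k / real p \<noteq> 1 / l / real p' \<or> 1 / k / real q \<noteq> 1 / l / real q'"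
      proof -
        have "1 / k / x = 1 / l / y \<longleftrightarrow> x / y = l / k" if "x > 0" "y > 0" for x y
          using k l that by (auto simp: divide_simps mult.commute)
        then show ?thesis using ne assms by auto
      qed
      \<comment> \<open>The exponents differ in some variable. The condition with the smaller
        exponent there supplies the Gevrey bounds, and the other one acts as the summability
        hypothesis.\<close>
      then have "(1 / l / real p' < 1 / k / real p \<or> 1 / l / real q' < 1 / k / real q) \<or>
          (1 / k / real p < 1 / l / real p' \<or> 1 / k / real q < 1 / l / real q')" by linarith
      then have "gevrey_coeffs 0 a"
        using summable_gevrey_imp_convergent[OF D(1) p s(1) g' pos(3,4)]
          summable_gevrey_imp_convergent[OF D(2) p' s(2) g pos(1,2)] by blast
      then show "a \<in> convergent_series2" by (simp add: convergent_series2_iff)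
    next
      fix a :: "'e series2" assume "a \<in> convergent_series2"
      then show "a \<in> summable_series2 p q k \<inter> summable_series2 p' q' l"
        unfolding convergent_series2_iff Int_iff using gevrey_coeffs_0_imp_summable[OF p k] gevrey_coeffs_0_imp_summable[OF p' l] by blast
    qed
  next
    assume eq: "real p / real p' = real q / real q' \<and> real q / real q' = l / k"
    then have "real q * real p' = real p * real q'" using assms by (simp add: field_simps)
    then have 1: "q * p' = p * q'" by (simp only: of_nat_eq_iff flip: of_nat_mult)
    have "real p / real p' = l / k" using eq by simp
    then have 2: "k * real p = l * real p'" using assms by (simp add: field_simps)
    have swapped: "q' * p = p' * q" using 1 by (simp add: mult.commute)
    show "(summable_series2 p q k :: 'e series2 set) = summable_series2 p' q' l"
      using summable_series2_proportional[OF p p' k l 1 2]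
        summable_series2_proportional[OF p' p l k swapped 2[symmetric]] by blast
  qed
qed

end
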